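(* There exist constants $c_1, c_2 > 0$ and an infinite set of integers $A \subset \mathbb{N}$ such that the following holds. If $n \in A$ and $p > 5 \log n$, then the function $E: (\mathbb{T}^2)^n \rightarrow \mathbb{R}$ given by $$ E(x_1, x_2, \dots, x_n) = \sum_{i,j=1,\ i \neq j}^{n} \frac{1}{\|x_i - x_j\|^p}$$ has at least $c_1 \exp(c_2 \sqrt{n})$ critical points, where critical points are counted after all symmetries (relabeling of the points and isometries of $\mathbb{T}^2$) have been factored out.
   Context: $\mathbb{T}^2 \cong [0,1]^2$ is the two-dimensional flat torus $\mathbb{R}^2/\mathbb{Z}^2$, and $\|x-y\|$ denotes the geodesic distance $d(x,y)$ on $\mathbb{T}^2$, i.e. $\|x-y\| = \min_{k \in \mathbb{Z}^2} |x-y+k|$ with $|\cdot|$ the Euclidean norm. A critical point of $E$ is a configuration $x = (x_1,\dots,x_n)$ of pairwise distinct points (so that the energy is finite) with $\nabla E(x) = 0$. Two critical points are identified if one can be obtained from the other by a permutation of the points combined with an isometry of $\mathbb{T}^2$ (so one counts geometrically distinct configurations). $\log$ is the natural logarithm. *)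

theory Defs
  imports "HOL-Analysis.Analysis" "HOL-Combinatorics.Permutations"
begin

definition int_lattice :: "(real^2) set" where
  "int_lattice = {k. \<forall>i. k $ i \<in> \<int>}"

lemma int_lattice_0 [simp]: "0 \<in> int_lattice"
  and int_lattice_uminus: "k \<in> int_lattice \<Longrightarrow> - k \<in> int_lattice"
  and int_lattice_add: "k \<in> int_lattice \<Longrightarrow> l \<in> int_lattice \<Longrightarrow> k + l \<in> int_lattice"
  and int_lattice_diff: "k \<in> int_lattice \<Longrightarrow> l \<in> int_lattice \<Longrightarrow> k - l \<in> int_lattice"
  by (auto simp: int_lattice_def)

lemma closed_int_lattice: "closed int_lattice"
proof -
  have "closed {k::real^2. k $ i \<in> \<int>}" for i
    using continuous_closed_vimage[OF closed_Ints, of "\<lambda>k::real^2. k $ i"]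
    by (simp add: vimage_def continuous_component)
  then show ?thesis
    unfolding int_lattice_def by (rule closed_Collect_all)
qed

quotient_type torus = "real^2" / "\<lambda>x y. x - y \<in> int_lattice"
  morphisms rep_torus torus_class
proof (rule equivpI)
  show "reflp (\<lambda>x y. x - y \<in> int_lattice)"
    by (simp add: reflp_def)
  show "symp (\<lambda>x y. x - y \<in> int_lattice)"
    by (metis (no_types, lifting) int_lattice_uminus minus_diff_eq symp_def)
  show "transp (\<lambda>x y. x - y \<in> int_lattice)"
  proof (rule transpI)
    fix x y z :: "real^2"
    assume "x - y \<in> int_lattice" "y - z \<in> int_lattice"
    then have "(x - y) + (y - z) \<in> int_lattice"
      by (rule int_lattice_add)
    then show "x - z \<in> int_lattice"
      by simp
  qed
qed

definition lattice_dist :: "real^2 \<Rightarrow> real^2 \<Rightarrow> real" where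
  "lattice_dist x y = (INF k\<in>int_lattice. norm (x - y + k))"

lemma lattice_dist_le: "k \<in> int_lattice \<Longrightarrow> lattice_dist x y \<le> norm (x - y + k)"
  unfolding lattice_dist_def by (rule cINF_lower) (auto intro!: bdd_belowI2[where m = 0])

lemma lattice_dist_attained:
  obtains k where "k \<in> int_lattice" "lattice_dist x y = norm (x - y + k)"
proof -
  obtain l where l: "l \<in> int_lattice" "\<And>z. z \<in> int_lattice \<Longrightarrow> dist (y - x) l \<le> dist (y - x) z"
    using distance_attains_inf[OF closed_int_lattice, of "y - x"] int_lattice_0 by (metis empty_iff)
  have eq: "dist (y - x) z = norm (x - y + z)" for z
    by (simp add: dist_norm norm_minus_commute algebra_simps)
  have "lattice_dist x y = norm (x - y + l)"
    unfolding lattice_dist_def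
    by (rule cInf_eq_minimum) (use l in \<open>auto simp: eq\<close>)
  with l show thesis
    using that by blast
qed

lemma lattice_dist_cong:
  assumes "x - x' \<in> int_lattice" "y - y' \<in> int_lattice"
  shows "lattice_dist x y = lattice_dist x' y'"
proof -
  have le: "lattice_dist a b \<le> lattice_dist a' b'"
    if "a - a' \<in> int_lattice" "b - b' \<in> int_lattice" for a a' b b'
  proof -
    obtain k where k: "k \<in> int_lattice" "lattice_dist a' b' = norm (a' - b' + k)"
      by (rule lattice_dist_attained)
    have "lattice_dist a b \<le> norm (a - b + (k - (a - a') + (b - b')))"
      by (intro lattice_dist_le int_lattice_add int_lattice_diff k that)
    also have "a - b + (k - (a - a') + (b - b')) = a' - b' + k"
      by simp
    finally show ?thesis
      using k by simp
  qed
  show ?thesis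
    using le[OF assms] le[of x' x y' y] assms int_lattice_uminus by (metis minus_diff_eq order_antisym)
qed

instantiation torus :: metric_space
begin

lift_definition dist_torus :: "torus \<Rightarrow> torus \<Rightarrow> real" is lattice_dist
  by (rule lattice_dist_cong)

definition uniformity_torus :: "(torus \<times> torus) filter" where
  "uniformity_torus = (INF e\<in>{0 <..}. principal {(x, y). dist x y < e})"

definition open_torus :: "torus set \<Rightarrow> bool" where
  "open_torus U \<longleftrightarrow> (\<forall>x\<in>U. eventually (\<lambda>(x', y). x' = x \<longrightarrow> y \<in> U) uniformity)"

instance
proof
  fix x y z :: torus
  show "dist x y = 0 \<longleftrightarrow> x = y"
  proof (transfer, rule iffI)
    fix x y :: "real^2"
    assume "lattice_dist x y = 0"
    then obtain k where k: "k \<in> int_lattice" "x - y + k = 0"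
      by (metis lattice_dist_attained norm_eq_zero)
    then show "x - y \<in> int_lattice"
      by (metis add.inverse_inverse add_eq_0_iff2 int_lattice_uminus)
  next
    fix x y :: "real^2"
    assume xy: "x - y \<in> int_lattice"
    obtain k where k: "lattice_dist x y = norm (x - y + k)"
      by (rule lattice_dist_attained)
    then show "lattice_dist x y = 0"
      using lattice_dist_le[OF int_lattice_uminus[OF xy], of x y] by simp
  qed
  show "dist x y \<le> dist x z + dist y z"
  proof transfer
    fix x y z :: "real^2"
    obtain k where k: "k \<in> int_lattice" "lattice_dist x z = norm (x - z + k)"
      by (rule lattice_dist_attained)
    obtain l where l: "l \<in> int_lattice" "lattice_dist y z = norm (y - z + l)"
      by (rule lattice_dist_attained)
    have "lattice_dist x y \<le> norm (x - y + (k - l))"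
      by (intro lattice_dist_le int_lattice_diff k l)
    also have "x - y + (k - l) = (x - z + k) - (y - z + l)"
      by simp
    also have "norm \<dots> \<le> norm (x - z + k) + norm (y - z + l)"
      by (rule norm_triangle_ineq4)
    finally show "lattice_dist x y \<le> lattice_dist x z + lattice_dist y z"
      using k l by simp
  qed
qed (rule uniformity_torus_def open_torus_def)+

end

lift_definition torus_shift :: "torus \<Rightarrow> real^2 \<Rightarrow> torus" is "\<lambda>x v. x + v"
  by simp

text \<open>A configuration of \<open>n\<close> points is an extensional function on the index set
  \<open>{..<n}\<close>, so that distinct elements of \<open>configs n\<close> are distinct elements of the \<open>n\<close>-fold
  product of the torus.\<close>

definition configs :: "nat \<Rightarrow> (nat \<Rightarrow> torus) set" where
  "configs n = {..<n} \<rightarrow>\<^sub>E UNIV"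

definition riesz_energy :: "real \<Rightarrow> nat \<Rightarrow> (nat \<Rightarrow> torus) \<Rightarrow> real" where
  "riesz_energy p n x = (\<Sum>i<n. \<Sum>j\<in>{..<n} - {i}. 1 / dist (x i) (x j) powr p)"

definition config_shift :: "nat \<Rightarrow> (nat \<Rightarrow> torus) \<Rightarrow> (nat \<Rightarrow> real^2) \<Rightarrow> (nat \<Rightarrow> torus)" where
  "config_shift n x h = (\<lambda>i\<in>{..<n}. torus_shift (x i) (h i))"

text \<open>Since \<open>n\<close> is not a type, the tangent space of the \<open>n\<close>-fold product of the torus is
  represented by the first \<open>n\<close> entries of functions \<open>nat \<Rightarrow> real^2\<close> with their Euclidean norm.
  The lemma \<open>has_gradient_iff_has_derivative\<close> below identifies \<open>has_gradient\<close> with the library's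
  Frechet derivative.\<close>

definition has_gradient ::
    "nat \<Rightarrow> ((nat \<Rightarrow> torus) \<Rightarrow> real) \<Rightarrow> (nat \<Rightarrow> real^2) \<Rightarrow> (nat \<Rightarrow> torus) \<Rightarrow> bool" where
  "has_gradient n F g x \<longleftrightarrow>
    (\<forall>e>0. \<exists>d>0. \<forall>h. L2_set (\<lambda>i. norm (h i)) {..<n} < d \<longrightarrow>
      \<bar>F (config_shift n x h) - F x - (\<Sum>i<n. g i \<bullet> h i)\<bar>
        \<le> e * L2_set (\<lambda>i. norm (h i)) {..<n})"

lemma has_gradient_iff_has_derivative:
  fixes idx :: "'n::finite \<Rightarrow> nat" and x :: "nat \<Rightarrow> torus"
  assumes idx: "bij_betw idx UNIV {..<n}" and x: "x \<in> configs n"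
  shows "has_gradient n F g x \<longleftrightarrow>
    ((\<lambda>v :: (real^2)^'n. F (config_shift n x (\<lambda>i. v $ inv idx i)))
      has_derivative (\<lambda>v. \<Sum>a\<in>UNIV. g (idx a) \<bullet> v $ a)) (at 0)"
proof -
  define L where "L = (\<lambda>v :: (real^2)^'n. \<Sum>a\<in>UNIV. g (idx a) \<bullet> v $ a)"
  define H where "H = (\<lambda>(v :: (real^2)^'n) i. v $ inv idx i)"
  have inj: "inj idx" and img: "range idx = {..<n}"
    using idx by (auto simp: bij_betw_def)
  have H_idx: "H v (idx a) = v $ a" for v a
    using inj by (simp add: H_def)
  have norm_H: "L2_set (\<lambda>i. norm (H v i)) {..<n} = norm v" for v
    unfolding L2_set_def norm_vec_def
    by (simp add: sum.reindex_bij_betw[OF idx, symmetric] H_idx)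
  have sum_H: "(\<Sum>i<n. g i \<bullet> H v i) = L v" for v
    unfolding L_def by (simp add: sum.reindex_bij_betw[OF idx, symmetric] H_idx)
  have bl: "bounded_linear L"
    unfolding L_def
    by (intro bounded_linear_sum bounded_linear_inner_right_comp bounded_linear_vec_nth)
  have shift_0: "config_shift n x (H 0) = x"
  proof
    fix i
    have "torus_shift t 0 = t" for t
      by transfer simp
    then show "config_shift n x (H 0) i = x i"
      using x by (auto simp: config_shift_def H_def configs_def PiE_def extensional_def restrict_def)
  qed
  let ?P = "\<lambda>e d h. L2_set (\<lambda>i. norm (h i)) {..<n} < d \<longrightarrow>
      \<bar>F (config_shift n x h) - F x - (\<Sum>i<n. g i \<bullet> h i)\<bar>
        \<le> e * L2_set (\<lambda>i. norm (h i)) {..<n}"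
  have all_H: "(\<forall>h. ?P e d h) \<longleftrightarrow> (\<forall>v. ?P e d (H v))" for e d
  proof (intro iffI allI)
    fix h
    assume P: "\<forall>v. ?P e d (H v)"
    define v :: "(real^2)^'n" where "v = (\<chi> a. h (idx a))"
    have eq: "H v i = h i" if "i < n" for i
    proof -
      from that img obtain a where "i = idx a"
        by (metis imageE lessThan_iff)
      then show ?thesis
        by (simp add: H_idx v_def)
    qed
    have "L2_set (\<lambda>i. norm (H v i)) {..<n} = L2_set (\<lambda>i. norm (h i)) {..<n}"
      "config_shift n x (H v) = config_shift n x h"
      "(\<Sum>i<n. g i \<bullet> H v i) = (\<Sum>i<n. g i \<bullet> h i)"
      by (auto intro!: L2_set_cong sum.cong simp: config_shift_def restrict_def eq)
    then show "?P e d h"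
      using P[rule_format, of v] by auto
  qed auto
  have "has_gradient n F g x \<longleftrightarrow> (\<forall>e>0. \<exists>d>0. \<forall>v. ?P e d (H v))"
    unfolding has_gradient_def all_H ..
  also have "\<dots> \<longleftrightarrow> ((\<lambda>v. F (config_shift n x (H v))) has_derivative L) (at 0)"
    by (simp add: has_derivative_at_alt bl norm_H sum_H shift_0)
  finally show ?thesis
    by (simp add: H_def L_def)
qed

definition critical_points :: "real \<Rightarrow> nat \<Rightarrow> (nat \<Rightarrow> torus) set" where
  "critical_points p n =
    {x \<in> configs n. inj_on x {..<n} \<and> has_gradient n (riesz_energy p n) (\<lambda>_. 0) x}"

definition torus_isometry :: "(torus \<Rightarrow> torus) \<Rightarrow> bool" where
  "torus_isometry \<phi> \<longleftrightarrow> bij \<phi> \<and> (\<forall>x y. dist (\<phi> x) (\<phi> y) = dist x y)"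

definition config_equiv :: "nat \<Rightarrow> ((nat \<Rightarrow> torus) \<times> (nat \<Rightarrow> torus)) set" where
  "config_equiv n = {(x, y). x \<in> configs n \<and> y \<in> configs n \<and>
    (\<exists>\<sigma> \<phi>. \<sigma> permutes {..<n} \<and> torus_isometry \<phi> \<and> (\<forall>i<n. y i = \<phi> (x (\<sigma> i))))}"

lemma equiv_config_equiv: "equiv (configs n) (config_equiv n)"
proof (rule equivI)
  show "config_equiv n \<subseteq> configs n \<times> configs n"
    by (auto simp: config_equiv_def)
  have "torus_isometry id"
    by (simp add: torus_isometry_def)
  moreover have "id permutes {..<n}"
    by (rule permutes_id)
  ultimately show "refl_on (configs n) (config_equiv n)"
    unfolding refl_on_def config_equiv_def by fastforce
  show "sym (config_equiv n)"
  proof (rule symI)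
    fix x y
    assume "(x, y) \<in> config_equiv n"
    then obtain \<sigma> \<phi> where xy: "x \<in> configs n" "y \<in> configs n" "\<sigma> permutes {..<n}"
      "torus_isometry \<phi>" "\<And>i. i < n \<Longrightarrow> y i = \<phi> (x (\<sigma> i))"
      by (auto simp: config_equiv_def)
    have "torus_isometry (inv \<phi>)"
      using xy(4) unfolding torus_isometry_def
      by (metis bij_imp_bij_inv bij_inv_eq_iff)
    moreover have "x i = inv \<phi> (y (inv \<sigma> i))" if "i < n" for i
    proof -
      have "inv \<sigma> i < n"
        using permutes_in_image[OF permutes_inv[OF xy(3)], of i] that by simp
      then have "y (inv \<sigma> i) = \<phi> (x i)"
        using xy(5) permutes_inverses(1)[OF xy(3)] by simp
      then show ?thesis
        using xy(4) by (simp add: torus_isometry_def bij_is_inj)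
    qed
    ultimately show "(y, x) \<in> config_equiv n"
      using xy permutes_inv[OF xy(3)] unfolding config_equiv_def by blast
  qed
  show "trans (config_equiv n)"
  proof (rule transI)
    fix x y z
    assume "(x, y) \<in> config_equiv n" "(y, z) \<in> config_equiv n"
    then obtain \<sigma> \<phi> \<tau> \<psi> where xyz: "x \<in> configs n" "z \<in> configs n"
      "\<sigma> permutes {..<n}" "torus_isometry \<phi>" "\<And>i. i < n \<Longrightarrow> y i = \<phi> (x (\<sigma> i))"
      "\<tau> permutes {..<n}" "torus_isometry \<psi>" "\<And>i. i < n \<Longrightarrow> z i = \<psi> (y (\<tau> i))"
      by (auto simp: config_equiv_def)
    have "torus_isometry (\<psi> \<circ> \<phi>)"
      using xyz(4,7) by (auto simp: torus_isometry_def intro: bij_comp)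
    moreover have "z i = (\<psi> \<circ> \<phi>) (x ((\<sigma> \<circ> \<tau>) i))" if "i < n" for i
      using xyz(5,8) that permutes_in_image[OF xyz(6), of i] by simp
    ultimately show "(x, z) \<in> config_equiv n"
      using xyz permutes_compose[OF xyz(6,3)] unfolding config_equiv_def by blast
  qed
qed

end

theory Submission
  imports Defs
begin

text \<open>
The critical points are built from rows of equally spaced points. Let \<open>m = 3 * J\<close> be odd and cut
the lattice of all points with coordinates in \<open>(1/m) \<int>\<close> into its \<open>m\<close> diagonals, the closed
geodesics in direction \<open>(1, 1)\<close>. In every block of three consecutive diagonals the first one
is occupied, and exactly one of the other two, which one being a free binary choice. So there are
\<open>2 * J\<close> rows of \<open>m\<close> points, hence \<open>n = 6 * J\<^sup>2\<close> points, and \<open>2 ^ J\<close> patterns, where \<open>J\<close> is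
proportional to \<open>sqrt n\<close>.

The rows may be displaced perpendicularly to the diagonal, row \<open>r\<close> by \<open>\<epsilon> r\<close>. Every such
configuration is invariant under the translation by \<open>(1/m, 1/m)\<close> and under the reflection
\<open>(x, y) \<mapsto> (- y, - x)\<close>, which maps each row to itself. Therefore the net force on a point has
no component along its row (\<open>along_row_balanced\<close>) and is the same for all points of a row, and
a configuration is critical as soon as the energy is stationary as a function of the \<open>2 * J\<close>
numbers \<open>\<epsilon> r\<close> (\<open>config_critical\<close>).

Consecutive rows are one diagonal apart (a narrow gap) or two (a wide gap). If the second row of
each block is displaced by about \<open>\<delta> = 1/6\<close> towards the middle of its block, then a point has
the same distance to its nearest points across narrow and wide gaps, and a suitable \<open>\<delta>\<close> close to
\<open>1/6\<close> makes the repulsions across the two kinds of gaps equal (\<open>psi_equilibrium\<close>). All other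
pairs of points in different rows are more distant by a factor larger than \<open>3/2\<close>
(\<open>nonadjacent_far\<close>), and for \<open>p > 5 * ln n\<close> the \<open>p\<close>-th power of this factor beats
\<open>n\<^sup>2\<close>, so that their forces are a negligible perturbation (\<open>far_force_small\<close>). Now minimise
the energy over the compact box of all displacements for which every gap differs from its ideal
width by at most \<open>tol\<close>, which is proportional to \<open>1 / J\<close>. If a gap had the extreme width, some
other gap would deviate from the ideal in the opposite direction or not at all, and transferring
width between the two would lower the energy (\<open>minimiser_interior\<close>). So the minimiser is an
interior point, hence stationary (\<open>equilibrium\<close>).

The torus distance is not differentiable where a coordinate difference is \<open>1/2\<close>. This is why the
rows are diagonals of a lattice of odd order: differences of lattice coordinates then stay at least
\<open>1 / (2 * m)\<close> away from \<open>1/2\<close>, and the displacements are too small to bridge that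
(\<open>sep_no_kink\<close>). Rows parallel to a coordinate axis, shifted by half a spacing against each other,
would always contain such a pair of points.

An isometry preserves distances. The pairs at distance \<open>sqrt 2 / m\<close> are exactly the neighbours
within rows, the pairs at a smaller distance are exactly the neighbours across gaps, and a narrow
gap differs from a wide one in that a point has two such neighbours across it instead of one. Hence
equivalent configurations have the same cyclic sequence of gap types up to rotation and reversal
(\<open>types_preserved\<close>). At most \<open>4 * J\<close> of the \<open>2 ^ J\<close> patterns can share a class
(\<open>config_equiv_decode\<close>), which leaves at least \<open>2 ^ J / (4 * J)\<close> classes.
\<close>

section \<open>Gradients of the energy at configurations without kinks\<close>

lemma abs_le_abs_add_Ints:
  fixes a k :: real
  assumes "\<bar>a\<bar> \<le> 1/2" "k \<in> \<int>"
  shows "\<bar>a\<bar> \<le> \<bar>a + k\<bar>"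
proof -
  obtain z where z: "k = of_int z"
    using assms by (auto elim: Ints_cases)
  consider "z = 0" | "z \<ge> 1" | "z \<le> -1" by linarith
  then show ?thesis
  proof cases
    case 2
    then have "k \<ge> 1" using z by simp
    then show ?thesis using assms by linarith
  next
    case 3
    then have "k \<le> -1" using z by linarith
    then show ?thesis using assms by linarith
  qed (simp add: z)
qed

text \<open>
A difference vector whose coordinates are at most \<open>1/2\<close> in absolute value is a shortest one in
its class, because adding an integer cannot shrink a coordinate.
\<close>

lemma dist_torus_class_eq_norm:
  assumes "\<And>c. \<bar>z $ c\<bar> \<le> 1/2" "x - y - z \<in> int_lattice"
  shows "dist (torus_class x) (torus_class y) = norm z"
proof -
  have "lattice_dist x y = norm z"
  proof (rule antisym)
    have "lattice_dist x y \<le> norm (x - y + - (x - y - z))"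
      by (intro lattice_dist_le int_lattice_uminus assms)
    then show "lattice_dist x y \<le> norm z" by simp
    obtain k where k: "k \<in> int_lattice" "lattice_dist x y = norm (x - y + k)"
      by (rule lattice_dist_attained)
    define l where "l = x - y - z + k"
    have l: "l \<in> int_lattice"
      unfolding l_def by (intro int_lattice_add assms k)
    have "norm z \<le> norm (z + l)"
    proof (rule norm_le_componentwise_cart)
      fix i
      show "norm (z $ i) \<le> norm ((z + l) $ i)"
        using abs_le_abs_add_Ints[of "z $ i" "l $ i"] assms(1)[of i] l
        by (simp add: int_lattice_def)
    qed
    also have "z + l = x - y + k" by (simp add: l_def)
    finally show "norm z \<le> lattice_dist x y" using k by simp
  qed
  then show ?thesis
    by (simp add: dist_torus.abs_eq)
qed

lemma has_derivative_norm_powr: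
  fixes z :: "real^2"
  assumes "z \<noteq> 0"
  shows "((\<lambda>w. 1 / norm (z + w) powr p) has_derivative
          (\<lambda>w. - p * norm z powr (- p - 2) * (z \<bullet> w))) (at 0)"
proof -
  have nz: "norm z > 0" using assms by simp
  have "((\<lambda>w. z + w) has_derivative (\<lambda>w. w)) (at 0)"
    by (auto intro!: derivative_eq_intros)
  moreover have "(norm has_derivative (\<lambda>h. h \<bullet> sgn z)) (at (z + 0))"
    using has_derivative_norm[OF assms] by simp
  ultimately have D: "((\<lambda>w. norm (z + w)) has_derivative (\<lambda>w. w \<bullet> sgn z)) (at 0)"
    by (rule has_derivative_compose)
  have "((\<lambda>w. norm (z + w) powr (- p)) has_derivative
          (\<lambda>w. - p * norm z powr (- p - 2) * (z \<bullet> w))) (at 0)"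
    by (rule has_derivative_eq_rhs[OF has_derivative_powr[OF D has_derivative_const]])
       (use nz in \<open>auto simp: sgn_div_norm field_simps powr_diff powr_minus inner_commute power2_eq_square\<close>)
  then show ?thesis
    by (simp add: powr_minus_divide)
qed

lemma sum_offdiagonal_swap:
  fixes f :: "nat \<Rightarrow> nat \<Rightarrow> 'a::comm_monoid_add"
  shows "(\<Sum>i<n. \<Sum>j\<in>{..<n} - {i}. f i j) = (\<Sum>i<n. \<Sum>j\<in>{..<n} - {i}. f j i)"
proof -
  have e: "(\<Sum>i<n. \<Sum>j\<in>{..<n} - {i}. f i j) = (\<Sum>i<n. \<Sum>j<n. if i = j then 0 else f i j)"
    for f :: "nat \<Rightarrow> nat \<Rightarrow> 'a"
    by (rule sum.cong[OF refl], rule sum.mono_neutral_cong_left) auto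
  have "(\<Sum>i<n. \<Sum>j<n. if i = j then 0 else f i j) = (\<Sum>j<n. \<Sum>i<n. if i = j then 0 else f i j)"
    by (rule sum.swap)
  also have "\<dots> = (\<Sum>i<n. \<Sum>j<n. if i = j then 0 else f j i)"
    by (intro sum.cong) auto
  finally show ?thesis unfolding e .
qed

text \<open>
As long as no coordinate difference is \<open>1/2\<close>, the same lift \<open>Z i j\<close> of \<open>x i - x j\<close>
realises the distance in a whole neighbourhood, so each summand of the energy is a smooth function
of the displacements with derivative proportional to \<open>norm (Z i j) powr (- p - 2) *\<^sub>R Z i j\<close>.
The total derivative vanishes when these vectors add up to zero at every point; the antisymmetry of
\<open>Z\<close> lets the force on both endpoints of a pair be read off from the same balance.
\<close>

lemma has_gradient_zero_if_balanced:
  fixes X :: "nat \<Rightarrow> real^2" and Z :: "nat \<Rightarrow> nat \<Rightarrow> real^2"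
  assumes x: "\<And>i. i < n \<Longrightarrow> x i = torus_class (X i)"
    and lift: "\<And>i j. i < n \<Longrightarrow> j < n \<Longrightarrow> i \<noteq> j \<Longrightarrow> X i - X j - Z i j \<in> int_lattice"
    and nokink: "\<And>i j c. i < n \<Longrightarrow> j < n \<Longrightarrow> i \<noteq> j \<Longrightarrow> \<bar>Z i j $ c\<bar> < 1/2"
    and nz: "\<And>i j. i < n \<Longrightarrow> j < n \<Longrightarrow> i \<noteq> j \<Longrightarrow> Z i j \<noteq> 0"
    and anti: "\<And>i j. i < n \<Longrightarrow> j < n \<Longrightarrow> i \<noteq> j \<Longrightarrow> Z j i = - Z i j"
    and bal: "\<And>i. i < n \<Longrightarrow> (\<Sum>j\<in>{..<n} - {i}. norm (Z i j) powr (- p - 2) *\<^sub>R Z i j) = 0"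
  shows "has_gradient n (riesz_energy p n) (\<lambda>_. 0) x"
  unfolding has_gradient_def
proof (intro allI impI)
  fix e :: real assume e: "e > 0"
  define N where "N h = L2_set (\<lambda>i. norm (h i)) {..<n}" for h :: "nat \<Rightarrow> real^2"
  define lin where "lin i j w = - p * norm (Z i j) powr (- p - 2) * (Z i j \<bullet> w)" for i j and w :: "real^2"
  define T where "T h i j = 1 / dist (config_shift n x h i) (config_shift n x h j) powr p" for h i j
  define T0 where "T0 i j = 1 / dist (x i) (x j) powr p" for i j
  define e' where "e' = e / (2 * (real n * real n) + 1)"
  have e': "e' > 0" unfolding e'_def using e by (simp add: add_nonneg_pos)
  have ex: "\<exists>d>0. \<forall>h. N h < d \<longrightarrow> \<bar>T h i j - T0 i j - lin i j (h i - h j)\<bar> \<le> e' * (2 * N h)"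
    if ij: "i < n" "j < n" "i \<noteq> j" for i j
  proof -
    let ?z = "Z i j"
    obtain d1 where d1: "d1 > 0" "\<And>w. norm w < d1 \<Longrightarrow>
        \<bar>1 / norm (?z + w) powr p - 1 / norm ?z powr p - lin i j w\<bar> \<le> e' * norm w"
      using has_derivative_norm_powr[OF nz[OF ij], of p] e' unfolding has_derivative_at_alt lin_def
      by (simp only: add_0_right diff_zero real_norm_def) blast
    \<comment> \<open>displacements shorter than \<open>d2\<close> keep all coordinates of the lift within \<open>1/2\<close>\<close>
    define d2 where "d2 = Min ((\<lambda>c. 1/2 - \<bar>?z $ c\<bar>) ` UNIV)"
    have d2: "d2 > 0" unfolding d2_def using nokink[OF ij] by (subst Min_gr_iff) auto
    have d2': "d2 \<le> 1/2 - \<bar>?z $ c\<bar>" for c unfolding d2_def by (rule Min_le) auto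
    have dist_xij: "dist (x i) (x j) = norm ?z"
      unfolding x[OF ij(1)] x[OF ij(2)]
      by (rule dist_torus_class_eq_norm) (use nokink[OF ij] lift[OF ij] less_imp_le in auto)
    show ?thesis
    proof (intro exI[of _ "min d1 d2 / 2"] conjI allI impI)
      show "min d1 d2 / 2 > 0" using d1 d2 by simp
      fix h assume h: "N h < min d1 d2 / 2"
      let ?w = "h i - h j"
      have mem: "norm (h a) \<le> N h" if "a < n" for a
        unfolding N_def using member_le_L2_set[of "{..<n}" a "\<lambda>i. norm (h i)"] that by simp
      have w: "norm ?w \<le> 2 * N h"
        using norm_triangle_ineq4[of "h i" "h j"] mem[OF ij(1)] mem[OF ij(2)] by linarith
      have comp: "\<bar>(?z + ?w) $ c\<bar> \<le> 1/2" for c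
      proof -
        have "\<bar>?w $ c\<bar> \<le> norm ?w" by (rule component_le_norm_cart)
        then show ?thesis using d2'[of c] w h by (simp only: vector_add_component)
      qed
      have "dist (config_shift n x h i) (config_shift n x h j) = norm (?z + ?w)"
        using ij by (simp only: config_shift_def restrict_def lessThan_iff if_True x torus_shift.abs_eq)
          (rule dist_torus_class_eq_norm[OF comp], use lift[OF ij] in \<open>simp_all add: algebra_simps\<close>)
      then have "T h i j - T0 i j = 1 / norm (?z + ?w) powr p - 1 / norm ?z powr p"
        by (simp add: T_def T0_def dist_xij)
      moreover have "\<bar>1 / norm (?z + ?w) powr p - 1 / norm ?z powr p - lin i j ?w\<bar> \<le> e' * norm ?w"
        using w h by (intro d1) auto
      moreover have "e' * norm ?w \<le> e' * (2 * N h)" using w e' by simp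
      ultimately show "\<bar>T h i j - T0 i j - lin i j ?w\<bar> \<le> e' * (2 * N h)" by linarith
    qed
  qed
  define P where "P = {(i, j). i < n \<and> j < n \<and> i \<noteq> j}"
  have finP: "finite P" unfolding P_def by (rule finite_subset[of _ "{..<n} \<times> {..<n}"]) auto
  have "\<forall>q\<in>P. \<exists>d>0. \<forall>h. N h < d \<longrightarrow>
     \<bar>T h (fst q) (snd q) - T0 (fst q) (snd q) - lin (fst q) (snd q) (h (fst q) - h (snd q))\<bar> \<le> e' * (2 * N h)"
    using ex by (auto simp: P_def)
  then obtain dd where dd: "\<And>q. q \<in> P \<Longrightarrow> dd q > 0" "\<And>q h. q \<in> P \<Longrightarrow> N h < dd q \<Longrightarrow>
     \<bar>T h (fst q) (snd q) - T0 (fst q) (snd q) - lin (fst q) (snd q) (h (fst q) - h (snd q))\<bar> \<le> e' * (2 * N h)"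
    by metis
  define d where "d = Min (insert 1 (dd ` P))"
  have "d > 0" unfolding d_def using finP dd(1) by (subst Min_gr_iff) auto
  have d: "d \<le> dd q" if "q \<in> P" for q unfolding d_def using that finP by (intro Min_le) auto
  have main: "\<bar>T h i j - T0 i j - lin i j (h i - h j)\<bar> \<le> e' * (2 * N h)"
    if "i < n" "j < n" "i \<noteq> j" "N h < d" for i j h
    using dd(2)[of "(i, j)" h] d[of "(i, j)"] that by (simp add: P_def)
  have lin0: "(\<Sum>i<n. \<Sum>j\<in>{..<n} - {i}. lin i j (h i - h j)) = 0" for h
  proof -
    let ?c = "\<lambda>i j. norm (Z i j) powr (- p - 2) *\<^sub>R Z i j"
    have 1: "(\<Sum>i<n. \<Sum>j\<in>{..<n} - {i}. ?c i j \<bullet> h i) = 0"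
      by (rule sum.neutral, rule ballI) (simp add: inner_sum_left[symmetric] bal del: inner_scaleR_left)
    have "(\<Sum>i<n. \<Sum>j\<in>{..<n} - {i}. ?c i j \<bullet> h j) = (\<Sum>i<n. \<Sum>j\<in>{..<n} - {i}. ?c j i \<bullet> h i)"
      by (rule sum_offdiagonal_swap)
    also have "\<dots> = (\<Sum>i<n. \<Sum>j\<in>{..<n} - {i}. - (?c i j \<bullet> h i))"
    proof (intro sum.cong refl)
      fix i j assume "i \<in> {..<n}" "j \<in> {..<n} - {i}"
      then have "Z j i = - Z i j" by (intro anti) auto
      then show "?c j i \<bullet> h i = - (?c i j \<bullet> h i)" by simp
    qed
    also have "\<dots> = 0" using 1 by (simp only: sum_negf)
    finally have 2: "(\<Sum>i<n. \<Sum>j\<in>{..<n} - {i}. ?c i j \<bullet> h j) = 0" .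
    have "(\<Sum>i<n. \<Sum>j\<in>{..<n} - {i}. lin i j (h i - h j)) =
       (\<Sum>i<n. \<Sum>j\<in>{..<n} - {i}. - p * (?c i j \<bullet> h i - ?c i j \<bullet> h j))"
      by (simp add: lin_def inner_diff_right algebra_simps)
    also have "\<dots> = - p * ((\<Sum>i<n. \<Sum>j\<in>{..<n} - {i}. ?c i j \<bullet> h i) - (\<Sum>i<n. \<Sum>j\<in>{..<n} - {i}. ?c i j \<bullet> h j))"
      by (simp only: sum_distrib_left[symmetric] sum_subtractf)
    also have "\<dots> = 0" using 1 2 by simp
    finally show ?thesis .
  qed
  show "\<exists>d>0. \<forall>h :: nat \<Rightarrow> real^2. L2_set (\<lambda>i. norm (h i)) {..<n} < d \<longrightarrow>
      \<bar>riesz_energy p n (config_shift n x h) - riesz_energy p n x - (\<Sum>i<n. 0 \<bullet> h i)\<bar>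
        \<le> e * L2_set (\<lambda>i. norm (h i)) {..<n}"
  proof (intro exI[of _ d] conjI allI impI)
    show "d > 0" by fact
    fix h :: "nat \<Rightarrow> real^2" assume "L2_set (\<lambda>i. norm (h i)) {..<n} < d"
    then have h: "N h < d" by (simp add: N_def)
    have eq: "riesz_energy p n (config_shift n x h) - riesz_energy p n x =
       (\<Sum>i<n. \<Sum>j\<in>{..<n} - {i}. T h i j - T0 i j - lin i j (h i - h j))"
      using lin0[of h] by (simp add: riesz_energy_def T_def T0_def sum_subtractf)
    have "\<bar>\<Sum>i<n. \<Sum>j\<in>{..<n} - {i}. T h i j - T0 i j - lin i j (h i - h j)\<bar>
        \<le> (\<Sum>i<n. \<Sum>j\<in>{..<n} - {i}. \<bar>T h i j - T0 i j - lin i j (h i - h j)\<bar>)"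
      by (intro order_trans[OF sum_abs] sum_mono order_refl)
    also have "\<dots> \<le> (\<Sum>i<n. \<Sum>j\<in>{..<n} - {i}. e' * (2 * N h))"
      by (intro sum_mono main h) auto
    also have "\<dots> \<le> (\<Sum>i<n. \<Sum>j<n. e' * (2 * N h))"
      using e' by (intro sum_mono[OF sum_mono2]) (auto simp: N_def)
    also have "\<dots> = (e' * (2 * (real n * real n))) * N h" by simp
    also have "\<dots> \<le> e * N h"
    proof (rule mult_right_mono)
      have "e' * (2 * (real n * real n)) \<le> e' * (2 * (real n * real n) + 1)" using e' by simp
      also have "\<dots> = e" unfolding e'_def
        by (smt (verit, best) nonzero_eq_divide_eq of_nat_0_le_iff mult_nonneg_nonneg)
      finally show "e' * (2 * (real n * real n)) \<le> e" .
    qed (simp add: N_def)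
    finally show "\<bar>riesz_energy p n (config_shift n x h) - riesz_energy p n x - (\<Sum>i<n. 0 \<bullet> h i)\<bar>
        \<le> e * L2_set (\<lambda>i. norm (h i)) {..<n}"
      by (simp add: N_def eq)
  qed
qed

section \<open>Centred residues and products of compact sets\<close>

text \<open>
For odd \<open>m\<close> this is the representative of least absolute value.
\<close>

definition centred_mod :: "int \<Rightarrow> int \<Rightarrow> int" where
  "centred_mod m x = (x + m div 2) mod m - m div 2"

lemma centred_mod_bound:
  assumes "odd m" "m > 0"
  shows "2 * \<bar>centred_mod m x\<bar> < m"
proof -
  obtain h where h: "m = 2 * h + 1" using assms by (auto elim: oddE)
  have "0 \<le> (x + h) mod m" "(x + h) mod m < m" using assms by auto
  then show ?thesis using h by (simp add: centred_mod_def)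
qed

lemma dvd_centred_mod_diff: "m dvd centred_mod m x - x"
proof -
  have "centred_mod m x - x = - (x + m div 2 - (x + m div 2) mod m)"
    by (simp add: centred_mod_def)
  then show ?thesis by (simp add: minus_mod_eq_mult_div)
qed

lemma centred_mod_unique:
  assumes "odd m" "m > 0" "m dvd y - x" "2 * \<bar>y\<bar> < m"
  shows "centred_mod m x = y"
proof -
  let ?c = "centred_mod m x"
  have "m dvd (?c - x) - (y - x)"
    using dvd_centred_mod_diff assms(3) by (rule dvd_diff)
  then have "m dvd ?c - y" by simp
  moreover have "\<bar>?c - y\<bar> < m"
    using centred_mod_bound[OF assms(1,2), of x] assms(4) by linarith
  ultimately show ?thesis
    using dvd_imp_le_int[of "?c - y" m] assms(2) by auto
qed

lemma centred_mod_uminus: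
  assumes "odd m" "m > 0"
  shows "centred_mod m (- x) = - centred_mod m x"
proof (rule centred_mod_unique[OF assms])
  have "- centred_mod m x - - x = - (centred_mod m x - x)" by simp
  then show "m dvd - centred_mod m x - - x"
    using dvd_centred_mod_diff by (metis dvd_minus_iff)
  show "2 * \<bar>- centred_mod m x\<bar> < m"
    using centred_mod_bound[OF assms, of x] by simp
qed

lemma centred_mod_cong: "x mod m = y mod m \<Longrightarrow> centred_mod m x = centred_mod m y"
  unfolding centred_mod_def by (metis mod_add_cong)

lemma centred_mod_add_mod [simp]:
  "centred_mod m (t mod m + d) = centred_mod m (t + d)"
  "centred_mod m (t mod m) = centred_mod m t"
  "centred_mod m (d + t mod m) = centred_mod m (d + t)"
  by (auto intro!: centred_mod_cong simp: mod_simps)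

text \<open>
Sums over all residues are invariant under reflection; this expresses the two symmetries of a
pair of rows, translation along the rows and reversal of the rows.
\<close>

lemma sum_residues_reflect:
  fixes f :: "int \<Rightarrow> 'a::comm_monoid_add"
  assumes "m > 0" "\<And>t. f (t mod m) = f t"
  shows "(\<Sum>t\<in>{0..<m}. f (c - t)) = (\<Sum>t\<in>{0..<m}. f t)"
  by (rule sum.reindex_bij_witness[of _ "\<lambda>t. (c - t) mod m" "\<lambda>t. (c - t) mod m"])
     (use assms in \<open>auto simp: mod_simps\<close>)

text \<open>
Tychonoff's theorem for functions, without extensionality.
\<close>

lemma compact_Pi_UNIV:
  fixes X :: "nat \<Rightarrow> real set"
  assumes "\<And>i. compact (X i)"
  shows "compact {f. \<forall>i. f i \<in> X i}"
proof -
  have "compactin (product_topology (\<lambda>i. euclidean) UNIV) (PiE UNIV X)"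
    using assms by (simp add: compactin_PiE)
  moreover have "PiE UNIV X = {f. \<forall>i. f i \<in> X i}" by (auto simp: PiE_def)
  ultimately show ?thesis by (simp add: euclidean_product_topology)
qed

section \<open>Forces across a gap between neighbouring rows\<close>

text \<open>
For \<open>P = p / 2 + 1\<close>, the repulsion across a narrow gap that has been widened by \<open>e\<close> is
\<open>2 * p * narrow_psi P e\<close> when only nearest points are counted, and \<open>2 * p * wide_psi P e\<close>
is the same for a wide gap (\<open>near_force_nxt\<close>). The squared distances of nearest points are the
bases of the two powers.
\<close>

definition narrow_psi :: "real \<Rightarrow> real \<Rightarrow> real" where
  "narrow_psi P e = (1 + 2 * e) * (1 + 2 * e + 2 * e\<^sup>2) powr (- P)"

definition wide_psi :: "real \<Rightarrow> real \<Rightarrow> real" where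
  "wide_psi P e = (1 + e) * (2 * (1 + e)\<^sup>2) powr (- P)"

text \<open>
The logarithm of the repulsion has slope at most \<open>- 1\<close>: the power decays at a rate growing with
\<open>P\<close>, while the geometric prefactor grows at a bounded rate. A decay rate that does not depend
on \<open>P\<close> is what the comparison of two gaps uses later, since \<open>p\<close> is not bounded in terms of \<open>n\<close>.
\<close>

lemma narrow_psi_decay:
  assumes P: "P \<ge> 3" and xy: "1/10 \<le> x" "x \<le> y" "y \<le> 1/4"
  shows "narrow_psi P y * exp y \<le> narrow_psi P x * exp x"
proof -
  define g where "g e = ln (1 + 2 * e) - P * ln (1 + 2 * e + 2 * e\<^sup>2) + e" for e :: real
  have eq: "narrow_psi P e * exp e = exp (g e)" if "1/10 \<le> e" for e
  proof -
    have "1 + 2 * e + 2 * e\<^sup>2 > 0" using that by (intro add_pos_nonneg) auto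
    then show ?thesis
      using that by (simp add: narrow_psi_def g_def exp_add exp_diff powr_def exp_minus field_simps)
  qed
  have "g y \<le> g x"
  proof (rule DERIV_nonpos_imp_nonincreasing[OF xy(2)])
    fix e assume e: "x \<le> e" "e \<le> y"
    have e': "1/10 \<le> e" "e \<le> 1/4" using e xy by auto
    let ?q = "1 + 2 * e + 2 * e\<^sup>2"
    have q: "?q > 0" using e' by (intro add_pos_nonneg) auto
    have "e\<^sup>2 \<le> (1/4)\<^sup>2" using e' by (intro power_mono) auto
    then have q2: "?q \<le> 13/8" using e' by (simp add: power2_eq_square)
    have D: "(g has_real_derivative 2 / (1 + 2 * e) - P * (1 / ?q * (2 + 4 * e)) + 1) (at e)"
    proof -
      have "((\<lambda>e. 1 + 2 * e + 2 * e\<^sup>2) has_real_derivative (2 + 4 * e)) (at e)"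
        by (auto intro!: derivative_eq_intros)
      note Dq = DERIV_chain2[OF DERIV_ln_divide[OF q] this]
      have "((\<lambda>e. 1 + 2 * e) has_real_derivative 2) (at e)"
        by (auto intro!: derivative_eq_intros)
      note Dl = DERIV_chain2[OF DERIV_ln_divide this]
      show ?thesis
        unfolding g_def
        by (rule DERIV_cong[OF DERIV_add[OF DERIV_diff[OF Dl DERIV_cmult[OF Dq]] DERIV_ident]])
           (use e' in auto)
    qed
    have "2 / (1 + 2 * e) \<le> 5/3" using e' by (simp add: field_simps)
    moreover have "(2 + 4 * e) / ?q \<ge> (12/5) / (13/8)"
      using e' q q2 by (intro frac_le) auto
    then have "P * ((2 + 4 * e) / ?q) \<ge> 3 * ((12/5) / (13/8))"
      using P by (intro mult_mono) auto
    ultimately have "2 / (1 + 2 * e) - P * (1 / ?q * (2 + 4 * e)) + 1 \<le> 0" by simp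
    then show "\<exists>d. (g has_real_derivative d) (at e) \<and> d \<le> 0" using D by blast
  qed
  then show ?thesis using eq xy by auto
qed

lemma wide_psi_decay:
  assumes P: "P \<ge> 2" and xy: "-1/4 \<le> x" "x \<le> y" "y \<le> 0"
  shows "wide_psi P y * exp y \<le> wide_psi P x * exp x"
proof -
  define g where "g e = (1 - 2 * P) * ln (1 + e) - P * ln 2 + e" for e :: real
  have eq: "wide_psi P e * exp e = exp (g e)" if "-1/4 \<le> e" for e
  proof -
    have "1 + e > 0" using that by simp
    then have "ln (2 * (1 + e)\<^sup>2) = ln 2 + 2 * ln (1 + e)"
      by (simp add: ln_mult ln_realpow)
    then have "(2 * (1 + e)\<^sup>2) powr (- P) = exp (- P * (ln 2 + 2 * ln (1 + e)))"
      using \<open>1 + e > 0\<close> by (simp add: powr_def)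
    moreover have "1 + e = exp (ln (1 + e))" using \<open>1 + e > 0\<close> by simp
    ultimately have "wide_psi P e * exp e = exp (ln (1 + e)) * exp (- P * (ln 2 + 2 * ln (1 + e))) * exp e"
      unfolding wide_psi_def by metis
    then show ?thesis by (simp only: exp_add[symmetric] g_def) (simp add: algebra_simps)
  qed
  have "g y \<le> g x"
  proof (rule DERIV_nonpos_imp_nonincreasing[OF xy(2)])
    fix e assume e: "x \<le> e" "e \<le> y"
    have e': "-1/4 \<le> e" "e \<le> 0" using e xy by auto
    have D: "(g has_real_derivative (1 - 2 * P) / (1 + e) + 1) (at e)"
    proof -
      have "((\<lambda>e. 1 + e) has_real_derivative 1) (at e)"
        by (auto intro!: derivative_eq_intros)
      note Dl = DERIV_chain2[OF DERIV_ln_divide this]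
      show ?thesis
        unfolding g_def
        by (rule DERIV_cong[OF DERIV_add[OF DERIV_diff[OF DERIV_cmult[OF Dl] DERIV_const] DERIV_ident]])
           (use e' in auto)
    qed
    have "(1 - 2 * P) / (1 + e) + 1 \<le> 0" using e' P by (simp add: field_simps)
    then show "\<exists>d. (g has_real_derivative d) (at e) \<and> d \<le> 0" using D by blast
  qed
  then show ?thesis using eq xy by auto
qed

text \<open>
At \<open>\<delta> = 1/6\<close> both powers have the base \<open>25/18\<close> and the narrow gap repels more because
two pairs of points contribute; at \<open>\<delta> = 9/50\<close> its larger base has reversed the order.
\<close>

lemma psi_equilibrium:
  assumes P: "P \<ge> 12"
  obtains \<delta> where "1/6 \<le> \<delta>" "\<delta> \<le> 9/50" "narrow_psi P \<delta> = wide_psi P (- \<delta>)"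
proof -
  define f where "f x = narrow_psi P x - wide_psi P (- x)" for x
  have pos: "1 + 2 * x + 2 * x\<^sup>2 > 0" "2 * (1 + - x)\<^sup>2 > 0" if "x \<ge> 1/6" "x \<le> 9/50" for x :: real
    using that by (auto intro!: add_pos_nonneg)
  have cont: "continuous_on {1/6..9/50} f"
    unfolding f_def narrow_psi_def wide_psi_def
    by (intro continuous_intros) (use pos in \<open>auto simp: less_imp_neq[THEN not_sym]\<close>)
  have f1: "f (1/6) \<ge> 0" by (simp add: f_def narrow_psi_def wide_psi_def power2_eq_square)
  have f2: "f (9/50) \<le> 0"
  proof -
    let ?a = "(1781/1250 :: real)" and ?b = "(1681/1250 :: real)"
    have "(?a / ?b) powr 12 \<le> (?a / ?b) powr P"
      using P by (intro powr_mono) auto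
    moreover have "34/25 \<le> 41/50 * (?a / ?b) powr 12"
      by (simp add: power_divide)
    ultimately have "34/25 \<le> 41/50 * (?a / ?b) powr P" by linarith
    then have "34/25 * ?a powr (-P) \<le> 41/50 * (?a / ?b) powr P * ?a powr (-P)"
      by (rule mult_right_mono) simp
    also have "\<dots> = 41/50 * ?b powr (-P)"
      by (simp add: powr_divide powr_minus field_simps)
    finally show ?thesis by (simp add: f_def narrow_psi_def wide_psi_def power2_eq_square)
  qed
  obtain \<delta> where "1/6 \<le> \<delta>" "\<delta> \<le> 9/50" "f \<delta> = 0"
    using IVT2'[of f "9/50" 0 "1/6"] f1 f2 cont by auto
  then show thesis using that by (simp add: f_def)
qed

text \<open>
The squared length of the lattice vector \<open>(A, B)\<close> displaced by \<open>e\<close> perpendicularly to the diagonal.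
\<close>

definition disp_sq :: "int \<Rightarrow> int \<Rightarrow> real \<Rightarrow> real" where
  "disp_sq A B e = (of_int A + e)\<^sup>2 + (of_int B - e)\<^sup>2"

lemma disp_sq_uminus: "disp_sq (- A) (- B) (- e) = disp_sq A B e"
  by (simp add: disp_sq_def power2_eq_square algebra_simps)

lemma disp_sq_swap: "disp_sq (- B) (- A) e = disp_sq A B e"
  by (simp add: disp_sq_def power2_eq_square algebra_simps)

lemma disp_sq_sum_diff: "disp_sq A B e = ((of_int (A + B))\<^sup>2 + (of_int (A - B) + 2 * e)\<^sup>2) / 2"
  by (simp add: disp_sq_def power2_eq_square algebra_simps)

definition pair_force :: "real \<Rightarrow> int \<Rightarrow> int \<Rightarrow> real \<Rightarrow> real" where
  "pair_force p A B e = - p * (of_int (A - B) + 2 * e) * disp_sq A B e powr (- (p / 2 + 1))"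

lemma pair_force_uminus: "pair_force p (- A) (- B) (- e) = - pair_force p A B e"
  unfolding pair_force_def disp_sq_uminus by (simp add: algebra_simps)

lemma disp_sq_pos:
  assumes "A \<noteq> B" "\<bar>e\<bar> < 1/2"
  shows "disp_sq A B e > 0"
proof -
  have "\<bar>of_int (A - B)\<bar> \<ge> (1::real)" using assms(1) by linarith
  then have "of_int (A - B) + 2 * e \<noteq> 0" using assms(2) by linarith
  then have "(of_int (A - B) + 2 * e)\<^sup>2 > 0" by simp
  then have "(of_int (A + B))\<^sup>2 + (of_int (A - B) + 2 * e)\<^sup>2 > 0"
    by (intro add_nonneg_pos zero_le_power2)
  then show ?thesis unfolding disp_sq_sum_diff by simp
qed

lemma DERIV_disp_sq_powr:
  assumes "disp_sq A B e > 0"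
  shows "((\<lambda>e. disp_sq A B e powr (- p / 2)) has_real_derivative pair_force p A B e) (at e)"
proof -
  have "((\<lambda>e. disp_sq A B e) has_real_derivative 2 * (of_int (A - B) + 2 * e)) (at e)"
    unfolding disp_sq_def by (auto intro!: derivative_eq_intros)
  from DERIV_fun_powr[OF this assms, of "- p / 2"]
  show ?thesis by (rule DERIV_cong) (simp add: pair_force_def)
qed

text \<open>
The factor \<open>A - B + 2 * e\<close> is at most \<open>sqrt (2 * disp_sq A B e)\<close>, hence at most
\<open>disp_sq A B e\<close>, and raises the exponent of the power by one.
\<close>

lemma pair_force_bound:
  assumes "disp_sq A B e \<ge> 33/10" "p \<ge> 0"
  shows "\<bar>pair_force p A B e\<bar> \<le> p * (33/10) powr (- p / 2)"
proof -
  let ?q = "disp_sq A B e" and ?x = "of_int (A - B) + 2 * e"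
  have "?x\<^sup>2 \<le> 2 * ?q" unfolding disp_sq_sum_diff using zero_le_power2[of "of_int (A + B) :: real"] by simp
  also have "\<dots> \<le> ?q\<^sup>2" using assms(1) by (simp add: power2_eq_square mult_right_mono)
  finally have "\<bar>?x\<bar>\<^sup>2 \<le> ?q\<^sup>2" by simp
  then have x: "\<bar>?x\<bar> \<le> ?q" by (rule power2_le_imp_le) (use assms(1) in simp)
  have "\<bar>pair_force p A B e\<bar> = p * \<bar>?x\<bar> * ?q powr (- (p / 2 + 1))"
    using assms(2) by (simp add: pair_force_def abs_mult)
  also have "\<dots> \<le> p * ?q * ?q powr (- (p / 2 + 1))"
    using x assms(2) by (intro mult_right_mono mult_left_mono) auto
  also have "\<dots> = p * (?q powr 1 * ?q powr (- (p / 2 + 1)))" using assms(1) by simp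
  also have "\<dots> = p * ?q powr (- p / 2)" by (simp only: powr_add[symmetric]) simp
  also have "\<dots> \<le> p * (33/10) powr (- p / 2)"
    using assms by (intro mult_left_mono powr_mono2') auto
  finally show ?thesis .
qed

section \<open>Diagonal rows in a lattice of odd order\<close>

text \<open>
Throughout, lengths are measured in units of \<open>1 / m\<close>. A block of three diagonals contains the
rows \<open>2 * j\<close> and \<open>2 * j + 1\<close>; the set \<open>S\<close> collects the blocks in which the second
of these rows occupies the third diagonal and not the second one.
\<close>

locale diagonal_rows =
  fixes J :: nat and S :: "nat set"
  assumes odd_J: "odd J" and J_ge: "J \<ge> 3"
begin

definition m :: int where "m = 3 * int J"
definition R :: nat where "R = 2 * J"

definition diag :: "nat \<Rightarrow> int" where
  "diag r = 3 * int (r div 2) + (if even r then 0 else if r div 2 \<in> S then 2 else 1)"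

text \<open>
The direction of the ideal displacement of a row. It is congruent to the index of the diagonal
modulo \<open>3\<close>, which makes it computable from differences of lattice coordinates.
\<close>

definition off :: "nat \<Rightarrow> int" where
  "off r = (if even r then 0 else if r div 2 \<in> S then - 1 else 1)"

definition nxt :: "nat \<Rightarrow> nat" where "nxt r = (r + 1) mod R"

text \<open>
Whether the gap following row \<open>r\<close> spans one diagonal.
\<close>

definition narrow :: "nat \<Rightarrow> bool" where "narrow r \<longleftrightarrow> (even r \<longleftrightarrow> r div 2 \<notin> S)"

text \<open>
The lattice vector of a difference between a point of row \<open>r'\<close> and a point of row \<open>r\<close> is
\<open>(cA r r' t, cB t)\<close>, where \<open>t\<close> is the difference of their positions in the rows.
\<close>

definition cA :: "nat \<Rightarrow> nat \<Rightarrow> int \<Rightarrow> int" where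
  "cA r r' t = centred_mod m (t + (diag r' - diag r))"

definition cB :: "int \<Rightarrow> int" where "cB t = centred_mod m t"

lemma odd_m: "odd m" and m_ge: "m \<ge> 9" and m_pos: "m > 0"
  using odd_J J_ge by (auto simp: m_def)

lemma R_ge: "R \<ge> 6" and R_pos: "R > 0"
  using J_ge by (auto simp: R_def)

lemma nxt_less: "nxt r < R"
  using R_pos by (simp add: nxt_def)

lemma nxt_cases: "r < R \<Longrightarrow> nxt r = (if r = R - 1 then 0 else r + 1)"
  using R_pos by (auto simp: nxt_def)

lemma nxt_neq: "r < R \<Longrightarrow> nxt r \<noteq> r"
  and nxt_nxt_neq: "r < R \<Longrightarrow> nxt (nxt r) \<noteq> r"
  using R_ge by (auto simp: nxt_cases nxt_less)

lemma inj_nxt: "inj_on nxt {..<R}"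
  using R_ge by (auto simp: inj_on_def nxt_cases split: if_splits)

lemma bij_nxt: "bij_betw nxt {..<R} {..<R}"
proof -
  have "nxt ` {..<R} = {..<R}"
    by (rule endo_inj_surj) (use inj_nxt nxt_less in auto)
  then show ?thesis using inj_nxt by (simp add: bij_betw_def)
qed

lemma off_bound: "\<bar>off r\<bar> \<le> 1"
  by (simp add: off_def)

lemma diag_bounds: "r < R \<Longrightarrow> 0 \<le> diag r" "r < R \<Longrightarrow> diag r < m"
proof -
  assume "r < R"
  then have "r div 2 < J" by (simp add: R_def)
  then show "diag r < m" by (simp add: diag_def m_def)
qed (simp add: diag_def)

lemma dvd3_diag_off: "3 dvd diag r - off r"
  by (simp add: diag_def off_def)

lemma div2_eq_diag: "int (r div 2) = diag r div 3"
  and even_iff_diag: "even r \<longleftrightarrow> diag r mod 3 = 0"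
  unfolding diag_def by (cases "even r"; cases "r div 2 \<in> S"; simp)+

lemma diag_eq_iff: "r < R \<Longrightarrow> r' < R \<Longrightarrow> m dvd diag r' - diag r \<Longrightarrow> r = r'"
proof -
  assume a: "r < R" "r' < R" "m dvd diag r' - diag r"
  have "\<bar>diag r' - diag r\<bar> < m" using diag_bounds[of r] diag_bounds[of r'] a by linarith
  then have "diag r' - diag r = 0"
    using a(3) m_pos dvd_imp_le_int[of "diag r' - diag r" m] by auto
  then have eq: "diag r' = diag r" by simp
  have "r div 2 = r' div 2"
    using div2_eq_diag[of r] div2_eq_diag[of r'] eq by linarith
  moreover have "even r \<longleftrightarrow> even r'"
    using even_iff_diag[of r] even_iff_diag[of r'] eq by simp
  ultimately show "r = r'"
    by (metis dvd_mult_div_cancel odd_two_times_div_two_succ)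
qed

lemma m_dvd_3: "m dvd 3 * a \<longleftrightarrow> int J dvd a"
  by (simp add: m_def)

lemma nxt_even: "j < J \<Longrightarrow> nxt (2 * j) = 2 * j + 1"
  and nxt_odd: "j < J \<Longrightarrow> nxt (2 * j + 1) = (if j + 1 = J then 0 else 2 * (j + 1))"
  by (auto simp: nxt_cases R_def)

lemma row_cases:
  assumes "r < R"
  obtains j where "r = 2 * j" "j < J" | j where "r = 2 * j + 1" "j < J"
proof (cases "even r")
  case True
  then show ?thesis using assms that(1)[of "r div 2"] by (auto simp: R_def)
next
  case False
  then show ?thesis using assms that(2)[of "r div 2"] by (auto simp: R_def)
qed

lemma diag_simps:
  "diag 0 = 0" "off 0 = 0"
  "diag (2 * j) = 3 * int j" "diag (Suc (2 * j)) = 3 * int j + (if j \<in> S then 2 else 1)"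
  "off (2 * j) = 0" "off (Suc (2 * j)) = (if j \<in> S then - 1 else 1)"
  "narrow (2 * j) \<longleftrightarrow> j \<notin> S" "narrow (Suc (2 * j)) \<longleftrightarrow> j \<in> S"
  by (auto simp: diag_def off_def narrow_def)

lemma narrow_gap:
  assumes "r < R" "narrow r"
  shows "m dvd 1 - (diag (nxt r) - diag r)" "off (nxt r) - off r = 1"
proof -
  have "m dvd 1 - (diag (nxt r) - diag r) \<and> off (nxt r) - off r = 1"
    using assms(1)
  proof (cases rule: row_cases)
    case (1 j)
    then show ?thesis using assms(2) by (simp add: nxt_even diag_simps)
  next
    case (2 j)
    show ?thesis
    proof (cases "j + 1 = J")
      case True
      then have "m = 3 + 3 * int j" by (auto simp: m_def)
      moreover have "nxt r = 0" using 2 True nxt_odd[of j] by simp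
      ultimately show ?thesis using 2 assms(2) by (auto simp: diag_simps)
    next
      case False
      then have "nxt r = 2 * (j + 1)" using 2 nxt_odd[of j] by simp
      then show ?thesis using 2 assms(2) diag_simps(3)[of "j + 1"] diag_simps(5)[of "j + 1"]
        by (auto simp: diag_simps)
    qed
  qed
  then show "m dvd 1 - (diag (nxt r) - diag r)" "off (nxt r) - off r = 1" by auto
qed

lemma wide_gap:
  assumes "r < R" "\<not> narrow r"
  shows "m dvd 2 - (diag (nxt r) - diag r)" "off (nxt r) - off r = - 1"
proof -
  have "m dvd 2 - (diag (nxt r) - diag r) \<and> off (nxt r) - off r = - 1"
    using assms(1)
  proof (cases rule: row_cases)
    case (1 j)
    then show ?thesis using assms(2) by (simp add: nxt_even diag_simps)
  next
    case (2 j)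
    show ?thesis
    proof (cases "j + 1 = J")
      case True
      then have "m = 3 + 3 * int j" by (auto simp: m_def)
      moreover have "nxt r = 0" using 2 True nxt_odd[of j] by simp
      ultimately show ?thesis using 2 assms(2) by (auto simp: diag_simps)
    next
      case False
      then have "nxt r = 2 * (j + 1)" using 2 nxt_odd[of j] by simp
      then show ?thesis using 2 assms(2) diag_simps(3)[of "j + 1"] diag_simps(5)[of "j + 1"]
        by (auto simp: diag_simps)
    qed
  qed
  then show "m dvd 2 - (diag (nxt r) - diag r)" "off (nxt r) - off r = - 1" by auto
qed

lemma dvd_J_cases:
  assumes "int J dvd a" "\<bar>a\<bar> < int J"
  shows "a = 0"
  using assms dvd_imp_le_int[of a "int J"] by fastforce

lemma nxt_if_dvd:
  assumes "r < R" "r' < R" "m dvd u - (diag r' - diag r)"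
    and u: "u = 1 \<and> off r' - off r = 1 \<or> u = 2 \<and> off r' - off r = - 1"
  shows "r' = nxt r"
  using assms(1)
proof (cases rule: row_cases)
  case (1 j)
  from assms(2) show ?thesis
  proof (cases rule: row_cases)
    fix j' assume "r' = 2 * j'"
    then show ?thesis using u 1 by (simp add: diag_simps)
  next
    fix j' assume j': "r' = 2 * j' + 1" "j' < J"
    have "off r = 0" using 1 by (simp add: diag_simps)
    then have "diag r' = 3 * int j' + u" using u j' by (cases "j' \<in> S") (auto simp: diag_simps)
    moreover have "diag r = 3 * int j" using 1 by (simp add: diag_simps)
    ultimately have "m dvd 3 * (int j - int j')" using assms(3) by (simp add: algebra_simps)
    then have "int j - int j' = 0" unfolding m_dvd_3 by (rule dvd_J_cases) (use 1 j' in linarith)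
    then show ?thesis using 1 j' by (simp add: nxt_even)
  qed
next
  case (2 j)
  from assms(2) show ?thesis
  proof (cases rule: row_cases)
    fix j' assume j': "r' = 2 * j'" "j' < J"
    have "off r' = 0" using j' by (simp add: diag_simps)
    then have "diag r = 3 * int j + (3 - u)" using u 2 by (cases "j \<in> S") (auto simp: diag_simps)
    moreover have "diag r' = 3 * int j'" using j' by (simp add: diag_simps)
    ultimately have "m dvd 3 * (int j + 1 - int j')" using assms(3) by (simp add: algebra_simps)
    then have dv: "int J dvd int j + 1 - int j'" unfolding m_dvd_3 .
    show ?thesis
    proof (cases "\<bar>int j + 1 - int j'\<bar> < int J")
      case True
      then have "j' = j + 1" using dvd_J_cases[OF dv] by linarith
      then show ?thesis using 2 j' nxt_odd[of j] by simp
    next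
      case False
      then have "j' = 0" "j + 1 = J" using 2 j' by linarith+
      then show ?thesis using 2 j' nxt_odd[of j] by simp
    qed
  next
    fix j' assume j': "r' = 2 * j' + 1"
    have "\<bar>off r' - off r\<bar> \<noteq> 1"
      unfolding j' 2 by (cases "j \<in> S"; cases "j' \<in> S") (simp_all add: diag_simps)
    then show ?thesis using u by auto
  qed
qed

text \<open>
Diagonals two and three of a block are never both occupied. Their rows would be displaced towards
each other, and this is the only pair of displacements that would bring unrelated points too close.
\<close>

lemma same_block_excluded:
  assumes "r < R" "r' < R" "m dvd 1 - (diag r' - diag r)" "off r' - off r = - 2"
  shows False
proof -
  have "off r' = - 1" "off r = 1" using assms(4) off_bound[of r] off_bound[of r'] by linarith+
  then have o: "odd r" "odd r'" "r div 2 \<notin> S" "r' div 2 \<in> S"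
    by (auto simp: off_def split: if_splits)
  then have d: "diag r = 3 * int (r div 2) + 1" "diag r' = 3 * int (r' div 2) + 2"
    by (auto simp: diag_def)
  have "m dvd 3 * (int (r div 2) - int (r' div 2))"
    using assms(3) unfolding d by (simp add: algebra_simps)
  then have dv: "int J dvd int (r div 2) - int (r' div 2)"
    unfolding m_dvd_3 .
  have "r div 2 < J" "r' div 2 < J" using assms(1,2) by (auto simp: R_def)
  then have "\<bar>int (r div 2) - int (r' div 2)\<bar> < int J" by linarith
  then have "int (r div 2) = int (r' div 2)"
    using dvd_J_cases[OF dv] by simp
  then show False using o by simp
qed

text \<open>
With \<open>u = A - B\<close>, twice the squared length is \<open>(A + B)\<^sup>2 + (u + 2 * e)\<^sup>2\<close>. Because the
displacement \<open>off r' - off r\<close> is congruent to \<open>u\<close> modulo \<open>3\<close> and at most \<open>2\<close> in absolute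
value, each small \<open>u\<close> leaves at most two possibilities for \<open>e\<close>, and \<open>A + B\<close> has the parity
of \<open>u\<close>. For \<open>u \<ge> 4\<close> the second summand alone is large enough.
\<close>

lemma nonadjacent_far_pos:
  assumes r: "r < R" "r' < R" and u: "A - B \<ge> 1" "m dvd (A - B) - (diag r' - diag r)"
    and \<delta>: "1/6 \<le> \<delta>" "\<delta> \<le> 9/50"
    and e: "\<bar>e - \<delta> * of_int (off r' - off r)\<bar> \<le> 1/100"
    and far: "\<not> (r' = nxt r \<and> \<bar>A\<bar> \<le> 1 \<and> \<bar>B\<bar> \<le> 1)"
  shows "33/10 \<le> disp_sq A B e"
proof -
  define u where "u = A - B"
  define D where "D = off r' - off r"
  have bound: "\<bar>D\<bar> \<le> 2" using off_bound[of r] off_bound[of r'] by (simp add: D_def)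
  have "3 dvd (u - (diag r' - diag r)) + (diag r' - off r') - (diag r - off r)"
  proof (rule dvd_diff[OF dvd_add[OF _ dvd3_diag_off] dvd3_diag_off])
    have "(3::int) dvd m" by (simp add: m_def)
    then show "3 dvd u - (diag r' - diag r)" using assms(4) dvd_trans unfolding u_def by blast
  qed
  then have mod3: "3 dvd u - D" by (simp add: D_def algebra_simps)
  have bdd: "\<bar>\<delta> * of_int D\<bar> \<le> 9/25"
  proof -
    have "\<bar>of_int D\<bar> \<le> (2::real)" using bound by linarith
    then have "\<delta> * \<bar>of_int D\<bar> \<le> 9/50 * 2" using \<delta> by (intro mult_mono) auto
    then show ?thesis using \<delta> by (simp add: abs_mult)
  qed
  have q: "disp_sq A B e = ((of_int (A + B))\<^sup>2 + (of_int u + 2 * e)\<^sup>2) / 2"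
    unfolding u_def by (rule disp_sq_sum_diff)
  have dvdu: "m dvd u - (diag r' - diag r)" using assms(4) by (simp only: u_def)
  have half2: "33/10 \<le> (a + b) / 2" if "c \<le> a" "d \<le> b" "33/5 \<le> c + d" for a b c d :: real
    using that by simp
  have half: "33/10 \<le> (a + b) / 2" if "0 \<le> a" "33/5 \<le> b" for a b :: real
    using that by simp
  have sq: "x\<^sup>2 \<le> y\<^sup>2" if "0 \<le> x" "x \<le> y" for x y :: real
    using that by (rule power_mono[rotated])
  have isq: "(of_int k)\<^sup>2 \<le> (of_int (A + B) :: real)\<^sup>2" if "k \<ge> 0" "k \<le> \<bar>A + B\<bar>" for k
  proof -
    have "(of_int k)\<^sup>2 \<le> (of_int \<bar>A + B\<bar> :: real)\<^sup>2" using that by (intro power_mono) auto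
    then show ?thesis by simp
  qed
  have e': "\<bar>e - \<delta> * of_int D\<bar> \<le> 1/100" using e by (simp add: D_def)
  consider "u \<ge> 4" | "u = 3" | "u = 2" | "u = 1" using assms(3) u_def by linarith
  then show ?thesis
  proof cases
    case 1
    then have "of_int u \<ge> (4::real)" by simp
    then have "163/50 \<le> of_int u + 2 * e" using e' bdd by linarith
    from sq[OF _ this] have "(163/50)\<^sup>2 \<le> (of_int u + 2 * e)\<^sup>2" by simp
    then have "33/5 \<le> (of_int u + 2 * e)\<^sup>2" by (rule order_trans[rotated]) (simp add: power2_eq_square)
    then show ?thesis unfolding q by (intro half zero_le_power2)
  next
    case 2
    then have "D = 0" using mod3 bound by presburger
    then have "\<bar>e\<bar> \<le> 1/100" using e' by simp
    then have "- 1/100 \<le> e" by linarith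
    then have "149/50 \<le> of_int u + 2 * e" using 2 by simp
    from sq[OF _ this] have "(149/50)\<^sup>2 \<le> (of_int u + 2 * e)\<^sup>2" by simp
    note 1 = this
    have "1 \<le> \<bar>A + B\<bar>" using 2 unfolding u_def by presburger
    from isq[OF _ this] have "1 \<le> (of_int (A + B) :: real)\<^sup>2" by simp
    then show ?thesis unfolding q using 1 by (rule half2) (simp add: power2_eq_square)
  next
    case 3
    then have "D = 2 \<or> D = - 1" using mod3 bound by presburger
    then show ?thesis
    proof
      assume "D = 2"
      then have "\<bar>e - \<delta> * 2\<bar> \<le> 1/100" using e' by simp
      then have "\<delta> * 2 - 1/100 \<le> e" by linarith
      then have "8/25 \<le> e" using \<delta> by linarith
      then have "132/50 \<le> of_int u + 2 * e" using 3 by simp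
      from sq[OF _ this] have "(132/50)\<^sup>2 \<le> (of_int u + 2 * e)\<^sup>2" by simp
      then have "33/5 \<le> (of_int u + 2 * e)\<^sup>2" by (rule order_trans[rotated]) (simp add: power2_eq_square)
      then show ?thesis unfolding q by (intro half zero_le_power2)
    next
      assume D: "D = - 1"
      then have "\<bar>e + \<delta>\<bar> \<le> 1/100" using e' by simp
      then have "- \<delta> - 1/100 \<le> e" by linarith
      then have "- 19/100 \<le> e" using \<delta> by linarith
      then have "81/50 \<le> of_int u + 2 * e" using 3 by simp
      from sq[OF _ this] have 1: "(81/50)\<^sup>2 \<le> (of_int u + 2 * e)\<^sup>2" by simp
      have "r' = nxt r"
        by (rule nxt_if_dvd[OF r, of u]) (use 3 D dvdu in \<open>simp_all add: D_def\<close>)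
      moreover have A: "A = B + 2" using 3 by (simp add: u_def)
      ultimately have "B \<noteq> - 1" using far by auto
      then have "2 \<le> \<bar>A + B\<bar>" unfolding A by linarith
      from isq[OF _ this] have "4 \<le> (of_int (A + B) :: real)\<^sup>2" by simp
      then show ?thesis unfolding q using 1 by (rule half2) (simp add: power2_eq_square)
    qed
  next
    case 4
    then have "D = 1 \<or> D = - 2" using mod3 bound by presburger
    then have D: "D = 1"
      using same_block_excluded[OF r] dvdu[unfolded 4] unfolding D_def by blast
    have "r' = nxt r"
      by (rule nxt_if_dvd[OF r, of u]) (use 4 D dvdu in \<open>simp_all add: D_def\<close>)
    moreover have A: "A = B + 1" using 4 by (simp add: u_def)
    ultimately have "B \<noteq> - 1" "B \<noteq> 0" using far by auto
    then have "3 \<le> \<bar>A + B\<bar>" unfolding A by linarith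
    from isq[OF _ this] have "9 \<le> (of_int (A + B) :: real)\<^sup>2" by simp
    then have "33/5 \<le> (of_int (A + B) :: real)\<^sup>2" by linarith
    then show ?thesis unfolding q add.commute[of "(of_int (A + B))\<^sup>2"] by (intro half zero_le_power2)
  qed
qed

definition near :: "nat \<Rightarrow> nat \<Rightarrow> int \<Rightarrow> bool" where
  "near r r' t \<longleftrightarrow> (r' = nxt r \<or> r = nxt r') \<and> \<bar>cA r r' t\<bar> \<le> 1 \<and> \<bar>cB t\<bar> \<le> 1"

lemma cAB_dvd: "m dvd (cA r r' t - cB t) - (diag r' - diag r)"
proof -
  have "m dvd (cA r r' t - (t + (diag r' - diag r))) - (cB t - t)"
    unfolding cA_def cB_def by (intro dvd_diff dvd_centred_mod_diff)
  then show ?thesis by (simp add: algebra_simps)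
qed

lemma nonadjacent_far:
  assumes r: "r < R" "r' < R" "r \<noteq> r'"
    and \<delta>: "1/6 \<le> \<delta>" "\<delta> \<le> 9/50"
    and e: "\<bar>e - \<delta> * of_int (off r' - off r)\<bar> \<le> 1/100"
    and far: "\<not> near r r' t"
  shows "33/10 \<le> disp_sq (cA r r' t) (cB t) e"
proof -
  let ?A = "cA r r' t" and ?B = "cB t"
  note dvd = cAB_dvd[of r r' t]
  have "?A - ?B \<noteq> 0"
  proof
    assume "?A - ?B = 0"
    then have "m dvd diag r' - diag r" using dvd by (simp add: dvd_diff_commute)
    then show False using diag_eq_iff r by blast
  qed
  then consider "?A - ?B \<ge> 1" | "- ?A - - ?B \<ge> 1" by linarith
  then show ?thesis
  proof cases
    case 1
    show ?thesis
      by (rule nonadjacent_far_pos[OF r(1,2) 1 dvd \<delta> e]) (use far in \<open>auto simp: near_def\<close>)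
  next
    case 2
    have "33/10 \<le> disp_sq (- ?A) (- ?B) (- e)"
    proof (rule nonadjacent_far_pos[OF r(2,1) 2 _ \<delta>])
      have "m dvd - ((?A - ?B) - (diag r' - diag r))" using dvd by (metis dvd_minus_iff)
      then show "m dvd (- ?A - - ?B) - (diag r - diag r')" by (simp add: algebra_simps)
      have "- e - \<delta> * of_int (off r - off r') = - (e - \<delta> * of_int (off r' - off r))"
        by (simp add: algebra_simps)
      then show "\<bar>- e - \<delta> * of_int (off r - off r')\<bar> \<le> 1/100" using e by (simp only: abs_minus_cancel)
    qed (use far in \<open>auto simp: near_def\<close>)
    then show ?thesis by (simp only: disp_sq_uminus)
  qed
qed

lemma cB_small:
  assumes "t \<in> {0..<m}" "\<bar>cB t\<bar> \<le> 1"
  shows "t = 0 \<or> t = 1 \<or> t = m - 1"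
proof -
  have "m dvd cB t - t" unfolding cB_def by (rule dvd_centred_mod_diff)
  then obtain k where k: "cB t - t = m * k" by (rule dvdE)
  have "k = 0 \<or> k = - 1"
  proof -
    have "0 \<le> t" "t < m" using assms by auto
    then have "m * k < m * 1" "m * (-2) < m * k" using k assms(2) m_ge by linarith+
    then have "k < 1" "- 2 < k" using m_pos by (simp_all only: mult_less_cancel_left_pos)
    then show ?thesis by linarith
  qed
  then show ?thesis using k assms by auto
qed

lemma cB_values: "cB 0 = 0" "cB 1 = 1" "cB (m - 1) = - 1"
  unfolding cB_def using odd_m m_pos m_ge by (auto intro!: centred_mod_unique)

lemma cA_values:
  assumes "m dvd u - (diag r' - diag r)" "m dvd b - t" "2 * \<bar>u + b\<bar> < m"
  shows "cA r r' t = u + b"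
  unfolding cA_def
proof (rule centred_mod_unique[OF odd_m m_pos])
  have "m dvd (u - (diag r' - diag r)) + (b - t)" using assms by (intro dvd_add)
  then show "m dvd u + b - (t + (diag r' - diag r))" by (simp add: algebra_simps)
qed fact

text \<open>
Across a narrow gap every point has two nearest points, at the lattice vectors \<open>(1, 0)\<close> and
\<open>(0, - 1)\<close>; across a wide gap, treated next, only one, at \<open>(1, - 1)\<close>.
\<close>

lemma near_narrow:
  assumes "r < R" "narrow r"
  shows "{t \<in> {0..<m}. \<bar>cA r (nxt r) t\<bar> \<le> 1 \<and> \<bar>cB t\<bar> \<le> 1} = {0, m - 1}"
    and "cA r (nxt r) 0 = 1" "cA r (nxt r) (m - 1) = 0"
proof -
  note c = cA_values[OF narrow_gap(1)[OF assms]]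
  show 0: "cA r (nxt r) 0 = 1" using c[of 0 0] m_ge by simp
  show 1: "cA r (nxt r) (m - 1) = 0" using c[of "-1" "m - 1"] m_ge by simp
  have "cA r (nxt r) 1 = 2" using c[of 1 1] m_ge by simp
  then have "t \<in> {0..<m} \<and> \<bar>cA r (nxt r) t\<bar> \<le> 1 \<and> \<bar>cB t\<bar> \<le> 1 \<longleftrightarrow> t = 0 \<or> t = m - 1" for t
    using 0 1 cB_values m_ge cB_small[of t] by (cases "t = 0 \<or> t = 1 \<or> t = m - 1") auto
  then show "{t \<in> {0..<m}. \<bar>cA r (nxt r) t\<bar> \<le> 1 \<and> \<bar>cB t\<bar> \<le> 1} = {0, m - 1}" by blast
qed

lemma near_wide:
  assumes "r < R" "\<not> narrow r"
  shows "{t \<in> {0..<m}. \<bar>cA r (nxt r) t\<bar> \<le> 1 \<and> \<bar>cB t\<bar> \<le> 1} = {m - 1}"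
    and "cA r (nxt r) (m - 1) = 1"
proof -
  note c = cA_values[OF wide_gap(1)[OF assms]]
  have 0: "cA r (nxt r) 0 = 2" using c[of 0 0] m_ge by simp
  show 1: "cA r (nxt r) (m - 1) = 1" using c[of "-1" "m - 1"] m_ge by simp
  have "cA r (nxt r) 1 = 3" using c[of 1 1] m_ge by simp
  then have "t \<in> {0..<m} \<and> \<bar>cA r (nxt r) t\<bar> \<le> 1 \<and> \<bar>cB t\<bar> \<le> 1 \<longleftrightarrow> t = m - 1" for t
    using 0 1 cB_values m_ge cB_small[of t] by (cases "t = 0 \<or> t = 1 \<or> t = m - 1") auto
  then show "{t \<in> {0..<m}. \<bar>cA r (nxt r) t\<bar> \<le> 1 \<and> \<bar>cB t\<bar> \<le> 1} = {m - 1}" by blast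
qed

section \<open>The energy as a function of the row displacements\<close>

text \<open>
The derivative with respect to \<open>e\<close> of the energy per point between two rows, \<open>e\<close> being their
relative displacement. The restriction to nearest points is \<open>near_force\<close>.
\<close>

definition force :: "real \<Rightarrow> nat \<Rightarrow> nat \<Rightarrow> real \<Rightarrow> real" where
  "force p r r' e = (\<Sum>t\<in>{0..<m}. pair_force p (cA r r' t) (cB t) e)"

definition near_force :: "real \<Rightarrow> nat \<Rightarrow> nat \<Rightarrow> real \<Rightarrow> real" where
  "near_force p r r' e = (\<Sum>t\<in>{0..<m}. if near r r' t then pair_force p (cA r r' t) (cB t) e else 0)"

text \<open>
The energy of the configuration per point of a row, without the constant contribution of the pairs
within a row and up to scaling.
\<close>

definition energy :: "real \<Rightarrow> (nat \<Rightarrow> real) \<Rightarrow> real" where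
  "energy p \<epsilon> = (\<Sum>r<R. \<Sum>r'\<in>{..<R} - {r}. \<Sum>t\<in>{0..<m}. disp_sq (cA r r' t) (cB t) (\<epsilon> r' - \<epsilon> r) powr (- p / 2))"

definition psi :: "nat \<Rightarrow> real \<Rightarrow> real \<Rightarrow> real" where
  "psi r = (if narrow r then narrow_psi else wide_psi)"

text \<open>
Exchanging the two rows negates all difference vectors.
\<close>

lemma sum_reverse_pair:
  "(\<Sum>t\<in>{0..<m}. f (cA r' r t) (cB t)) = (\<Sum>t\<in>{0..<m}. f (- cA r r' t) (- cB t))"
proof -
  have "(\<Sum>t\<in>{0..<m}. f (cA r' r (0 - t)) (cB (0 - t))) = (\<Sum>t\<in>{0..<m}. f (cA r' r t) (cB t))"
    by (rule sum_residues_reflect[OF m_pos]) (simp add: cA_def cB_def)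
  moreover have "cA r' r (0 - t) = - cA r r' t" "cB (0 - t) = - cB t" for t
    unfolding cA_def cB_def centred_mod_uminus[OF odd_m m_pos, symmetric] by (simp_all add: algebra_simps)
  ultimately show ?thesis by simp
qed

lemma force_antisym: "force p r' r (- e) = - force p r r' e"
  unfolding force_def sum_reverse_pair[of "\<lambda>A B. pair_force p A B (- e)" r' r] pair_force_uminus by (simp add: sum_negf)

lemma near_force_antisym: "near_force p r' r (- e) = - near_force p r r' e"
proof -
  have eq: "near_force p r r' e = (\<Sum>t\<in>{0..<m}. (\<lambda>A B. if (r' = nxt r \<or> r = nxt r') \<and> \<bar>A\<bar> \<le> 1 \<and> \<bar>B\<bar> \<le> 1 then pair_force p A B e else 0)
      (cA r r' t) (cB t))" for r r' e
    by (simp add: near_force_def near_def)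
  show ?thesis unfolding eq
    by (subst sum_reverse_pair) (auto simp: pair_force_uminus sum_negf[symmetric] intro!: sum.cong)
qed

lemma near_force_nxt:
  assumes "r < R"
  shows "near_force p r (nxt r) e = - 2 * p * psi r (p / 2 + 1) e"
proof -
  let ?N = "{t \<in> {0..<m}. \<bar>cA r (nxt r) t\<bar> \<le> 1 \<and> \<bar>cB t\<bar> \<le> 1}"
  have "near_force p r (nxt r) e = (\<Sum>t\<in>?N. pair_force p (cA r (nxt r) t) (cB t) e)"
    unfolding near_force_def near_def by (subst sum.inter_filter) simp_all
  also have "\<dots> = - 2 * p * psi r (p / 2 + 1) e"
  proof (cases "narrow r")
    case True
    have "disp_sq 1 0 e = 1 + 2 * e + 2 * e\<^sup>2" "disp_sq 0 (- 1) e = 1 + 2 * e + 2 * e\<^sup>2"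
      by (simp_all add: disp_sq_def power2_eq_square algebra_simps)
    then show ?thesis
      unfolding near_narrow(1)[OF assms True]
      using m_ge True by (simp add: near_narrow(2,3)[OF assms True] cB_values pair_force_def psi_def narrow_psi_def)
  next
    case False
    have "disp_sq 1 (- 1) e = 2 * (1 + e)\<^sup>2"
      by (simp add: disp_sq_def power2_eq_square algebra_simps)
    then show ?thesis
      unfolding near_wide(1)[OF assms False]
      using False by (simp add: near_wide(2)[OF assms False] cB_values pair_force_def psi_def wide_psi_def algebra_simps)
  qed
  finally show ?thesis .
qed

lemma near_force_nonadjacent: "r' \<noteq> nxt r \<Longrightarrow> r \<noteq> nxt r' \<Longrightarrow> near_force p r r' e = 0"
  by (simp add: near_force_def near_def)

text \<open>
The displacements are close to the ideal ones. The bounds on \<open>\<delta>\<close> and the slack \<open>1/200\<close> are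
chosen such that all pairs of points in different rows which are not nearest across a gap keep a
squared distance of at least \<open>33/10\<close>, whereas nearest pairs have about \<open>25/18\<close>.
\<close>

definition near_ideal :: "real \<Rightarrow> (nat \<Rightarrow> real) \<Rightarrow> bool" where
  "near_ideal \<delta> \<epsilon> \<longleftrightarrow> 1/6 \<le> \<delta> \<and> \<delta> \<le> 9/50 \<and> (\<forall>r<R. \<bar>\<epsilon> r - \<delta> * of_int (off r)\<bar> \<le> 1/200)"

lemma near_ideal_diff:
  assumes "near_ideal \<delta> \<epsilon>" "r < R" "r' < R"
  shows "\<bar>(\<epsilon> r' - \<epsilon> r) - \<delta> * of_int (off r' - off r)\<bar> \<le> 1/100"
proof -
  have "\<bar>\<epsilon> r' - \<delta> * of_int (off r')\<bar> \<le> 1/200" "\<bar>\<epsilon> r - \<delta> * of_int (off r)\<bar> \<le> 1/200"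
    using assms by (auto simp: near_ideal_def)
  then show ?thesis by (simp only: of_int_diff right_diff_distrib)
qed

lemma near_ideal_abs:
  assumes "near_ideal \<delta> \<epsilon>" "r < R"
  shows "\<bar>\<epsilon> r\<bar> \<le> 1/5"
proof -
  have "\<delta> * \<bar>of_int (off r)\<bar> \<le> 9/50 * 1"
    using assms(1) off_bound[of r] by (intro mult_mono) (auto simp: near_ideal_def)
  then have "\<bar>\<delta> * of_int (off r)\<bar> \<le> 9/50" using assms(1) by (simp add: abs_mult near_ideal_def)
  moreover have "\<bar>\<epsilon> r - \<delta> * of_int (off r)\<bar> \<le> 1/200" using assms by (simp add: near_ideal_def)
  ultimately show ?thesis by linarith
qed

lemma near_ideal_less_half:
  assumes "near_ideal \<delta> \<epsilon>" "r < R" "r' < R"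
  shows "\<bar>\<epsilon> r' - \<epsilon> r\<bar> < 1/2"
  using near_ideal_abs[OF assms(1,2)] near_ideal_abs[OF assms(1,3)] by linarith

lemma cA_neq_cB:
  assumes "r < R" "r' < R" "r \<noteq> r'"
  shows "cA r r' t \<noteq> cB t"
  using cAB_dvd[of r r' t] diag_eq_iff[OF assms(1,2)] assms(3) by (auto simp: dvd_diff_commute)

lemma near_ideal_disp_sq_pos:
  assumes "near_ideal \<delta> \<epsilon>" "r < R" "r' < R" "r \<noteq> r'"
  shows "disp_sq (cA r r' t) (cB t) (\<epsilon> r' - \<epsilon> r) > 0"
  using assms by (intro disp_sq_pos cA_neq_cB near_ideal_less_half)

lemma near_force_approx:
  assumes "near_ideal \<delta> \<epsilon>" "r < R" "r' < R" "r \<noteq> r'" "p \<ge> 0"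
  shows "\<bar>force p r r' (\<epsilon> r' - \<epsilon> r) - near_force p r r' (\<epsilon> r' - \<epsilon> r)\<bar> \<le> of_int m * (p * (33/10) powr (- p / 2))"
proof -
  let ?e = "\<epsilon> r' - \<epsilon> r"
  have "force p r r' ?e - near_force p r r' ?e =
      (\<Sum>t\<in>{0..<m}. if near r r' t then 0 else pair_force p (cA r r' t) (cB t) ?e)"
    unfolding force_def near_force_def sum_subtractf[symmetric] by (intro sum.cong) auto
  also have "\<bar>\<dots>\<bar> \<le> (\<Sum>t\<in>{0..<m}. p * (33/10) powr (- p / 2))"
  proof (intro order_trans[OF sum_abs] sum_mono)
    fix t
    show "\<bar>if near r r' t then 0 else pair_force p (cA r r' t) (cB t) ?e\<bar> \<le> p * (33/10) powr (- p / 2)"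
    proof (cases "near r r' t")
      case False
      have "33/10 \<le> disp_sq (cA r r' t) (cB t) ?e"
        by (rule nonadjacent_far[OF assms(2-4) _ _ near_ideal_diff[OF assms(1-3)] False])
           (use assms(1) in \<open>auto simp: near_ideal_def\<close>)
      then show ?thesis using pair_force_bound[OF _ assms(5)] False by simp
    qed (use assms(5) in simp)
  qed
  also have "\<dots> = of_int m * (p * (33/10) powr (- p / 2))" using m_pos by simp
  finally show ?thesis .
qed

lemma DERIV_energy:
  assumes "near_ideal \<delta> \<epsilon>"
  shows "((\<lambda>x. energy p (\<lambda>r. \<epsilon> r + x * w r)) has_real_derivative
    (\<Sum>r<R. \<Sum>r'\<in>{..<R} - {r}. force p r r' (\<epsilon> r' - \<epsilon> r) * (w r' - w r))) (at 0)"
  unfolding energy_def force_def sum_distrib_right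
proof (intro DERIV_sum)
  fix r r' t assume r: "r \<in> {..<R}" "r' \<in> {..<R} - {r}"
  let ?e = "\<epsilon> r' - \<epsilon> r"
  have D1: "((\<lambda>x. (\<epsilon> r' + x * w r') - (\<epsilon> r + x * w r)) has_real_derivative (w r' - w r)) (at 0)"
    by (auto intro!: derivative_eq_intros)
  have "((\<lambda>e. disp_sq (cA r r' t) (cB t) e powr (- p / 2)) has_real_derivative pair_force p (cA r r' t) (cB t) ?e)
      (at ((\<epsilon> r' + 0 * w r') - (\<epsilon> r + 0 * w r)))"
    using DERIV_disp_sq_powr[OF near_ideal_disp_sq_pos[OF assms, of r r' t]] r by simp
  from DERIV_chain2[OF this D1]
  show "((\<lambda>x. disp_sq (cA r r' t) (cB t) (\<epsilon> r' + x * w r' - (\<epsilon> r + x * w r)) powr (- p / 2)) has_real_derivative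
     pair_force p (cA r r' t) (cB t) ?e * (w r' - w r)) (at 0)" .
qed

text \<open>
The two neighbours of a row are different because there are more than two rows, so every gap is
counted exactly twice.
\<close>

lemma sum_adjacent:
  assumes sym: "\<And>r r'. N r' r = N r r'" and non: "\<And>r r'. r' \<noteq> nxt r \<Longrightarrow> r \<noteq> nxt r' \<Longrightarrow> N r r' = 0"
  shows "(\<Sum>r<R. \<Sum>r'\<in>{..<R} - {r}. N r r') = 2 * (\<Sum>r<R. N r (nxt r) :: real)"
proof -
  have "(\<Sum>r<R. \<Sum>r'\<in>{..<R} - {r}. N r r') =
     (\<Sum>r<R. \<Sum>r'<R. (if r' = nxt r then N r r' else 0) + (if r = nxt r' then N r r' else 0))"
  proof (rule sum.cong[OF refl])
    fix r assume r: "r \<in> {..<R}"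
    show "(\<Sum>r'\<in>{..<R} - {r}. N r r') =
      (\<Sum>r'<R. (if r' = nxt r then N r r' else 0) + (if r = nxt r' then N r r' else 0))"
    proof (rule sum.mono_neutral_cong_left)
      show "\<forall>r'\<in>{..<R} - ({..<R} - {r}).
          (if r' = nxt r then N r r' else 0) + (if r = nxt r' then N r r' else 0) = 0"
        using nxt_neq[of r] r by auto
      fix r' assume "r' \<in> {..<R} - {r}"
      then show "N r r' = (if r' = nxt r then N r r' else 0) + (if r = nxt r' then N r r' else 0)"
        using non[of r' r] nxt_nxt_neq[of r] r by auto
    qed auto
  qed
  also have "\<dots> = (\<Sum>r<R. \<Sum>r'<R. if r' = nxt r then N r r' else 0) + (\<Sum>r<R. \<Sum>r'<R. if r = nxt r' then N r r' else 0)"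
    by (simp add: sum.distrib)
  also have "(\<Sum>r<R. \<Sum>r'<R. if r = nxt r' then N r r' else 0) = (\<Sum>r'<R. \<Sum>r<R. if r = nxt r' then N r r' else 0)"
    by (rule sum.swap)
  also have "\<dots> = (\<Sum>r'<R. N r' (nxt r'))"
    using nxt_less sym by simp
  also have "(\<Sum>r<R. \<Sum>r'<R. if r' = nxt r then N r r' else 0) = (\<Sum>r<R. N r (nxt r))"
    using nxt_less by simp
  finally show ?thesis by simp
qed

text \<open>
The direction \<open>w\<close> shifts the rows between two gaps rigidly, so that gap \<open>b\<close> grows at the expense of
gap \<open>a\<close>. Among nearest points only these two gaps feel the change. All remaining pairs of points,
at most \<open>R * R * m\<close> up to translation, contribute an error that is bounded crudely.
\<close>

lemma transfer_derivative:
  assumes \<epsilon>: "near_ideal \<delta> \<epsilon>" and p: "p \<ge> 0" and ab: "a < R" "b < R"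
    and w: "\<And>r. r < R \<Longrightarrow> w (nxt r) - w r = (if r = b then 1 else 0) - (if r = a then 1 else 0)"
      "\<And>r r'. \<bar>w r' - w r\<bar> \<le> 1"
  shows "(\<Sum>r<R. \<Sum>r'\<in>{..<R} - {r}. force p r r' (\<epsilon> r' - \<epsilon> r) * (w r' - w r)) \<le>
    4 * p * (psi a (p / 2 + 1) (\<epsilon> (nxt a) - \<epsilon> a) - psi b (p / 2 + 1) (\<epsilon> (nxt b) - \<epsilon> b))
     + p * (real R * real R * of_int m * (33/10) powr (- p / 2))"
proof -
  let ?c = "of_int m * (p * (33/10) powr (- p / 2))"
  define N where "N r r' = near_force p r r' (\<epsilon> r' - \<epsilon> r) * (w r' - w r)" for r r'
  have sym: "N r' r = N r r'" for r r'
    using near_force_antisym[of p r' r "\<epsilon> r' - \<epsilon> r"] by (simp add: N_def algebra_simps)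
  have "(\<Sum>r<R. \<Sum>r'\<in>{..<R} - {r}. force p r r' (\<epsilon> r' - \<epsilon> r) * (w r' - w r))
     \<le> (\<Sum>r<R. \<Sum>r'\<in>{..<R} - {r}. N r r' + ?c)"
  proof (intro sum_mono)
    fix r r' assume r: "r \<in> {..<R}" "r' \<in> {..<R} - {r}"
    let ?d = "force p r r' (\<epsilon> r' - \<epsilon> r) - near_force p r r' (\<epsilon> r' - \<epsilon> r)"
    have "?d * (w r' - w r) \<le> \<bar>?d\<bar> * \<bar>w r' - w r\<bar>" by (metis abs_ge_self abs_mult)
    also have "\<dots> \<le> ?c * 1"
      using near_force_approx[OF \<epsilon>, of r r' p] r p w(2)[of r' r] m_pos by (intro mult_mono) auto
    finally show "force p r r' (\<epsilon> r' - \<epsilon> r) * (w r' - w r) \<le> N r r' + ?c"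
      by (simp add: N_def algebra_simps)
  qed
  also have "\<dots> = (\<Sum>r<R. \<Sum>r'\<in>{..<R} - {r}. N r r') + (\<Sum>r<R. \<Sum>r'\<in>{..<R} - {r}. ?c)"
    by (simp only: sum.distrib)
  also have "(\<Sum>r<R. \<Sum>r'\<in>{..<R} - {r}. N r r') = 2 * (\<Sum>r<R. N r (nxt r))"
    by (rule sum_adjacent[OF sym]) (simp add: N_def near_force_nonadjacent)
  also have "(\<Sum>r<R. N r (nxt r)) = (\<Sum>r<R. (if r = b then near_force p r (nxt r) (\<epsilon> (nxt r) - \<epsilon> r) else 0)
       - (if r = a then near_force p r (nxt r) (\<epsilon> (nxt r) - \<epsilon> r) else 0))"
    by (intro sum.cong refl) (use w in \<open>auto simp: N_def\<close>)
  also have "\<dots> = near_force p b (nxt b) (\<epsilon> (nxt b) - \<epsilon> b) - near_force p a (nxt a) (\<epsilon> (nxt a) - \<epsilon> a)"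
    using ab by (simp add: sum_subtractf)
  also have "\<dots> = 2 * p * (psi a (p / 2 + 1) (\<epsilon> (nxt a) - \<epsilon> a) - psi b (p / 2 + 1) (\<epsilon> (nxt b) - \<epsilon> b))"
    using ab by (simp add: near_force_nxt algebra_simps)
  also have "(\<Sum>r<R. \<Sum>r'\<in>{..<R} - {r}. ?c) \<le> (\<Sum>r<R. \<Sum>r'<R. ?c)"
    using p m_pos by (intro sum_mono sum_mono2) auto
  also have "\<dots> = p * (real R * real R * of_int m * (33/10) powr (- p / 2))" by simp
  finally show ?thesis by (simp add: algebra_simps)
qed

section \<open>A minimiser in the interior of the box of nearly ideal gaps\<close>

text \<open>
Deviations of gap widths may add up over all \<open>R\<close> rows and still displace no row by more than \<open>1/200\<close>.
\<close>

definition tol :: real where "tol = 1 / (200 * real R)"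

definition gap_dev :: "real \<Rightarrow> (nat \<Rightarrow> real) \<Rightarrow> nat \<Rightarrow> real" where
  "gap_dev \<delta> \<epsilon> r = \<epsilon> (nxt r) - \<epsilon> r - \<delta> * of_int (off (nxt r) - off r)"

text \<open>
Row \<open>0\<close> is held fixed, since the energy depends only on differences. The bounds \<open>- 1\<close> and
\<open>1\<close> only serve compactness and are never attained: the constraints on the gaps already keep the
displacements small.
\<close>

definition gap_box :: "real \<Rightarrow> (nat \<Rightarrow> real) set" where
  "gap_box \<delta> = {\<epsilon>. (\<forall>r. \<epsilon> r \<in> (if r = 0 \<or> r \<ge> R then {0} else {-1..1})) \<and> (\<forall>r<R. \<bar>gap_dev \<delta> \<epsilon> r\<bar> \<le> tol)}"

lemma tol_pos: "tol > 0"
  using R_pos by (simp add: tol_def)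

lemma off_0: "off 0 = 0" by (simp add: off_def)

lemma near_ideal_gap_box:
  assumes "1/6 \<le> \<delta>" "\<delta> \<le> 9/50" "\<epsilon> \<in> gap_box \<delta>"
  shows "near_ideal \<delta> \<epsilon>"
proof -
  have "\<bar>\<epsilon> r - \<delta> * of_int (off r)\<bar> \<le> real r * tol" if "r < R" for r
    using that
  proof (induction r)
    case 0
    have "\<epsilon> 0 \<in> (if (0::nat) = 0 \<or> 0 \<ge> R then {0} else {-1..1})"
      using assms(3) unfolding gap_box_def by blast
    then show ?case by (simp add: off_0)
  next
    case (Suc r)
    then have n: "nxt r = Suc r" by (simp add: nxt_cases)
    have "\<bar>gap_dev \<delta> \<epsilon> r\<bar> \<le> tol" using assms(3) Suc.prems by (simp add: gap_box_def)
    moreover have "\<bar>\<epsilon> r - \<delta> * of_int (off r)\<bar> \<le> real r * tol" using Suc by simp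
    moreover have "\<epsilon> (Suc r) - \<delta> * of_int (off (Suc r)) = gap_dev \<delta> \<epsilon> r + (\<epsilon> r - \<delta> * of_int (off r))"
      by (simp add: gap_dev_def n algebra_simps)
    ultimately show ?case by (simp add: algebra_simps)
  qed
  moreover have "real r * tol \<le> 1/200" if "r < R" for r
    using that R_pos by (simp add: tol_def field_simps)
  ultimately show ?thesis using assms(1,2) unfolding near_ideal_def by (meson order_trans)
qed

lemma compact_gap_box: "compact (gap_box \<delta>)"
proof -
  have 1: "compact {\<epsilon>. \<forall>r. \<epsilon> r \<in> (if r = 0 \<or> r \<ge> R then {0} else {-1..1::real})}"
    by (rule compact_Pi_UNIV) auto
  have 2: "closed {\<epsilon>. \<forall>r. r < R \<longrightarrow> \<bar>gap_dev \<delta> \<epsilon> r\<bar> \<le> tol}"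
    unfolding gap_dev_def
    by (intro closed_Collect_all closed_Collect_imp open_Collect_const closed_Collect_le continuous_intros
         continuous_on_product_coordinates)
  show ?thesis using compact_Int_closed[OF 1 2] by (simp add: gap_box_def Collect_conj_eq)
qed

lemma gap_box_nonempty:
  assumes "1/6 \<le> \<delta>" "\<delta> \<le> 9/50"
  shows "(\<lambda>r. if r < R then \<delta> * of_int (off r) else 0) \<in> gap_box \<delta>"
proof -
  have "\<delta> * of_int (off r) \<in> {-1..1}" for r
    using assms by (simp add: off_def)
  then show ?thesis
    using nxt_less tol_pos by (auto simp: gap_box_def gap_dev_def off_0 algebra_simps less_imp_le)
qed

lemma energy_minimiser:
  assumes "1/6 \<le> \<delta>" "\<delta> \<le> 9/50"
  obtains \<epsilon> where "\<epsilon> \<in> gap_box \<delta>" "\<And>\<epsilon>'. \<epsilon>' \<in> gap_box \<delta> \<Longrightarrow> energy p \<epsilon> \<le> energy p \<epsilon>'"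
proof -
  have "continuous_on (gap_box \<delta>) (energy p)"
    unfolding energy_def
  proof (intro continuous_on_sum continuous_on_powr' continuous_on_const ballI)
    fix r r' t assume r: "r \<in> {..<R}" "r' \<in> {..<R} - {r}"
    show "continuous_on (gap_box \<delta>) (\<lambda>\<epsilon>. disp_sq (cA r r' t) (cB t) (\<epsilon> r' - \<epsilon> r))"
      unfolding disp_sq_def
      by (intro continuous_intros continuous_on_subset[OF continuous_on_product_coordinates]) auto
    fix \<epsilon> assume "\<epsilon> \<in> gap_box \<delta>"
    then have "disp_sq (cA r r' t) (cB t) (\<epsilon> r' - \<epsilon> r) > 0"
      using near_ideal_disp_sq_pos[OF near_ideal_gap_box[OF assms]] r by auto
    then show "0 \<le> disp_sq (cA r r' t) (cB t) (\<epsilon> r' - \<epsilon> r) \<and>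
      (disp_sq (cA r r' t) (cB t) (\<epsilon> r' - \<epsilon> r) = 0 \<longrightarrow> 0 < - p / 2)" by simp
  qed
  from continuous_attains_inf[OF compact_gap_box _ this] gap_box_nonempty[OF assms] that
  show ?thesis by blast
qed

lemma psi_decay:
  assumes "P \<ge> 3" "r < R" "\<bar>x\<bar> \<le> 1/20" "\<bar>y\<bar> \<le> 1/20" "x \<le> y" "1/6 \<le> \<delta>" "\<delta> \<le> 9/50"
  defines "c \<equiv> \<delta> * of_int (off (nxt r) - off r)"
  shows "psi r P (c + y) \<le> psi r P (c + x) * exp (x - y)"
proof -
  have "psi r P (c + y) * exp (c + y) \<le> psi r P (c + x) * exp (c + x)"
  proof (cases "narrow r")
    case True
    then have "c = \<delta>" using narrow_gap[OF assms(2)] by (simp add: c_def)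
    then show ?thesis using True assms by (auto simp: psi_def intro!: narrow_psi_decay)
  next
    case False
    then have "c = - \<delta>" using wide_gap[OF assms(2)] by (simp add: c_def)
    then show ?thesis using False assms by (auto simp: psi_def intro!: wide_psi_decay)
  qed
  then have "psi r P (c + y) * exp (c + y) * exp (- (c + y)) \<le> psi r P (c + x) * exp (c + x) * exp (- (c + y))"
    by (rule mult_right_mono) simp
  then show ?thesis by (simp add: mult.assoc exp_add[symmetric])
qed

lemma psi_level:
  assumes "r < R" "narrow_psi P \<delta> = wide_psi P (- \<delta>)"
  shows "psi r P (\<delta> * of_int (off (nxt r) - off r)) = narrow_psi P \<delta>"
  using narrow_gap(2)[OF assms(1)] wide_gap(2)[OF assms(1)] assms(2)
  by (cases "narrow r") (simp_all add: psi_def del: of_int_diff)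

text \<open>
The difference of two steps is a direction as required by \<open>transfer_derivative\<close>: the jumps of both
steps between the last row and row \<open>0\<close> cancel.
\<close>

definition step :: "nat \<Rightarrow> nat \<Rightarrow> real" where
  "step a r = (if a < r \<and> r < R then 1 else 0)"

lemma step_nxt:
  assumes "r < R" "a < R"
  shows "step a (nxt r) - step a r = (if r = a then 1 else 0) - (if r = R - 1 then 1 else 0)"
  using assms by (auto simp: step_def nxt_cases)

text \<open>
At a minimiser no admissible transfer of width from a gap \<open>a\<close> to a gap \<open>b\<close> can lower the energy.
Hence \<open>b\<close> repels at most as strongly as \<open>a\<close>, up to the error made by the far pairs.
\<close>

lemma minimiser_transfer:
  assumes \<delta>: "1/6 \<le> \<delta>" "\<delta> \<le> 9/50" and p: "p > 0"
    and \<epsilon>: "\<epsilon> \<in> gap_box \<delta>" and min: "\<And>\<epsilon>'. \<epsilon>' \<in> gap_box \<delta> \<Longrightarrow> energy p \<epsilon> \<le> energy p \<epsilon>'"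
    and ab: "a < R" "b < R" "gap_dev \<delta> \<epsilon> a > - tol" "gap_dev \<delta> \<epsilon> b < tol"
  shows "4 * (psi b (p / 2 + 1) (\<epsilon> (nxt b) - \<epsilon> b) - psi a (p / 2 + 1) (\<epsilon> (nxt a) - \<epsilon> a))
     \<le> real R * real R * of_int m * (33/10) powr (- p / 2)"
proof (rule ccontr)
  assume neg: "\<not> ?thesis"
  have near_ideal: "near_ideal \<delta> \<epsilon>" by (rule near_ideal_gap_box[OF \<delta> \<epsilon>])
  define w where "w r = step b r - step a r" for r
  let ?D = "\<Sum>r<R. \<Sum>r'\<in>{..<R} - {r}. force p r r' (\<epsilon> r' - \<epsilon> r) * (w r' - w r)"
  have w1: "w (nxt r) - w r = (if r = b then 1 else 0) - (if r = a then 1 else 0)" if "r < R" for r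
    using step_nxt[OF that ab(1)] step_nxt[OF that ab(2)] by (simp add: w_def)
  have w2: "\<bar>w r' - w r\<bar> \<le> 1" for r r' by (auto simp: w_def step_def)
  have w3: "\<bar>w r\<bar> \<le> 1" for r by (auto simp: w_def step_def)
  have w0: "w r = 0" if "r = 0 \<or> r \<ge> R" for r using that by (auto simp: w_def step_def)
  have "?D \<le> 4 * p * (psi a (p / 2 + 1) (\<epsilon> (nxt a) - \<epsilon> a) - psi b (p / 2 + 1) (\<epsilon> (nxt b) - \<epsilon> b))
     + p * (real R * real R * of_int m * (33/10) powr (- p / 2))"
    by (rule transfer_derivative[OF near_ideal _ ab(1,2) w1 w2]) (use p in auto)
  also have "\<dots> = p * (real R * real R * of_int m * (33/10) powr (- p / 2) -
       4 * (psi b (p / 2 + 1) (\<epsilon> (nxt b) - \<epsilon> b) - psi a (p / 2 + 1) (\<epsilon> (nxt a) - \<epsilon> a)))"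
    by (simp add: algebra_simps)
  also have "\<dots> < 0" using neg p by (intro mult_pos_neg) auto
  finally have "?D < 0" .
  from DERIV_neg_dec_right[OF DERIV_energy[OF near_ideal, of p w] this]
  obtain d where d: "d > 0" "\<And>h. 0 < h \<Longrightarrow> h < d \<Longrightarrow>
     energy p (\<lambda>r. \<epsilon> r + (0 + h) * w r) < energy p (\<lambda>r. \<epsilon> r + 0 * w r)" by blast
  \<comment> \<open>a step that is short enough to stay in the box and to decrease the energy\<close>
  define h where "h = Min {d / 2, 1/10, gap_dev \<delta> \<epsilon> a + tol, tol - gap_dev \<delta> \<epsilon> b}"
  have h_le: "h \<le> d / 2" "h \<le> 1/10" "h \<le> gap_dev \<delta> \<epsilon> a + tol" "h \<le> tol - gap_dev \<delta> \<epsilon> b"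
    unfolding h_def by (rule Min_le, simp, simp)+
  moreover have "h > 0"
    unfolding h_def using d(1) ab by (subst Min_gr_iff) auto
  ultimately have h: "h > 0" "h < d" "h \<le> 1/10" "h \<le> gap_dev \<delta> \<epsilon> a + tol" "h \<le> tol - gap_dev \<delta> \<epsilon> b"
    by linarith+
  let ?\<epsilon> = "\<lambda>r. \<epsilon> r + h * w r"
  have "?\<epsilon> \<in> gap_box \<delta>"
    unfolding gap_box_def
  proof (intro CollectI conjI allI impI)
    fix r
    show "?\<epsilon> r \<in> (if r = 0 \<or> r \<ge> R then {0} else {-1..1})"
    proof (cases "r = 0 \<or> r \<ge> R")
      case True
      have "\<epsilon> r \<in> (if r = 0 \<or> r \<ge> R then {0} else {-1..1})"
        using \<epsilon> unfolding gap_box_def by blast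
      then show ?thesis using True w0[OF True] by auto
    next
      case False
      then have "\<bar>\<epsilon> r\<bar> \<le> 1/5" using near_ideal_abs[OF near_ideal] by simp
      moreover have "\<bar>h * w r\<bar> \<le> 1/10 * 1"
        unfolding abs_mult using h w3 by (intro mult_mono) auto
      ultimately show ?thesis using False by (simp add: abs_le_iff) linarith
    qed
  next
    fix r assume r: "r < R"
    have "gap_dev \<delta> ?\<epsilon> r = gap_dev \<delta> \<epsilon> r + h * (w (nxt r) - w r)"
      by (simp add: gap_dev_def algebra_simps)
    also have "\<dots> = gap_dev \<delta> \<epsilon> r + h * ((if r = b then 1 else 0) - (if r = a then 1 else 0))"
      using w1[OF r] by simp
    finally have e: "gap_dev \<delta> ?\<epsilon> r = gap_dev \<delta> \<epsilon> r + h * ((if r = b then 1 else 0) - (if r = a then 1 else 0))" .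
    have "\<bar>gap_dev \<delta> \<epsilon> r\<bar> \<le> tol" using \<epsilon> r by (simp add: gap_box_def)
    then show "\<bar>gap_dev \<delta> ?\<epsilon> r\<bar> \<le> tol"
      unfolding e using h by (auto simp: abs_le_iff)
  qed
  then show False using min[of ?\<epsilon>] d(2)[of h] h by simp
qed

text \<open>
The gaps close up around the torus, so the deviations of their widths cancel.
\<close>

lemma sum_gap_dev: "(\<Sum>r<R. gap_dev \<delta> \<epsilon> r) = 0"
proof -
  have nx: "(\<Sum>r<R. f (nxt r)) = (\<Sum>r<R. f r)" for f :: "nat \<Rightarrow> real"
    by (rule sum.reindex_bij_betw[OF bij_nxt])
  have "(\<Sum>r<R. gap_dev \<delta> \<epsilon> r) = (\<Sum>r<R. (\<lambda>r. \<epsilon> r - \<delta> * of_int (off r)) (nxt r)) - (\<Sum>r<R. (\<epsilon> r - \<delta> * of_int (off r)))"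
    unfolding sum_subtractf[symmetric] by (intro sum.cong) (auto simp: gap_dev_def algebra_simps)
  then show ?thesis using nx[of "\<lambda>r. \<epsilon> r - \<delta> * of_int (off r)"] by simp
qed

text \<open>
If one gap has an extreme width, then by \<open>sum_gap_dev\<close> some gap does not deviate in the same
direction. The repulsions across the two differ by at least the factor \<open>exp tol\<close>, which exceeds
the error allowed by \<open>minimiser_transfer\<close>.
\<close>

lemma minimiser_interior:
  assumes \<delta>: "1/6 \<le> \<delta>" "\<delta> \<le> 9/50" and p: "p \<ge> 4"
    and level: "narrow_psi (p / 2 + 1) \<delta> = wide_psi (p / 2 + 1) (- \<delta>)"
    and small: "real R * real R * of_int m * (33/10) powr (- p / 2)
        < 4 * (narrow_psi (p / 2 + 1) \<delta> * (1 - exp (- tol)))"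
    and \<epsilon>: "\<epsilon> \<in> gap_box \<delta>" and min: "\<And>\<epsilon>'. \<epsilon>' \<in> gap_box \<delta> \<Longrightarrow> energy p \<epsilon> \<le> energy p \<epsilon>'"
    and r: "r < R"
  shows "\<bar>gap_dev \<delta> \<epsilon> r\<bar> < tol"
proof (rule ccontr)
  let ?P = "p / 2 + 1" and ?L = "narrow_psi (p / 2 + 1) \<delta>"
  have tol: "tol \<le> 1/20" using R_pos by (simp add: tol_def field_simps)
  have L: "?L > 0"
  proof -
    have "1 + 2 * \<delta> + 2 * \<delta>\<^sup>2 > 0" using \<delta> by (intro add_pos_nonneg) auto
    then show ?thesis using \<delta> by (simp add: narrow_psi_def)
  qed
  have devb: "\<bar>gap_dev \<delta> \<epsilon> s\<bar> \<le> tol" if "s < R" for s using \<epsilon> that by (simp add: gap_box_def)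
  have gap: "\<epsilon> (nxt s) - \<epsilon> s = \<delta> * of_int (off (nxt s) - off s) + gap_dev \<delta> \<epsilon> s" for s
    by (simp add: gap_dev_def)
  have up: "psi s ?P (\<epsilon> (nxt s) - \<epsilon> s) \<le> ?L * exp (- gap_dev \<delta> \<epsilon> s)" if "s < R" "gap_dev \<delta> \<epsilon> s \<ge> 0" for s
    using psi_decay[of ?P s 0 "gap_dev \<delta> \<epsilon> s" \<delta>] p that devb[OF that(1)] tol \<delta> psi_level[OF that(1) level]
    unfolding gap by simp
  have dn: "?L * exp (- gap_dev \<delta> \<epsilon> s) \<le> psi s ?P (\<epsilon> (nxt s) - \<epsilon> s)" if "s < R" "gap_dev \<delta> \<epsilon> s \<le> 0" for s
  proof -
    have "?L \<le> psi s ?P (\<epsilon> (nxt s) - \<epsilon> s) * exp (gap_dev \<delta> \<epsilon> s)"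
      using psi_decay[of ?P s "gap_dev \<delta> \<epsilon> s" 0 \<delta>] p that devb[OF that(1)] tol \<delta> psi_level[OF that(1) level]
      unfolding gap by simp
    then have "?L * exp (- gap_dev \<delta> \<epsilon> s) \<le> psi s ?P (\<epsilon> (nxt s) - \<epsilon> s) * exp (gap_dev \<delta> \<epsilon> s) * exp (- gap_dev \<delta> \<epsilon> s)"
      by (rule mult_right_mono) simp
    then show ?thesis by (simp add: mult.assoc exp_add[symmetric])
  qed
  note tr = minimiser_transfer[OF \<delta> _ \<epsilon> min]
  assume "\<not> \<bar>gap_dev \<delta> \<epsilon> r\<bar> < tol"
  then consider "gap_dev \<delta> \<epsilon> r = tol" | "gap_dev \<delta> \<epsilon> r = - tol" using devb[OF r] by linarith
  then show False
  proof cases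
    case 1
    have "\<exists>s<R. gap_dev \<delta> \<epsilon> s \<le> 0"
    proof (rule ccontr)
      assume "\<not> ?thesis"
      then have "(\<Sum>s<R. gap_dev \<delta> \<epsilon> s) > 0" using R_pos by (intro sum_pos) auto
      then show False by (simp add: sum_gap_dev)
    qed
    then obtain s where s: "s < R" "gap_dev \<delta> \<epsilon> s \<le> 0" by blast
    have "?L * 1 \<le> ?L * exp (- gap_dev \<delta> \<epsilon> s)" using L s by (intro mult_left_mono) auto
    then have "?L \<le> psi s ?P (\<epsilon> (nxt s) - \<epsilon> s)" using dn[OF s] by linarith
    moreover have "psi r ?P (\<epsilon> (nxt r) - \<epsilon> r) \<le> ?L * exp (- tol)"
      using up[OF r] 1 tol_pos by simp
    moreover have "4 * (psi s ?P (\<epsilon> (nxt s) - \<epsilon> s) - psi r ?P (\<epsilon> (nxt r) - \<epsilon> r))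
       \<le> real R * real R * of_int m * (33/10) powr (- p / 2)"
      by (rule tr) (use p r s 1 tol_pos in auto)
    ultimately show False using small by (simp add: algebra_simps)
  next
    case 2
    have "\<exists>s<R. gap_dev \<delta> \<epsilon> s \<ge> 0"
    proof (rule ccontr)
      assume "\<not> ?thesis"
      then have "(\<Sum>s<R. - gap_dev \<delta> \<epsilon> s) > 0" using R_pos by (intro sum_pos) auto
      then show False by (simp add: sum_gap_dev sum_negf)
    qed
    then obtain s where s: "s < R" "gap_dev \<delta> \<epsilon> s \<ge> 0" by blast
    have "?L * exp (- gap_dev \<delta> \<epsilon> s) \<le> ?L * 1" using L s by (intro mult_left_mono) auto
    then have "psi s ?P (\<epsilon> (nxt s) - \<epsilon> s) \<le> ?L" using up[OF s] by linarith
    moreover have "?L * exp tol \<le> psi r ?P (\<epsilon> (nxt r) - \<epsilon> r)"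
      using dn[OF r] 2 tol_pos by simp
    moreover have "4 * (psi r ?P (\<epsilon> (nxt r) - \<epsilon> r) - psi s ?P (\<epsilon> (nxt s) - \<epsilon> s))
       \<le> real R * real R * of_int m * (33/10) powr (- p / 2)"
      by (rule tr) (use p r s 2 tol_pos in auto)
    moreover have "?L * (1 - exp (- tol)) \<le> ?L * (exp tol - 1)"
    proof (rule mult_left_mono)
      have "1 + tol \<le> exp tol" "1 + - tol \<le> exp (- tol)" by (rule exp_ge_add_one_self)+
      then show "1 - exp (- tol) \<le> exp tol - 1" by linarith
    qed (use L in simp)
    ultimately show False using small by (simp add: algebra_simps)
  qed
qed

text \<open>
Every row except row \<open>0\<close> can be moved a little in both directions within the box, which gives a
vanishing derivative. The force on row \<open>0\<close> vanishes as well because all forces add up to zero.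
\<close>

lemma equilibrium:
  assumes p: "p \<ge> 22"
    and small: "\<And>\<delta>. 1/6 \<le> \<delta> \<Longrightarrow> \<delta> \<le> 9/50 \<Longrightarrow> real R * real R * of_int m * (33/10) powr (- p / 2)
        < 4 * (narrow_psi (p / 2 + 1) \<delta> * (1 - exp (- tol)))"
  obtains \<delta> \<epsilon> where "near_ideal \<delta> \<epsilon>" "\<And>r. r < R \<Longrightarrow> (\<Sum>r'\<in>{..<R} - {r}. force p r r' (\<epsilon> r' - \<epsilon> r)) = 0"
proof -
  obtain \<delta> where \<delta>: "1/6 \<le> \<delta>" "\<delta> \<le> 9/50" and level: "narrow_psi (p / 2 + 1) \<delta> = wide_psi (p / 2 + 1) (- \<delta>)"
    using psi_equilibrium[of "p / 2 + 1"] p by auto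
  obtain \<epsilon> where \<epsilon>: "\<epsilon> \<in> gap_box \<delta>" and min: "\<And>\<epsilon>'. \<epsilon>' \<in> gap_box \<delta> \<Longrightarrow> energy p \<epsilon> \<le> energy p \<epsilon>'"
    using energy_minimiser[OF \<delta>] by blast
  have near_ideal: "near_ideal \<delta> \<epsilon>" by (rule near_ideal_gap_box[OF \<delta> \<epsilon>])
  have int: "\<bar>gap_dev \<delta> \<epsilon> r\<bar> < tol" if "r < R" for r
    by (rule minimiser_interior[OF \<delta> _ level small[OF \<delta>] \<epsilon> min that]) (use p in auto)
  define F where "F r = (\<Sum>r'\<in>{..<R} - {r}. force p r r' (\<epsilon> r' - \<epsilon> r))" for r
  have anti: "force p r' r (\<epsilon> r - \<epsilon> r') = - force p r r' (\<epsilon> r' - \<epsilon> r)" for r r'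
    using force_antisym[of p r' r "\<epsilon> r' - \<epsilon> r"] by simp
  have pos: "F a = 0" if a: "a < R" "a \<noteq> 0" for a
  proof -
    define w where "w r = (if r = a then 1 else 0 :: real)" for r
    let ?D = "\<Sum>r<R. \<Sum>r'\<in>{..<R} - {r}. force p r r' (\<epsilon> r' - \<epsilon> r) * (w r' - w r)"
    have "?D = (\<Sum>r<R. \<Sum>r'\<in>{..<R} - {r}. force p r r' (\<epsilon> r' - \<epsilon> r) * w r')
        - (\<Sum>r<R. \<Sum>r'\<in>{..<R} - {r}. force p r r' (\<epsilon> r' - \<epsilon> r) * w r)"
      by (simp add: sum_subtractf right_diff_distrib)
    also have "(\<Sum>r<R. \<Sum>r'\<in>{..<R} - {r}. force p r r' (\<epsilon> r' - \<epsilon> r) * w r') =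
        (\<Sum>r<R. \<Sum>r'\<in>{..<R} - {r}. force p r' r (\<epsilon> r - \<epsilon> r') * w r)"
      by (rule sum_offdiagonal_swap)
    also have "\<dots> = - (\<Sum>r<R. \<Sum>r'\<in>{..<R} - {r}. force p r r' (\<epsilon> r' - \<epsilon> r) * w r)"
      unfolding sum_negf[symmetric] by (intro sum.cong refl, subst anti) simp
    also have "(\<Sum>r<R. \<Sum>r'\<in>{..<R} - {r}. force p r r' (\<epsilon> r' - \<epsilon> r) * w r) = (\<Sum>r<R. F r * w r)"
      by (simp add: F_def sum_distrib_right)
    also have "\<dots> = (\<Sum>r<R. if r = a then F r else 0)" by (intro sum.cong) (auto simp: w_def)
    also have "\<dots> = F a" using a by simp
    finally have D: "?D = - 2 * F a" by simp
    \<comment> \<open>the room that row \<open>a\<close> has on both sides\<close>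
    define d where "d = Min (insert (1/10) ((\<lambda>r. tol - \<bar>gap_dev \<delta> \<epsilon> r\<bar>) ` {..<R}))"
    have d: "d > 0" unfolding d_def using int by (subst Min_gr_iff) auto
    have d1: "d \<le> 1/10" unfolding d_def by (rule Min_le) auto
    have d2: "d \<le> tol - \<bar>gap_dev \<delta> \<epsilon> r\<bar>" if "r < R" for r unfolding d_def using that by (intro Min_le) auto
    have "?D = 0"
    proof (rule DERIV_local_min[OF DERIV_energy[OF near_ideal, of p w] d], intro allI impI)
      fix x assume x: "\<bar>0 - x\<bar> < d"
      have "(\<lambda>r. \<epsilon> r + x * w r) \<in> gap_box \<delta>"
        unfolding gap_box_def
      proof (intro CollectI conjI allI impI)
        fix r
        have "\<epsilon> r \<in> (if r = 0 \<or> r \<ge> R then {0} else {-1..1})"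
          using \<epsilon> unfolding gap_box_def by blast
        moreover have "\<bar>\<epsilon> a\<bar> \<le> 1/5" using near_ideal_abs[OF near_ideal a(1)] .
        ultimately show "\<epsilon> r + x * w r \<in> (if r = 0 \<or> r \<ge> R then {0} else {-1..1})"
          using a x d1 by (auto simp: w_def abs_le_iff abs_less_iff)
      next
        fix r assume r: "r < R"
        have "gap_dev \<delta> (\<lambda>r. \<epsilon> r + x * w r) r = gap_dev \<delta> \<epsilon> r + x * (w (nxt r) - w r)"
          by (simp add: gap_dev_def algebra_simps)
        moreover have "\<bar>x * (w (nxt r) - w r)\<bar> \<le> \<bar>x\<bar>"
          by (auto simp: w_def)
        ultimately show "\<bar>gap_dev \<delta> (\<lambda>r. \<epsilon> r + x * w r) r\<bar> \<le> tol"
          using d2[OF r] x by linarith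
      qed
      from min[OF this] show "energy p (\<lambda>r. \<epsilon> r + 0 * w r) \<le> energy p (\<lambda>r. \<epsilon> r + x * w r)" by simp
    qed
    then show ?thesis using D by simp
  qed
  have "(\<Sum>r<R. F r) = - (\<Sum>r<R. F r)"
    unfolding F_def sum_negf[symmetric]
    by (subst sum_offdiagonal_swap) (intro sum.cong refl anti)
  then have "(\<Sum>r<R. F r) = 0" by simp
  moreover have "(\<Sum>r<R. F r) = F 0"
    using pos R_pos by (subst sum.remove[of _ 0]) auto
  ultimately have "F r = 0" if "r < R" for r using pos that by (cases "r = 0") auto
  then show thesis using that near_ideal unfolding F_def by blast
qed

section \<open>The configuration on the torus\<close>

definition cols :: nat where "cols = 3 * J"
definition num :: nat where "num = R * cols"
definition row_of :: "nat \<Rightarrow> nat" where "row_of i = i div cols"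
definition col_of :: "nat \<Rightarrow> int" where "col_of i = int (i mod cols)"

text \<open>
A lift of the \<open>i\<close>-th point to the plane: displacing the row by \<open>\<epsilon>\<close> adds \<open>(\<epsilon>, - \<epsilon>) / m\<close>.
\<close>

definition pt :: "(nat \<Rightarrow> real) \<Rightarrow> nat \<Rightarrow> real^2" where
  "pt \<epsilon> i = vector [(of_int (col_of i + diag (row_of i)) + \<epsilon> (row_of i)) / of_int m, (of_int (col_of i) - \<epsilon> (row_of i)) / of_int m]"

definition config :: "(nat \<Rightarrow> real) \<Rightarrow> nat \<Rightarrow> torus" where
  "config \<epsilon> = (\<lambda>i\<in>{..<num}. torus_class (pt \<epsilon> i))"

definition sepA :: "nat \<Rightarrow> nat \<Rightarrow> int" where "sepA i j = cA (row_of j) (row_of i) (col_of i - col_of j)"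
definition sepB :: "nat \<Rightarrow> nat \<Rightarrow> int" where "sepB i j = cB (col_of i - col_of j)"

text \<open>
For relative displacements below \<open>1/2\<close> the shortest lift of the difference of two
points, with squared length \<open>sep_sq \<epsilon> i j / m\<^sup>2\<close>.
\<close>

definition sep :: "(nat \<Rightarrow> real) \<Rightarrow> nat \<Rightarrow> nat \<Rightarrow> real^2" where
  "sep \<epsilon> i j = vector [(of_int (sepA i j) + (\<epsilon> (row_of i) - \<epsilon> (row_of j))) / of_int m,
                        (of_int (sepB i j) - (\<epsilon> (row_of i) - \<epsilon> (row_of j))) / of_int m]"

definition sep_sq :: "(nat \<Rightarrow> real) \<Rightarrow> nat \<Rightarrow> nat \<Rightarrow> real" where
  "sep_sq \<epsilon> i j = disp_sq (sepA i j) (sepB i j) (\<epsilon> (row_of i) - \<epsilon> (row_of j))"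

lemma m_cols: "m = int cols" by (simp add: m_def cols_def)
lemma cols_pos: "cols > 0" using J_ge by (simp add: cols_def)
lemma num_eq: "num = 6 * J\<^sup>2" by (simp add: num_def R_def cols_def power2_eq_square)

lemma row_less: "i < num \<Longrightarrow> row_of i < R"
  unfolding row_of_def num_def using cols_pos by (simp add: div_less_iff_less_mult)

lemma col_bounds: "0 \<le> col_of i" "col_of i < m"
  using cols_pos by (auto simp: col_of_def m_cols)

lemma row_col_inject: "row_of i = row_of j \<Longrightarrow> col_of i = col_of j \<Longrightarrow> i = j"
  unfolding row_of_def col_of_def by (metis div_mult_mod_eq of_nat_eq_iff)

lemma row_col_inverse: "row_of i * cols + nat (col_of i) = i"
  by (simp add: row_of_def col_of_def)

lemma row_col_ex:
  assumes "r < R" "0 \<le> k" "k < m"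
  shows "r * cols + nat k < num" "row_of (r * cols + nat k) = r" "col_of (r * cols + nat k) = k"
proof -
  have k: "nat k < cols" using assms by (simp add: m_cols)
  show "row_of (r * cols + nat k) = r" using k by (simp add: row_of_def)
  show "col_of (r * cols + nat k) = k" using k assms by (simp add: col_of_def)
  have "r * cols + nat k < (r + 1) * cols" using k by simp
  also have "\<dots> \<le> R * cols" using assms by (intro mult_le_mono) auto
  finally show "r * cols + nat k < num" by (simp add: num_def)
qed

lemma sum_points:
  "(\<Sum>j<num. f (row_of j) (col_of j)) = (\<Sum>r<R. \<Sum>k\<in>{0..<m}. f r k)"
proof -
  have "(\<Sum>r<R. \<Sum>k\<in>{0..<m}. f r k) = (\<Sum>(r, k)\<in>{..<R} \<times> {0..<m}. f r k)"
    by (rule sum.cartesian_product)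
  also have "\<dots> = (\<Sum>j<num. f (row_of j) (col_of j))"
    by (rule sum.reindex_bij_witness[of _ "\<lambda>j. (row_of j, col_of j)" "\<lambda>(r, k). r * cols + nat k"])
       (auto simp: row_col_ex row_less col_bounds row_col_inverse)
  finally show ?thesis by simp
qed

lemma sepA_uminus: "sepA j i = - sepA i j" and sepB_uminus: "sepB j i = - sepB i j"
  unfolding sepA_def sepB_def cA_def cB_def centred_mod_uminus[OF odd_m m_pos, symmetric]
  by (simp_all add: algebra_simps)

lemma sep_sq_sym: "sep_sq \<epsilon> j i = sep_sq \<epsilon> i j"
proof -
  have "\<epsilon> (row_of j) - \<epsilon> (row_of i) = - (\<epsilon> (row_of i) - \<epsilon> (row_of j))" by simp
  then show ?thesis unfolding sep_sq_def sepA_uminus[of j i] sepB_uminus[of j i] by (simp only: disp_sq_uminus)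
qed

lemma sep_uminus: "sep \<epsilon> j i = - sep \<epsilon> i j"
  unfolding sep_def sepA_uminus[of j i] sepB_uminus[of j i]
  by (simp add: vec_eq_iff forall_2 field_simps minus_divide_left del: of_int_minus)

lemma norm_sep: "norm (sep \<epsilon> i j) = sqrt (sep_sq \<epsilon> i j) / of_int m"
  using m_pos
  by (simp add: norm_vec_def L2_set_def sum_2 sep_def sep_sq_def disp_sq_def power_divide real_sqrt_divide
      add_divide_distrib[symmetric])

lemma sep_lift: "pt \<epsilon> i - pt \<epsilon> j - sep \<epsilon> i j \<in> int_lattice"
proof -
  have "m dvd sepA i j - (col_of i - col_of j + (diag (row_of i) - diag (row_of j)))" "m dvd sepB i j - (col_of i - col_of j)"
    unfolding sepA_def sepB_def cA_def cB_def by (rule dvd_centred_mod_diff)+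
  then obtain u v where u: "sepA i j = col_of i - col_of j + (diag (row_of i) - diag (row_of j)) + m * u"
    and v: "sepB i j = col_of i - col_of j + m * v"
    unfolding dvd_def by (metis add.commute diff_add_cancel)
  have "(pt \<epsilon> i - pt \<epsilon> j - sep \<epsilon> i j) $ 1 = of_int (- u)" "(pt \<epsilon> i - pt \<epsilon> j - sep \<epsilon> i j) $ 2 = of_int (- v)"
    using m_pos by (simp_all add: pt_def sep_def u v field_simps)
  then show ?thesis unfolding int_lattice_def by (simp only: mem_Collect_eq forall_2 Ints_of_int simp_thms)
qed

context
  fixes \<delta> :: real and \<epsilon> :: "nat \<Rightarrow> real"
  assumes near_ideal: "near_ideal \<delta> \<epsilon>"
begin

text \<open>
Here the oddness of \<open>m\<close> enters: a centred residue is at most \<open>(m - 1) / 2\<close>, and the relative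
displacement is less than \<open>1/2\<close>.
\<close>

lemma sep_no_kink:
  assumes "i < num" "j < num"
  shows "\<bar>sep \<epsilon> i j $ c\<bar> < 1/2"
proof -
  have e: "\<bar>\<epsilon> (row_of i) - \<epsilon> (row_of j)\<bar> < 1/2"
    using near_ideal_less_half[OF near_ideal] assms row_less by simp
  have "2 * \<bar>sepA i j\<bar> \<le> m - 1" "2 * \<bar>sepB i j\<bar> \<le> m - 1"
    unfolding sepA_def sepB_def cA_def cB_def
    using centred_mod_bound[OF odd_m m_pos] by (simp_all add: int_one_le_iff_zero_less zle_diff1_eq)
  then have "of_int (2 * \<bar>sepA i j\<bar>) \<le> (of_int (m - 1) :: real)" "of_int (2 * \<bar>sepB i j\<bar>) \<le> (of_int (m - 1) :: real)"
    by (simp_all only: of_int_le_iff)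
  then have A: "2 * \<bar>real_of_int (sepA i j)\<bar> \<le> of_int m - 1" and B: "2 * \<bar>real_of_int (sepB i j)\<bar> \<le> of_int m - 1"
    by simp_all
  have mp: "real_of_int m > 0" using m_pos by simp
  have half: "\<bar>x / of_int m\<bar> < 1/2" if "2 * \<bar>x\<bar> < of_int m" for x :: real
    using that mp by (simp add: abs_divide field_simps)
  have add: "2 * \<bar>a + x\<bar> < of_int m" "2 * \<bar>a - x\<bar> < of_int m"
    if "2 * \<bar>a\<bar> \<le> of_int m - 1" "\<bar>x\<bar> < 1/2" for a x :: real
  proof -
    have aux: "2 * c < of_int m" if "2 * u \<le> of_int m - 1" "v < 1/2" "c \<le> u + v" for c u v :: real
      using that by linarith
    show "2 * \<bar>a + x\<bar> < of_int m" "2 * \<bar>a - x\<bar> < of_int m"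
      by (rule aux[OF that abs_triangle_ineq] aux[OF that abs_triangle_ineq4])+
  qed
  have "2 * \<bar>real_of_int (sepA i j) + (\<epsilon> (row_of i) - \<epsilon> (row_of j))\<bar> < of_int m"
    "2 * \<bar>real_of_int (sepB i j) - (\<epsilon> (row_of i) - \<epsilon> (row_of j))\<bar> < of_int m"
    using add(1)[OF A e] add(2)[OF B e] .
  from this[THEN half] have "\<bar>sep \<epsilon> i j $ 1\<bar> < 1/2 \<and> \<bar>sep \<epsilon> i j $ 2\<bar> < 1/2"
    unfolding sep_def vector_2 by blast
  then show ?thesis using exhaust_2[of c] by auto
qed

lemma sep_sq_pos:
  assumes "i < num" "j < num" "i \<noteq> j"
  shows "sep_sq \<epsilon> i j > 0"
proof (cases "row_of i = row_of j")
  case False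
  then show ?thesis
    unfolding sep_sq_def sepA_def sepB_def using near_ideal_disp_sq_pos[OF near_ideal] assms row_less by auto
next
  case True
  have "\<not> m dvd col_of i - col_of j"
  proof
    assume "m dvd col_of i - col_of j"
    moreover have "\<bar>col_of i - col_of j\<bar> < m" using col_bounds[of i] col_bounds[of j] by linarith
    ultimately have "col_of i - col_of j = 0" using dvd_imp_le_int[of "col_of i - col_of j" m] m_pos by auto
    then show False using row_col_inject[OF True] assms(3) by simp
  qed
  moreover have "m dvd sepB i j - (col_of i - col_of j)" unfolding sepB_def cB_def by (rule dvd_centred_mod_diff)
  ultimately have "sepB i j \<noteq> 0" by (metis diff_0 dvd_minus_iff)
  then have "(real_of_int (sepB i j))\<^sup>2 > 0" by simp
  then show ?thesis using True unfolding sep_sq_def disp_sq_def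
    by (simp add: add_nonneg_pos)
qed

lemma dist_config:
  assumes "i < num" "j < num"
  shows "dist (config \<epsilon> i) (config \<epsilon> j) = sqrt (sep_sq \<epsilon> i j) / of_int m"
proof -
  have "dist (torus_class (pt \<epsilon> i)) (torus_class (pt \<epsilon> j)) = norm (sep \<epsilon> i j)"
    by (rule dist_torus_class_eq_norm[OF less_imp_le[OF sep_no_kink[OF assms]] sep_lift])
  then show ?thesis using assms by (simp add: config_def norm_sep)
qed

lemma config_in: "config \<epsilon> \<in> configs num"
  by (simp add: config_def configs_def)

lemma inj_config: "inj_on (config \<epsilon>) {..<num}"
proof (rule inj_onI, rule ccontr)
  fix i j assume ij: "i \<in> {..<num}" "j \<in> {..<num}" "config \<epsilon> i = config \<epsilon> j" "i \<noteq> j"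
  then have "sqrt (sep_sq \<epsilon> i j) / of_int m = 0"
    using dist_config[of i j] by simp
  then show False using sep_sq_pos[of i j] ij m_pos by simp
qed

text \<open>
The reflection \<open>(x, y) \<mapsto> (- y, - x)\<close> permutes the differences between two rows.
\<close>

lemma sum_reflect_row:
  "(\<Sum>t\<in>{0..<m}. f (cA r r' t) (cB t)) = (\<Sum>t\<in>{0..<m}. f (- cB t) (- cA r r' t))"
proof -
  let ?D = "diag r' - diag r"
  have "(\<Sum>t\<in>{0..<m}. f (cA r r' (- ?D - t)) (cB (- ?D - t))) = (\<Sum>t\<in>{0..<m}. f (cA r r' t) (cB t))"
    by (rule sum_residues_reflect[OF m_pos]) (simp add: cA_def cB_def)
  moreover have "cA r r' (- ?D - t) = - cB t" "cB (- ?D - t) = - cA r r' t" for t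
    unfolding cA_def cB_def centred_mod_uminus[OF odd_m m_pos, symmetric] by (simp_all add: algebra_simps)
  ultimately show ?thesis by simp
qed

text \<open>
The reflection keeps lengths and negates the component \<open>A + B\<close> along the row.
\<close>

lemma along_row_balanced:
  "(\<Sum>t\<in>{0..<m}. disp_sq (cA r r' t) (cB t) e powr s * of_int (cA r r' t + cB t)) = 0"
proof -
  have "(\<Sum>t\<in>{0..<m}. disp_sq (cA r r' t) (cB t) e powr s * of_int (cA r r' t + cB t))
      = (\<Sum>t\<in>{0..<m}. disp_sq (- cB t) (- cA r r' t) e powr s * of_int (- cB t + - cA r r' t))"
    by (rule sum_reflect_row)
  also have "\<dots> = - (\<Sum>t\<in>{0..<m}. disp_sq (cA r r' t) (cB t) e powr s * of_int (cA r r' t + cB t))"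
    unfolding disp_sq_swap sum_negf[symmetric] by (intro sum.cong) (auto simp: algebra_simps)
  finally show ?thesis by simp
qed

text \<open>
The sum of both coordinates of the net force is its component along the row and vanishes by
reflection; the difference of the coordinates is the perpendicular component, which is the force on
the whole row divided among its points.
\<close>

lemma config_balanced:
  assumes p: "p > 0" and bal: "\<And>r. r < R \<Longrightarrow> (\<Sum>r'\<in>{..<R} - {r}. force p r r' (\<epsilon> r' - \<epsilon> r)) = 0"
    and i: "i < num"
  shows "(\<Sum>j\<in>{..<num} - {i}. norm (sep \<epsilon> i j) powr (- p - 2) *\<^sub>R sep \<epsilon> i j) = 0"
proof -
  let ?P = "p / 2 + 1" and ?r = "row_of i"
  have mp: "real_of_int m > 0" using m_pos by simp
  \<comment> \<open>the factor that accounts for measuring lengths in units of \<open>1 / m\<close>\<close>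
  define C where "C = of_int m powr (p + 2) / of_int m"
  define q where "q r t = disp_sq (cA r ?r t) (cB t) (\<epsilon> ?r - \<epsilon> r) powr (- ?P)" for r t
  define X where "X r t = q r t * (of_int (cA r ?r t) + (\<epsilon> ?r - \<epsilon> r))" for r t
  define Y where "Y r t = q r t * (of_int (cB t) - (\<epsilon> ?r - \<epsilon> r))" for r t
  have nrm: "norm (sep \<epsilon> i j) powr (- p - 2) = of_int m powr (p + 2) * sep_sq \<epsilon> i j powr (- ?P)" if "j < num" "j \<noteq> i" for j
  proof -
    have "sep_sq \<epsilon> i j > 0" using sep_sq_pos[of i j] that i by auto
    then have "norm (sep \<epsilon> i j) = sep_sq \<epsilon> i j powr (1/2) * of_int m powr (- 1)"
      unfolding norm_sep using mp by (simp add: powr_half_sqrt powr_minus_divide)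
    then have "norm (sep \<epsilon> i j) powr (- p - 2) =
        sep_sq \<epsilon> i j powr ((1/2) * (- p - 2)) * of_int m powr ((- 1) * (- p - 2))"
      by (simp only: powr_mult powr_powr)
    moreover have "(1/2) * (- p - 2) = - ?P" "(- 1) * (- p - 2) = p + 2" by simp_all
    ultimately show ?thesis by (simp only: mult.commute)
  qed
  have summand: "norm (sep \<epsilon> i j) powr (- p - 2) *\<^sub>R sep \<epsilon> i j =
      vector [C * X (row_of j) (col_of i - col_of j), C * Y (row_of j) (col_of i - col_of j)]" if "j < num" "j \<noteq> i" for j
    unfolding nrm[OF that]
    by (simp add: vec_eq_iff forall_2 sep_def C_def X_def Y_def q_def sep_sq_def sepA_def sepB_def)
  have self: "X (row_of i) (col_of i - col_of i) = 0" "Y (row_of i) (col_of i - col_of i) = 0"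
    by (simp_all add: X_def Y_def q_def cA_def cB_def cB_values(1)[unfolded cB_def])
  have per: "X r (t mod m) = X r t" "Y r (t mod m) = Y r t" for r t
    by (simp_all add: X_def Y_def q_def cA_def cB_def)
  have conv: "(\<Sum>j\<in>{..<num} - {i}. C * f (row_of j) (col_of i - col_of j)) = C * (\<Sum>r<R. \<Sum>t\<in>{0..<m}. f r t)"
    if "f (row_of i) (col_of i - col_of i) = 0" "\<And>r t. f r (t mod m) = f r t" for f
  proof -
    have "(\<Sum>j\<in>{..<num} - {i}. C * f (row_of j) (col_of i - col_of j)) = (\<Sum>j<num. C * f (row_of j) (col_of i - col_of j))"
      by (rule sum.mono_neutral_left) (use that in auto)
    also have "\<dots> = (\<Sum>r<R. \<Sum>k\<in>{0..<m}. C * f r (col_of i - k))"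
      by (rule sum_points)
    also have "\<dots> = (\<Sum>r<R. \<Sum>t\<in>{0..<m}. C * f r t)"
      by (intro sum.cong refl sum_residues_reflect[OF m_pos]) (simp add: that)
    finally show ?thesis by (simp add: sum_distrib_left)
  qed
  have U: "(\<Sum>r<R. \<Sum>t\<in>{0..<m}. X r t + Y r t) = 0"
  proof (rule sum.neutral, rule ballI)
    fix r
    have "(\<Sum>t\<in>{0..<m}. X r t + Y r t) = (\<Sum>t\<in>{0..<m}. q r t * of_int (cA r ?r t + cB t))"
      by (intro sum.cong) (auto simp: X_def Y_def algebra_simps)
    then show "(\<Sum>t\<in>{0..<m}. X r t + Y r t) = 0"
      unfolding q_def using along_row_balanced by simp
  qed
  have V: "(\<Sum>r<R. \<Sum>t\<in>{0..<m}. X r t - Y r t) = 0"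
  proof -
    have F: "p * (\<Sum>t\<in>{0..<m}. X r t - Y r t) = force p ?r r (\<epsilon> r - \<epsilon> ?r)" for r
    proof -
      have "p * (\<Sum>t\<in>{0..<m}. X r t - Y r t) = - force p r ?r (\<epsilon> ?r - \<epsilon> r)"
        unfolding force_def sum_distrib_left sum_negf[symmetric]
        by (intro sum.cong) (auto simp: X_def Y_def q_def pair_force_def algebra_simps)
      also have "\<dots> = force p ?r r (\<epsilon> r - \<epsilon> ?r)"
        using force_antisym[of p ?r r "\<epsilon> ?r - \<epsilon> r"] by simp
      finally show ?thesis .
    qed
    have 0: "force p ?r ?r (\<epsilon> ?r - \<epsilon> ?r) = 0"
      using force_antisym[of p ?r ?r 0] by simp
    have "p * (\<Sum>r<R. \<Sum>t\<in>{0..<m}. X r t - Y r t) = (\<Sum>r<R. force p ?r r (\<epsilon> r - \<epsilon> ?r))"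
      unfolding sum_distrib_left[of p "\<lambda>r. \<Sum>t\<in>{0..<m}. X r t - Y r t"] F ..
    also have "\<dots> = (\<Sum>r\<in>{..<R} - {?r}. force p ?r r (\<epsilon> r - \<epsilon> ?r))"
      by (rule sum.mono_neutral_right) (use 0 in auto)
    also have "\<dots> = 0" using bal row_less[OF i] by simp
    finally show ?thesis using p by simp
  qed
  have "(\<Sum>r<R. \<Sum>t\<in>{0..<m}. X r t) = 0" "(\<Sum>r<R. \<Sum>t\<in>{0..<m}. Y r t) = 0"
    using U V by (simp_all add: sum.distrib sum_subtractf)
  then have XY: "(\<Sum>j\<in>{..<num} - {i}. C * X (row_of j) (col_of i - col_of j)) = 0"
    "(\<Sum>j\<in>{..<num} - {i}. C * Y (row_of j) (col_of i - col_of j)) = 0"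
    using conv[of X] conv[of Y] self per by simp_all
  have "(\<Sum>j\<in>{..<num} - {i}. norm (sep \<epsilon> i j) powr (- p - 2) *\<^sub>R sep \<epsilon> i j) =
     (\<Sum>j\<in>{..<num} - {i}. vector [C * X (row_of j) (col_of i - col_of j), C * Y (row_of j) (col_of i - col_of j)])"
    by (intro sum.cong) (auto simp: summand)
  also have "\<dots> = 0" using XY by (simp add: vec_eq_iff forall_2)
  finally show ?thesis .
qed

lemma config_critical:
  assumes "p > 0" "\<And>r. r < R \<Longrightarrow> (\<Sum>r'\<in>{..<R} - {r}. force p r r' (\<epsilon> r' - \<epsilon> r)) = 0"
  shows "config \<epsilon> \<in> critical_points p num"
proof -
  have "has_gradient num (riesz_energy p num) (\<lambda>_. 0) (config \<epsilon>)"
  proof (rule has_gradient_zero_if_balanced[where X = "pt \<epsilon>" and Z = "sep \<epsilon>"])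
    fix i j assume ij: "i < num" "j < num" "i \<noteq> j"
    show "sep \<epsilon> i j \<noteq> 0"
      using sep_sq_pos[OF ij] m_pos norm_sep[of \<epsilon> i j] by auto
    show "sep \<epsilon> j i = - sep \<epsilon> i j" by (rule sep_uminus)
    show "pt \<epsilon> i - pt \<epsilon> j - sep \<epsilon> i j \<in> int_lattice" by (rule sep_lift)
    show "\<bar>sep \<epsilon> i j $ c\<bar> < 1/2" for c by (rule sep_no_kink[OF ij(1,2)])
  next
    fix i assume i: "i < num"
    then show "config \<epsilon> i = torus_class (pt \<epsilon> i)" by (simp add: config_def)
    show "(\<Sum>j\<in>{..<num} - {i}. norm (sep \<epsilon> i j) powr (- p - 2) *\<^sub>R sep \<epsilon> i j) = 0"
      by (rule config_balanced[OF assms i])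
  qed
  then show ?thesis
    using config_in inj_config by (simp add: critical_points_def)
qed

end

section \<open>Recovering the gap types from the distances\<close>

definition prv :: "nat \<Rightarrow> nat" where "prv r = (r + (R - 1)) mod R"

lemma prv_unique:
  assumes "r < R" "s < R" "nxt r = s"
  shows "r = prv s"
proof -
  have "(r + 1) mod R = s" using assms(3) by (simp add: nxt_def)
  then have "prv s = (r + 1 + (R - 1)) mod R" unfolding prv_def by (metis mod_add_left_eq)
  also have "\<dots> = r" using assms(1) by simp
  finally show ?thesis by simp
qed

definition double_link :: "(nat \<Rightarrow> nat \<Rightarrow> real) \<Rightarrow> nat \<Rightarrow> nat \<Rightarrow> bool" where
  "double_link q a b \<longleftrightarrow> (\<exists>i<num. \<exists>j<num. \<exists>j'<num. row_of i = a \<and> row_of j = b \<and> row_of j' = b \<and>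
     j \<noteq> j' \<and> q i j < 2 \<and> q i j' < 2)"

text \<open>
What the squared distances \<open>q\<close> (in units of \<open>1 / m\<^sup>2\<close>) reveal about rows and gaps: the value
\<open>2\<close> marks neighbours within a row, smaller values mark neighbours across a gap, and \<open>T\<close>
tells for which gaps some point has two such neighbours. The last condition looks at the gap from
its other side, as it appears after a reversal of the order of the rows.
\<close>

definition row_structure :: "(nat \<Rightarrow> nat \<Rightarrow> real) \<Rightarrow> (nat \<Rightarrow> bool) \<Rightarrow> bool" where
  "row_structure q T \<longleftrightarrow>
    (\<forall>i<num. \<forall>j<num. i \<noteq> j \<longrightarrow> q i j = 2 \<longrightarrow> row_of i = row_of j) \<and>
    (\<forall>i<num. \<forall>j<num. row_of i = row_of j \<longrightarrow> col_of j = (col_of i + 1) mod m \<longrightarrow> q i j = 2) \<and>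
    (\<forall>i<num. \<forall>j<num. i \<noteq> j \<longrightarrow> q i j < 2 \<longrightarrow> row_of j = nxt (row_of i) \<or> row_of i = nxt (row_of j)) \<and>
    (\<forall>i<num. \<exists>j<num. row_of j = nxt (row_of i) \<and> q i j < 2) \<and>
    (\<forall>r<R. T r \<longleftrightarrow> double_link q r (nxt r)) \<and>
    (\<forall>r<R. T r \<longleftrightarrow> double_link q (nxt r) r)"

lemma
  assumes "row_structure q T"
  shows row_structure_row: "\<And>i j. i < num \<Longrightarrow> j < num \<Longrightarrow> i \<noteq> j \<Longrightarrow> q i j = 2 \<Longrightarrow> row_of i = row_of j"
    and row_structure_2: "\<And>i j. i < num \<Longrightarrow> j < num \<Longrightarrow> row_of i = row_of j \<Longrightarrow> col_of j = (col_of i + 1) mod m \<Longrightarrow> q i j = 2"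
    and row_structure_adj: "\<And>i j. i < num \<Longrightarrow> j < num \<Longrightarrow> i \<noteq> j \<Longrightarrow> q i j < 2 \<Longrightarrow> row_of j = nxt (row_of i) \<or> row_of i = nxt (row_of j)"
    and row_structure_link: "\<And>i. i < num \<Longrightarrow> \<exists>j<num. row_of j = nxt (row_of i) \<and> q i j < 2"
    and row_structure_type: "\<And>r. r < R \<Longrightarrow> T r \<longleftrightarrow> double_link q r (nxt r)"
    and row_structure_type': "\<And>r. r < R \<Longrightarrow> T r \<longleftrightarrow> double_link q (nxt r) r"
proof -
  note c = assms[unfolded row_structure_def]
  show "\<And>i j. i < num \<Longrightarrow> j < num \<Longrightarrow> i \<noteq> j \<Longrightarrow> q i j = 2 \<Longrightarrow> row_of i = row_of j"
    by (rule conjunct1[OF c, rule_format])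
  note c = conjunct2[OF c]
  show "\<And>i j. i < num \<Longrightarrow> j < num \<Longrightarrow> row_of i = row_of j \<Longrightarrow> col_of j = (col_of i + 1) mod m \<Longrightarrow> q i j = 2"
    by (rule conjunct1[OF c, rule_format])
  note c = conjunct2[OF c]
  show "\<And>i j. i < num \<Longrightarrow> j < num \<Longrightarrow> i \<noteq> j \<Longrightarrow> q i j < 2 \<Longrightarrow> row_of j = nxt (row_of i) \<or> row_of i = nxt (row_of j)"
    by (rule conjunct1[OF c, rule_format])
  note c = conjunct2[OF c]
  show "\<And>i. i < num \<Longrightarrow> \<exists>j<num. row_of j = nxt (row_of i) \<and> q i j < 2"
    by (rule conjunct1[OF c, rule_format])
  note c = conjunct2[OF c]
  show "\<And>r. r < R \<Longrightarrow> T r \<longleftrightarrow> double_link q r (nxt r)"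
    by (rule conjunct1[OF c, rule_format])
  show "\<And>r. r < R \<Longrightarrow> T r \<longleftrightarrow> double_link q (nxt r) r"
    by (rule conjunct2[OF c, rule_format])
qed

text \<open>
Neighbours within a row are at squared distance \<open>2\<close>, so a distance-preserving relabelling moves
along a row from point to point without leaving the image row.
\<close>

lemma rows_preserved:
  assumes q: "row_structure q T" and q': "row_structure q' T'"
    and \<sigma>: "\<sigma> permutes {..<num}"
    and eq: "\<And>i j. i < num \<Longrightarrow> j < num \<Longrightarrow> q' i j = q (\<sigma> i) (\<sigma> j)"
    and ij: "i < num" "j < num" "row_of i = row_of j"
  shows "row_of (\<sigma> i) = row_of (\<sigma> j)"
proof -
  have \<sigma>_less: "\<sigma> a < num" if "a < num" for a
    using permutes_in_image[OF \<sigma>, of a] that by simp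
  have start: "row_of (\<sigma> (r * cols + k)) = row_of (\<sigma> (r * cols))" if r: "r < R" and "k < cols" for r k
    using \<open>k < cols\<close>
  proof (induction k)
    case (Suc k)
    let ?a = "r * cols + k" and ?b = "r * cols + Suc k"
    have a: "?a < num" "row_of ?a = r" "col_of ?a = int k"
      using row_col_ex[of r "int k"] r Suc.prems by (auto simp: m_cols)
    have b: "?b < num" "row_of ?b = r" "col_of ?b = int (Suc k)"
      using row_col_ex[of r "int (Suc k)"] r Suc.prems by (auto simp: m_cols nat_add_distrib)
    have "q' ?a ?b = 2"
      by (rule row_structure_2[OF q' a(1) b(1)]) (use a b Suc.prems in \<open>auto simp: m_cols\<close>)
    then have "q (\<sigma> ?a) (\<sigma> ?b) = 2" using eq a b by simp
    moreover have "\<sigma> ?a \<noteq> \<sigma> ?b" by (simp add: inj_eq[OF permutes_inj[OF \<sigma>]])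
    ultimately have "row_of (\<sigma> ?a) = row_of (\<sigma> ?b)"
      using row_structure_row[OF q \<sigma>_less[OF a(1)] \<sigma>_less[OF b(1)]] by blast
    then show ?case using Suc by simp
  qed simp
  have "row_of (\<sigma> a) = row_of (\<sigma> (row_of a * cols))" if "a < num" for a
  proof -
    have "nat (col_of a) < cols" using col_bounds[of a] by (simp add: m_cols)
    from start[OF row_less[OF that] this] show ?thesis by (simp add: row_col_inverse)
  qed
  then show ?thesis using ij by metis
qed

text \<open>
A distance-preserving relabelling induces an injection \<open>\<rho>\<close> of the rows that maps adjacent rows to
adjacent rows. By injectivity it cannot turn back, so it is determined by the image of row \<open>0\<close> and
the direction in which it proceeds.
\<close>

lemma types_preserved:
  assumes q: "row_structure q T" and q': "row_structure q' T'"
    and \<sigma>: "\<sigma> permutes {..<num}"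
    and eq: "\<And>i j. i < num \<Longrightarrow> j < num \<Longrightarrow> q' i j = q (\<sigma> i) (\<sigma> j)"
  obtains x where "x < R" "\<And>k. Suc k < R \<Longrightarrow> T' k = T ((nxt ^^ k) x)"
  | x where "x < R" "\<And>k. Suc k < R \<Longrightarrow> T' k = T ((prv ^^ Suc k) x)"
proof -
  define \<tau> where "\<tau> = inv \<sigma>"
  have \<tau>: "\<tau> permutes {..<num}" unfolding \<tau>_def by (rule permutes_inv[OF \<sigma>])
  have \<sigma>\<tau>: "\<sigma> (\<tau> i) = i" "\<tau> (\<sigma> i) = i" for i
    unfolding \<tau>_def using permutes_inverses[OF \<sigma>] by auto
  have \<sigma>_less: "\<sigma> a < num" if "a < num" for a
    using permutes_in_image[OF \<sigma>, of a] that by simp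
  have \<tau>_less: "\<tau> a < num" if "a < num" for a
    using permutes_in_image[OF \<tau>, of a] that by simp
  have eq2: "q i j = q' (\<tau> i) (\<tau> j)" if "i < num" "j < num" for i j
    using eq[OF \<tau>_less[OF that(1)] \<tau>_less[OF that(2)]] by (simp add: \<sigma>\<tau>)
  define \<rho> where "\<rho> r = row_of (\<sigma> (r * cols))" for r
  have base: "r * cols < num" "row_of (r * cols) = r" if "r < R" for r
    using row_col_ex[of r 0] that m_pos by auto
  have \<rho>: "row_of (\<sigma> i) = \<rho> (row_of i)" if "i < num" for i
    unfolding \<rho>_def
    by (rule rows_preserved[OF q q' \<sigma> eq that]) (use base row_less[OF that] in auto)
  have \<rho>_less: "\<rho> r < R" if "r < R" for r
    unfolding \<rho>_def by (intro row_less \<sigma>_less base that)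
  have row_inverse: "row_of (\<tau> i) = r" if "i < num" "r < R" "row_of i = \<rho> r" for i r
  proof -
    have "row_of (\<tau> i) = row_of (\<tau> (\<sigma> (r * cols)))"
      by (rule rows_preserved[OF q' q \<tau> eq2 that(1)]) (use that base \<sigma>_less in \<open>auto simp: \<rho>_def\<close>)
    then show ?thesis using base that by (simp add: \<sigma>\<tau>)
  qed
  have \<rho>_inj: "r = s" if "r < R" "s < R" "\<rho> r = \<rho> s" for r s
    using row_inverse[of "\<sigma> (r * cols)" r] row_inverse[of "\<sigma> (r * cols)" s] that base \<sigma>_less by (simp add: \<rho>_def)
  have adj: "\<rho> (nxt r) = nxt (\<rho> r) \<or> \<rho> r = nxt (\<rho> (nxt r))" if r: "r < R" for r
  proof -
    obtain j where j: "j < num" "row_of j = nxt r" "q' (r * cols) j < 2"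
      using row_structure_link[OF q' base(1)[OF r]] base(2)[OF r] by auto
    have "r * cols \<noteq> j" using j(2) base(2)[OF r] nxt_neq[OF r] by auto
    then have "\<sigma> (r * cols) \<noteq> \<sigma> j" by (simp add: inj_eq[OF permutes_inj[OF \<sigma>]])
    moreover have "q (\<sigma> (r * cols)) (\<sigma> j) < 2" using eq[OF base(1)[OF r] j(1)] j(3) by simp
    ultimately show ?thesis
      using row_structure_adj[OF q \<sigma>_less[OF base(1)[OF r]] \<sigma>_less[OF j(1)]] \<rho>[OF base(1)[OF r]] \<rho>[OF j(1)]
        j(2) base(2)[OF r] by simp
  qed
  have QQ: "double_link q' r s \<longleftrightarrow> double_link q (\<rho> r) (\<rho> s)" if "r < R" "s < R" for r s
  proof
    assume "double_link q' r s"
    then obtain i j j' where ij: "i < num" "j < num" "j' < num" "row_of i = r" "row_of j = s" "row_of j' = s"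
      "j \<noteq> j'" "q' i j < 2" "q' i j' < 2" unfolding double_link_def by blast
    have "\<sigma> j \<noteq> \<sigma> j'" using ij(7) by (simp add: inj_eq[OF permutes_inj[OF \<sigma>]])
    moreover have "q (\<sigma> i) (\<sigma> j) < 2" "q (\<sigma> i) (\<sigma> j') < 2"
      using ij(8,9) eq[OF ij(1,2)] eq[OF ij(1,3)] by simp_all
    moreover have "row_of (\<sigma> i) = \<rho> r" "row_of (\<sigma> j) = \<rho> s" "row_of (\<sigma> j') = \<rho> s"
      using \<rho>[OF ij(1)] \<rho>[OF ij(2)] \<rho>[OF ij(3)] ij(4-6) by simp_all
    ultimately show "double_link q (\<rho> r) (\<rho> s)"
      unfolding double_link_def using \<sigma>_less[OF ij(1)] \<sigma>_less[OF ij(2)] \<sigma>_less[OF ij(3)] by blast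
  next
    assume "double_link q (\<rho> r) (\<rho> s)"
    then obtain i j j' where ij: "i < num" "j < num" "j' < num" "row_of i = \<rho> r" "row_of j = \<rho> s" "row_of j' = \<rho> s"
      "j \<noteq> j'" "q i j < 2" "q i j' < 2" unfolding double_link_def by blast
    have "\<tau> j \<noteq> \<tau> j'" using ij(7) by (simp add: inj_eq[OF permutes_inj[OF \<tau>]])
    moreover have "q' (\<tau> i) (\<tau> j) < 2" "q' (\<tau> i) (\<tau> j') < 2"
      using ij(8,9) eq2[OF ij(1,2)] eq2[OF ij(1,3)] by simp_all
    moreover have "row_of (\<tau> i) = r" "row_of (\<tau> j) = s" "row_of (\<tau> j') = s"
      by (rule row_inverse[OF ij(1) that(1) ij(4)] row_inverse[OF ij(2) that(2) ij(5)] row_inverse[OF ij(3) that(2) ij(6)])+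
    ultimately show "double_link q' r s"
      unfolding double_link_def using \<tau>_less[OF ij(1)] \<tau>_less[OF ij(2)] \<tau>_less[OF ij(3)] by blast
  qed
  have T: "T r \<longleftrightarrow> double_link q r (nxt r)" "T r \<longleftrightarrow> double_link q (nxt r) r" "T' r \<longleftrightarrow> double_link q' r (nxt r)" if "r < R" for r
    by (rule row_structure_type[OF q that] row_structure_type'[OF q that] row_structure_type[OF q' that])+
  have nx: "nxt k = Suc k" if "Suc k < R" for k using that by (simp add: nxt_cases)
  have adj_Suc: "\<rho> (Suc k) = nxt (\<rho> k) \<or> \<rho> k = nxt (\<rho> (Suc k))" if "Suc k < R" for k
    using adj[OF Suc_lessD[OF that]] unfolding nx[OF that] .
  have QT: "T' k \<longleftrightarrow> double_link q (\<rho> k) (\<rho> (Suc k))" if "Suc k < R" for k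
    using T(3)[OF Suc_lessD[OF that]] QQ[OF Suc_lessD[OF that] that] unfolding nx[OF that] by blast
  show thesis
  proof (cases "\<rho> (Suc 0) = nxt (\<rho> 0)")
    case True
    have fwd: "\<rho> (Suc k) = nxt (\<rho> k)" if "Suc k < R" for k
      using that
    proof (induction k)
      case 0
      show ?case by (rule True)
    next
      case (Suc k)
      have IH: "\<rho> (Suc k) = nxt (\<rho> k)" by (rule Suc.IH[OF Suc_lessD[OF Suc.prems]])
      show ?case
      proof (rule ccontr)
        assume "\<not> ?thesis"
        then have "\<rho> (Suc k) = nxt (\<rho> (Suc (Suc k)))"
          using adj_Suc[OF Suc.prems] by blast
        from trans[OF sym[OF this] IH] have "\<rho> (Suc (Suc k)) = \<rho> k"
          by (rule inj_onD[OF inj_nxt]) (use \<rho>_less Suc.prems in simp_all)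
        then have "Suc (Suc k) = k" by (rule \<rho>_inj[rotated 2]) (use Suc.prems in simp_all)
        then show False by simp
      qed
    qed
    have pow: "k < R \<Longrightarrow> \<rho> k = (nxt ^^ k) (\<rho> 0)" for k
      by (induction k) (simp_all add: fwd)
    have "T' k = T ((nxt ^^ k) (\<rho> 0))" if "Suc k < R" for k
      using QT[OF that] T(1)[OF \<rho>_less[OF Suc_lessD[OF that]]]
      unfolding fwd[OF that] pow[OF Suc_lessD[OF that]] by blast
    with \<rho>_less[OF R_pos] show thesis by (rule that(1))
  next
    case False
    have bwd: "\<rho> k = nxt (\<rho> (Suc k))" if "Suc k < R" for k
      using that
    proof (induction k)
      case 0
      then show ?case using adj_Suc[of 0] False by blast
    next
      case (Suc k)
      have IH: "\<rho> k = nxt (\<rho> (Suc k))" by (rule Suc.IH[OF Suc_lessD[OF Suc.prems]])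
      show ?case
      proof (rule ccontr)
        assume "\<not> ?thesis"
        then have "\<rho> (Suc (Suc k)) = nxt (\<rho> (Suc k))"
          using adj_Suc[OF Suc.prems] by blast
        from trans[OF this sym[OF IH]] have "Suc (Suc k) = k"
          by (rule \<rho>_inj[rotated 2]) (use Suc.prems in simp_all)
        then show False by simp
      qed
    qed
    have step: "\<rho> (Suc k) = prv (\<rho> k)" if "Suc k < R" for k
      by (rule prv_unique[OF \<rho>_less[OF that] \<rho>_less[OF Suc_lessD[OF that]] sym[OF bwd[OF that]]])
    have pow: "k < R \<Longrightarrow> \<rho> k = (prv ^^ k) (\<rho> 0)" for k
      by (induction k) (simp_all add: step)
    have "T' k = T ((prv ^^ Suc k) (\<rho> 0))" if "Suc k < R" for k
    proof -
      have "T (\<rho> (Suc k)) \<longleftrightarrow> double_link q (\<rho> k) (\<rho> (Suc k))"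
        using T(2)[OF \<rho>_less[OF that]] bwd[OF that] by metis
      then show ?thesis using QT[OF that] pow[OF that] by metis
    qed
    with \<rho>_less[OF R_pos] show thesis by (rule that(2))
  qed
qed

context
  fixes \<delta> :: real and \<epsilon> :: "nat \<Rightarrow> real"
  assumes near_ideal: "near_ideal \<delta> \<epsilon>"
begin

lemma minus_1_mod: "- 1 mod m = m - 1"
  using zmod_minus1[OF m_pos] by simp

lemma gap_disp_sq_less_2:
  assumes r: "r < R" and t: "\<bar>cA r (nxt r) t\<bar> \<le> 1" "\<bar>cB t\<bar> \<le> 1" "t \<in> {0..<m}"
  shows "disp_sq (cA r (nxt r) t) (cB t) (\<epsilon> (nxt r) - \<epsilon> r) < 2"
proof -
  let ?e = "\<epsilon> (nxt r) - \<epsilon> r"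
  have \<delta>: "1/6 \<le> \<delta>" "\<delta> \<le> 9/50" using near_ideal by (auto simp: near_ideal_def)
  have e: "\<bar>?e - \<delta> * of_int (off (nxt r) - off r)\<bar> \<le> 1/100"
    by (rule near_ideal_diff[OF near_ideal r nxt_less])
  show ?thesis
  proof (cases "narrow r")
    case True
    then have "\<bar>?e - \<delta>\<bar> \<le> 1/100" using e narrow_gap(2)[OF r] by (simp del: of_int_diff)
    then have "\<delta> - 1/100 \<le> ?e" "?e \<le> \<delta> + 1/100" by linarith+
    then have e1: "0 \<le> ?e" "?e \<le> 1/5" using \<delta> by linarith+
    have "1 + 2 * x + 2 * (x * x) < 2" if "0 \<le> x" "x \<le> 1/5" for x :: real
      using that mult_mono[of x "1/5" x "1/5"] by simp
    from this[OF e1] have "1 + 2 * ?e + 2 * (?e * ?e) < 2" .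
    moreover have "disp_sq 1 0 ?e = 1 + 2 * ?e + 2 * (?e * ?e)" "disp_sq 0 (- 1) ?e = 1 + 2 * ?e + 2 * (?e * ?e)"
      unfolding disp_sq_def power2_eq_square by (simp_all add: algebra_simps)
    moreover have "t \<in> {t \<in> {0..<m}. \<bar>cA r (nxt r) t\<bar> \<le> 1 \<and> \<bar>cB t\<bar> \<le> 1}"
      using t by simp
    then have "t = 0 \<or> t = m - 1" unfolding near_narrow(1)[OF r True] by simp
    then have "cA r (nxt r) t = 1 \<and> cB t = 0 \<or> cA r (nxt r) t = 0 \<and> cB t = - 1"
      using near_narrow(2,3)[OF r True] cB_values by blast
    ultimately show ?thesis by auto
  next
    case False
    then have "\<bar>?e - \<delta> * (- 1)\<bar> \<le> 1/100" using e wide_gap(2)[OF r] by (simp del: of_int_diff)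
    then have "- \<delta> - 1/100 \<le> ?e" "?e \<le> - \<delta> + 1/100" by linarith+
    then have e1: "0 \<le> 1 + ?e" "1 + ?e \<le> 9/10" using \<delta> by linarith+
    have "2 * (x * x) < 2" if "0 \<le> x" "x \<le> 9/10" for x :: real
      using that mult_mono[of x "9/10" x "9/10"] by simp
    from this[OF e1] have "2 * ((1 + ?e) * (1 + ?e)) < 2" .
    moreover have "disp_sq 1 (- 1) ?e = 2 * ((1 + ?e) * (1 + ?e))"
      unfolding disp_sq_def power2_eq_square by (simp add: algebra_simps)
    moreover have "t \<in> {t \<in> {0..<m}. \<bar>cA r (nxt r) t\<bar> \<le> 1 \<and> \<bar>cB t\<bar> \<le> 1}"
      using t by simp
    then have "t = m - 1" unfolding near_wide(1)[OF r False] by simp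
    then have "cA r (nxt r) t = 1" "cB t = - 1"
      using near_wide(2)[OF r False] cB_values by blast+
    ultimately show ?thesis by simp
  qed
qed

lemma sep_sq_mod:
  "sep_sq \<epsilon> j i = disp_sq (cA (row_of i) (row_of j) ((col_of j - col_of i) mod m)) (cB ((col_of j - col_of i) mod m))
     (\<epsilon> (row_of j) - \<epsilon> (row_of i))"
  unfolding sep_sq_def sepA_def sepB_def cA_def cB_def by simp

lemma sep_sq_next_row:
  assumes ij: "i < num" "j < num" "row_of j = nxt (row_of i)"
  defines "t \<equiv> (col_of j - col_of i) mod m"
  shows "sep_sq \<epsilon> i j < 2 \<longleftrightarrow> t = m - 1 \<or> narrow (row_of i) \<and> t = 0"
    and "sep_sq \<epsilon> i j < 2 \<or> sep_sq \<epsilon> i j \<ge> 33/10"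
proof -
  let ?r = "row_of i"
  have r: "?r < R" by (rule row_less[OF ij(1)])
  have t: "t \<in> {0..<m}" using m_pos by (simp add: t_def)
  have z: "sep_sq \<epsilon> i j = disp_sq (cA ?r (nxt ?r) t) (cB t) (\<epsilon> (nxt ?r) - \<epsilon> ?r)"
    using sep_sq_mod[of j i] sep_sq_sym[of \<epsilon> i j] by (simp only: ij(3) t_def)
  have \<delta>: "1/6 \<le> \<delta>" "\<delta> \<le> 9/50" using near_ideal by (auto simp: near_ideal_def)
  have neq: "?r \<noteq> nxt ?r" using nxt_neq[OF r] by simp
  have nr: "near ?r (nxt ?r) t \<longleftrightarrow> t = m - 1 \<or> narrow ?r \<and> t = 0"
  proof -
    have "near ?r (nxt ?r) t \<longleftrightarrow> t \<in> {t \<in> {0..<m}. \<bar>cA ?r (nxt ?r) t\<bar> \<le> 1 \<and> \<bar>cB t\<bar> \<le> 1}"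
      using t by (simp add: near_def)
    moreover have "\<dots> \<longleftrightarrow> t = m - 1 \<or> narrow ?r \<and> t = 0"
    proof (cases "narrow ?r")
      case True
      then show ?thesis unfolding near_narrow(1)[OF r True] by auto
    next
      case False
      then show ?thesis unfolding near_wide(1)[OF r False] by simp
    qed
    ultimately show ?thesis by simp
  qed
  have 1: "sep_sq \<epsilon> i j < 2" if "near ?r (nxt ?r) t"
    unfolding z by (rule gap_disp_sq_less_2[OF r]) (use that t in \<open>auto simp: near_def\<close>)
  have 2: "sep_sq \<epsilon> i j \<ge> 33/10" if "\<not> near ?r (nxt ?r) t"
    unfolding z by (rule nonadjacent_far[OF r nxt_less neq \<delta> near_ideal_diff[OF near_ideal r nxt_less] that])
  have "sep_sq \<epsilon> i j < 2 \<longleftrightarrow> near ?r (nxt ?r) t"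
    using 1 2 by (cases "near ?r (nxt ?r) t") auto
  then show "sep_sq \<epsilon> i j < 2 \<longleftrightarrow> t = m - 1 \<or> narrow ?r \<and> t = 0" using nr by blast
  show "sep_sq \<epsilon> i j < 2 \<or> sep_sq \<epsilon> i j \<ge> 33/10"
    using 1 2 by blast
qed

lemma sep_sq_other_row:
  assumes ij: "i < num" "j < num" "row_of i \<noteq> row_of j"
  shows "sep_sq \<epsilon> i j < 2 \<and> (row_of j = nxt (row_of i) \<or> row_of i = nxt (row_of j)) \<or> sep_sq \<epsilon> i j \<ge> 33/10"
proof (cases "row_of j = nxt (row_of i) \<or> row_of i = nxt (row_of j)")
  case True
  then show ?thesis
    using sep_sq_next_row(2)[OF ij(1,2)] sep_sq_next_row(2)[OF ij(2,1)] sep_sq_sym[of \<epsilon> i j] by auto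
next
  case False
  have r: "row_of i < R" "row_of j < R" using ij row_less by auto
  have "33/10 \<le> sep_sq \<epsilon> i j"
    unfolding sep_sq_def sepA_def sepB_def
    by (rule nonadjacent_far[OF r(2,1) _ _ _ near_ideal_diff[OF near_ideal r(2,1)]])
       (use False ij near_ideal in \<open>auto simp: near_def near_ideal_def\<close>)
  then show ?thesis by simp
qed

lemma sep_sq_same_row:
  assumes "i < num" "j < num" "row_of i = row_of j" "i \<noteq> j"
  shows "sep_sq \<epsilon> i j \<ge> 2"
proof -
  have z: "sep_sq \<epsilon> i j = 2 * (of_int (sepB i j))\<^sup>2"
    using assms(3) by (simp add: sep_sq_def disp_sq_def sepA_def sepB_def cA_def cB_def)
  have "sepB i j \<noteq> 0" using sep_sq_pos[OF near_ideal assms(1,2,4)] z by auto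
  then have "1 \<le> \<bar>sepB i j\<bar>" by linarith
  then have "(1::real) \<le> \<bar>of_int (sepB i j)\<bar>" by linarith
  then have "1 \<le> \<bar>of_int (sepB i j) :: real\<bar>\<^sup>2" by (rule one_le_power)
  then show ?thesis unfolding z by simp
qed

lemma config_row_structure: "row_structure (sep_sq \<epsilon>) narrow"
  unfolding row_structure_def
proof (intro conjI allI impI)
  fix i j assume ij: "i < num" "j < num"
  { assume "i \<noteq> j" "sep_sq \<epsilon> i j = 2"
    then show "row_of i = row_of j" using sep_sq_other_row[OF ij] by fastforce }
  { assume r: "row_of i = row_of j" and c: "col_of j = (col_of i + 1) mod m"
    have "sepB i j = - 1"
      unfolding sepB_def cB_def
    proof (rule centred_mod_unique[OF odd_m m_pos])
      have "- 1 - (col_of i - col_of j) = col_of j - (col_of i + 1)" by simp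
      then show "m dvd - 1 - (col_of i - col_of j)" unfolding c
        by (metis dvd_minus_iff minus_diff_eq dvd_minus_mod)
    qed (use m_ge in simp)
    then show "sep_sq \<epsilon> i j = 2"
      using r by (simp add: sep_sq_def disp_sq_def sepA_def sepB_def cA_def cB_def) }
  { assume "i \<noteq> j" "sep_sq \<epsilon> i j < 2"
    then show "row_of j = nxt (row_of i) \<or> row_of i = nxt (row_of j)"
      using sep_sq_other_row[OF ij] sep_sq_same_row[OF ij] by fastforce }
next
  fix i assume i: "i < num"
  let ?k = "(col_of i - 1) mod m"
  let ?j = "nxt (row_of i) * cols + nat ?k"
  have j: "?j < num" "row_of ?j = nxt (row_of i)" "col_of ?j = ?k"
    using row_col_ex[of "nxt (row_of i)" ?k] nxt_less m_pos by auto
  have "(col_of ?j - col_of i) mod m = (- 1) mod m" unfolding j(3) by (simp add: mod_simps)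
  also have "\<dots> = m - 1" by (rule minus_1_mod)
  finally have "sep_sq \<epsilon> i ?j < 2" using sep_sq_next_row(1)[OF i j(1,2)] by blast
  then show "\<exists>j<num. row_of j = nxt (row_of i) \<and> sep_sq \<epsilon> i j < 2" using j by blast
next
  fix r assume r: "r < R"
  have inj: "j = j'" if "row_of j = row_of j'" "(col_of j - c) mod m = (col_of j' - c) mod m" for j j' c
  proof -
    have "col_of j mod m = col_of j' mod m"
      using that(2) by (metis diff_add_cancel mod_add_left_eq)
    then show ?thesis using that(1) row_col_inject col_bounds by simp
  qed
  have inj2: "j = j'" if "row_of j = row_of j'" "(c - col_of j) mod m = (c - col_of j') mod m" for j j' c
  proof -
    have "(c - (c - col_of j)) mod m = (c - (c - col_of j')) mod m"
      using that(2) by (metis mod_diff_right_eq)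
    then have "col_of j mod m = col_of j' mod m" by simp
    then show ?thesis using that(1) row_col_inject col_bounds by simp
  qed
  have pts: "r * cols + nat k < num" "row_of (r * cols + nat k) = r" "col_of (r * cols + nat k) = k"
    if "r < R" "k \<in> {0, 1, m - 1}" for r k
    using row_col_ex[of r k] that m_ge by auto
  show "narrow r \<longleftrightarrow> double_link (sep_sq \<epsilon>) r (nxt r)"
  proof
    assume n: "narrow r"
    let ?i = "r * cols + nat 0" and ?j = "nxt r * cols + nat 0" and ?j' = "nxt r * cols + nat (m - 1)"
    have "sep_sq \<epsilon> ?i ?j < 2" "sep_sq \<epsilon> ?i ?j' < 2"
      using sep_sq_next_row(1)[of ?i ?j] sep_sq_next_row(1)[of ?i ?j'] n pts[OF r, of 0]
        pts[OF nxt_less, of 0 r] pts[OF nxt_less, of "m - 1" r] minus_1_mod by simp_all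
    moreover have "?j \<noteq> ?j'" using m_ge by simp
    ultimately show "double_link (sep_sq \<epsilon>) r (nxt r)"
      unfolding double_link_def
      using pts[OF r, of 0] pts[OF nxt_less, of 0 r] pts[OF nxt_less, of "m - 1" r] by blast
  next
    assume "double_link (sep_sq \<epsilon>) r (nxt r)"
    then obtain i j j' where ij: "i < num" "j < num" "j' < num" "row_of i = r" "row_of j = nxt r"
      "row_of j' = nxt r" "j \<noteq> j'" "sep_sq \<epsilon> i j < 2" "sep_sq \<epsilon> i j' < 2" unfolding double_link_def by blast
    show "narrow r"
    proof (rule ccontr)
      assume "\<not> narrow r"
      then have "(col_of j - col_of i) mod m = m - 1" "(col_of j' - col_of i) mod m = m - 1"
        using sep_sq_next_row(1)[of i j] sep_sq_next_row(1)[of i j'] ij by auto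
      then show False using inj[of j j' "col_of i"] ij by simp
    qed
  qed
  show "narrow r \<longleftrightarrow> double_link (sep_sq \<epsilon>) (nxt r) r"
  proof
    assume n: "narrow r"
    let ?i = "nxt r * cols + nat 0" and ?j = "r * cols + nat 0" and ?j' = "r * cols + nat 1"
    have "sep_sq \<epsilon> ?j ?i < 2" "sep_sq \<epsilon> ?j' ?i < 2"
      using sep_sq_next_row(1)[of ?j ?i] sep_sq_next_row(1)[of ?j' ?i] n pts[OF r, of 0]
        pts[OF r, of 1] pts[OF nxt_less, of 0 r] minus_1_mod by simp_all
    then have "sep_sq \<epsilon> ?i ?j < 2" "sep_sq \<epsilon> ?i ?j' < 2" using sep_sq_sym by metis+
    moreover have "?j \<noteq> ?j'" by simp
    ultimately show "double_link (sep_sq \<epsilon>) (nxt r) r"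
      unfolding double_link_def
      using pts[OF r, of 0] pts[OF r, of 1] pts[OF nxt_less, of 0 r] by blast
  next
    assume "double_link (sep_sq \<epsilon>) (nxt r) r"
    then obtain i j j' where ij: "i < num" "j < num" "j' < num" "row_of i = nxt r" "row_of j = r"
      "row_of j' = r" "j \<noteq> j'" "sep_sq \<epsilon> i j < 2" "sep_sq \<epsilon> i j' < 2" unfolding double_link_def by blast
    have "sep_sq \<epsilon> j i < 2" "sep_sq \<epsilon> j' i < 2" using ij sep_sq_sym by metis+
    show "narrow r"
    proof (rule ccontr)
      assume "\<not> narrow r"
      then have "(col_of i - col_of j) mod m = m - 1" "(col_of i - col_of j') mod m = m - 1"
        using sep_sq_next_row(1)[of j i] sep_sq_next_row(1)[of j' i] ij \<open>sep_sq \<epsilon> j i < 2\<close> \<open>sep_sq \<epsilon> j' i < 2\<close> by auto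
      then show False using inj2[of j j' "col_of i"] ij by simp
    qed
  qed
qed

end

section \<open>Counting the classes\<close>

text \<open>
The set \<open>S'\<close> that is read off from the gaps of the present configuration when starting at row \<open>x\<close>
and proceeding upwards or downwards. It suffices to look at the gaps following even rows, which are
wide precisely for the blocks in \<open>S'\<close>.
\<close>

definition decode :: "nat \<times> bool \<Rightarrow> nat set" where
  "decode = (\<lambda>(x, up). {j. j < J \<and> \<not> narrow (if up then (nxt ^^ (2 * j)) x else (prv ^^ Suc (2 * j)) x)})"

lemma config_equiv_decode:
  assumes \<epsilon>: "near_ideal \<delta> \<epsilon>" and S': "S' \<subseteq> {..<J}" and \<epsilon>': "diagonal_rows.near_ideal J S' \<delta>' \<epsilon>'"
    and equiv: "(config \<epsilon>, diagonal_rows.config J S' \<epsilon>') \<in> config_equiv num"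
  shows "S' \<in> decode ` ({..<R} \<times> UNIV)"
proof -
  interpret B: diagonal_rows J S' by unfold_locales (rule odd_J J_ge)+
  obtain \<sigma> \<phi> where \<sigma>: "\<sigma> permutes {..<num}" and \<phi>: "torus_isometry \<phi>"
    and y: "\<And>i. i < num \<Longrightarrow> B.config \<epsilon>' i = \<phi> (config \<epsilon> (\<sigma> i))"
    using equiv unfolding config_equiv_def by blast
  have eq: "B.sep_sq \<epsilon>' i j = sep_sq \<epsilon> (\<sigma> i) (\<sigma> j)" if "i < num" "j < num" for i j
  proof -
    have \<sigma>_less: "\<sigma> i < num" "\<sigma> j < num"
      using permutes_in_image[OF \<sigma>] that by simp_all
    have "dist (B.config \<epsilon>' i) (B.config \<epsilon>' j) = dist (config \<epsilon> (\<sigma> i)) (config \<epsilon> (\<sigma> j))"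
      using y[OF that(1)] y[OF that(2)] \<phi> by (simp add: torus_isometry_def)
    then have "sqrt (B.sep_sq \<epsilon>' i j) / of_int m = sqrt (sep_sq \<epsilon> (\<sigma> i) (\<sigma> j)) / of_int m"
      unfolding B.dist_config[OF \<epsilon>' that] dist_config[OF \<epsilon> \<sigma>_less] .
    then show ?thesis using m_pos by simp
  qed
  have sets: "S' = {j. j < J \<and> \<not> B.narrow (2 * j)}"
    using S' by (auto simp: B.diag_simps)
  have lt: "Suc (2 * j) < R" if "j < J" for j using that by (simp add: R_def)
  show ?thesis
  proof (rule types_preserved[OF config_row_structure[OF \<epsilon>] B.config_row_structure[OF \<epsilon>'] \<sigma> eq])
    fix x assume x: "x < R" "\<And>k. Suc k < R \<Longrightarrow> B.narrow k = narrow ((nxt ^^ k) x)"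
    have "{j. j < J \<and> \<not> B.narrow (2 * j)} = decode (x, True)"
      unfolding decode_def prod.case if_True using x(2)[OF lt] by blast
    with sets have "S' = decode (x, True)" by (rule trans)
    then show ?thesis using x(1) by blast
  next
    fix x assume x: "x < R" "\<And>k. Suc k < R \<Longrightarrow> B.narrow k = narrow ((prv ^^ Suc k) x)"
    have "{j. j < J \<and> \<not> B.narrow (2 * j)} = decode (x, False)"
      unfolding decode_def prod.case if_False using x(2)[OF lt] by blast
    with sets have "S' = decode (x, False)" by (rule trans)
    then show ?thesis using x(1) by blast
  qed
qed

lemma narrow_psi_lower:
  assumes "1/6 \<le> \<delta>" "\<delta> \<le> 9/50" "p \<ge> 0"
  shows "narrow_psi (p / 2 + 1) \<delta> \<ge> 9/10 * (1781/1250) powr (- p / 2)"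
proof -
  let ?q = "1 + 2 * \<delta> + 2 * \<delta>\<^sup>2" and ?b = "1781/1250 :: real"
  have q0: "?q > 0" using assms by (intro add_pos_nonneg) auto
  have "\<delta>\<^sup>2 \<le> (9/50)\<^sup>2" using assms by (intro power_mono) auto
  then have q: "?q \<le> ?b" using assms(2) by (simp add: power2_eq_square)
  have "9/10 \<le> 4/3 * ?b powr (- 1)" by (simp add: powr_minus_divide)
  from mult_right_mono[OF this powr_ge_zero[of ?b "- p / 2"]]
  have "9/10 * ?b powr (- p / 2) \<le> 4/3 * (?b powr (- 1) * ?b powr (- p / 2))"
    by (simp only: mult.assoc)
  also have "?b powr (- 1) * ?b powr (- p / 2) = ?b powr (- (p / 2 + 1))"
    by (simp only: powr_add[symmetric]) (simp add: algebra_simps)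
  also have "4/3 * ?b powr (- (p / 2 + 1)) \<le> (1 + 2 * \<delta>) * ?q powr (- (p / 2 + 1))"
    using assms q q0 by (intro mult_mono powr_mono2') auto
  finally show ?thesis by (simp add: narrow_psi_def)
qed

lemma exp_41_50: "exp (41/50 :: real) \<le> 165/72"
proof -
  \<comment> \<open>the quadratic bound for \<open>exp\<close> is sharp enough only close to zero, hence the 64-th root\<close>
  have "exp (41/3200 :: real) \<le> 1 + 41/3200 + (41/3200)\<^sup>2"
    by (rule exp_bound) auto
  also have "\<dots> \<le> 1013/1000" by (simp add: power2_eq_square)
  finally have "exp (41/3200 :: real) ^ 64 \<le> (1013/1000) ^ 64"
    by (rule power_mono) simp
  also have "\<dots> \<le> 165/72" by (simp add: power_divide)
  also have "exp (41/3200 :: real) ^ 64 = exp (41/50)"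
    by (simp add: exp_of_nat_mult[symmetric])
  finally show ?thesis .
qed

text \<open>
The left-hand side is of order \<open>J ^ 3 * 3.3 powr (- p / 2)\<close> and the right-hand side is at least of
order \<open>J powr (- 1) * 1.4248 powr (- p / 2)\<close>, where \<open>1.4248\<close> is the squared distance of nearest
points for \<open>\<delta> = 9/50\<close>. Their quotient is controlled by \<open>J ^ 4\<close>, that is \<open>n\<^sup>2\<close>, against
\<open>(3.3 / 1.4248) powr (p / 2)\<close>, which for \<open>p > 5 * ln n\<close> exceeds \<open>n powr 2.05\<close>. The spare factor
\<open>n powr 0.05\<close> has to absorb the constant \<open>75\<close>, whence the bound \<open>75 ^ 10\<close> on \<open>J\<close>.
\<close>

lemma far_force_small:
  assumes J: "J \<ge> 75 ^ 10" and p: "p > 5 * ln (real num)" and \<delta>: "1/6 \<le> \<delta>" "\<delta> \<le> 9/50"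
  shows "p \<ge> 22" "real R * real R * of_int m * (33/10) powr (- p / 2)
        < 4 * (narrow_psi (p / 2 + 1) \<delta> * (1 - exp (- tol)))"
proof -
  let ?b = "1781/1250 :: real" and ?n = "real num"
  have "real J \<ge> real (75 ^ 10)" using J by (simp only: of_nat_le_iff)
  then have J': "real J \<ge> 75 ^ 10" by (simp only: of_nat_power of_nat_numeral)
  have n: "?n = 6 * (real J)\<^sup>2" by (simp add: num_eq)
  have "((75 :: real) ^ 10)\<^sup>2 \<le> (real J)\<^sup>2" using J' by (intro power_mono) auto
  then have n75: "75 ^ 20 \<le> ?n" unfolding n by (simp add: power_mult[symmetric])
  then have n0: "?n > 0" by (rule less_le_trans[rotated]) simp
  have "20 * ln (75 :: real) = ln (75 ^ 20)" by (rule sym, subst ln_realpow) simp_all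
  also have "\<dots> \<le> ln ?n" using n75 by (subst ln_le_cancel_iff) (use n0 in auto)
  finally have ln: "20 * ln (75 :: real) \<le> ln ?n" .
  have ln1: "1 \<le> ln (75 :: real)"
    using exp_le by (subst ln_ge_iff) auto
  show p22: "p \<ge> 22" using p ln ln1 by linarith
  have "75 * ?n\<^sup>2 \<le> exp (ln ?n / 20) * exp (2 * ln ?n)"
  proof (rule mult_mono)
    have "75 = exp (ln (75 :: real))" by simp
    also have "\<dots> \<le> exp (ln ?n / 20)" using ln by (subst exp_le_cancel_iff) simp
    finally show "75 \<le> exp (ln ?n / 20)" .
    show "?n\<^sup>2 \<le> exp (2 * ln ?n)"
      using n0 by (simp add: exp_double)
  qed auto
  also have "\<dots> = exp (41/100 * (5 * ln ?n))" by (simp add: exp_add[symmetric])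
  also have "\<dots> \<le> exp (41/50 * (p / 2))" using p by simp
  also have "\<dots> = exp (41/50) powr (p / 2)" by (simp add: powr_def)
  also have "\<dots> \<le> (165/72) powr (p / 2)"
    using exp_41_50 p22 by (intro powr_mono2) auto
  also have "\<dots> \<le> (33/10 / ?b) powr (p / 2)"
    using p22 by (intro powr_mono2) auto
  also have "\<dots> = (33/10) powr (p / 2) / ?b powr (p / 2)"
    by (simp only: powr_divide)
  finally have "75 * ?n\<^sup>2 \<le> (33/10) powr (p / 2) / ?b powr (p / 2)" .
  then have "75 * ?n\<^sup>2 * ?b powr (p / 2) \<le> (33/10) powr (p / 2)"
    by (simp add: field_simps)
  then have "75 * ?n\<^sup>2 * (33/10) powr (- p / 2) \<le> ?b powr (- p / 2)"
    by (simp add: powr_minus field_simps)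
  then have main: "2700 * (real J)^4 * (33/10) powr (- p / 2) \<le> ?b powr (- p / 2)"
    unfolding n by (simp add: power_mult_distrib power_mult[symmetric])
  have J0: "real J > 0" using J_ge by simp
  have tol: "tol = 1 / (400 * real J)" by (simp add: tol_def R_def)
  have tol1: "0 < tol" "tol \<le> 1" using J_ge by (simp_all add: tol field_simps)
  have "exp (- tol) \<le> 1 / (1 + tol)"
    using exp_ge_add_one_self[of tol] tol1 by (simp add: exp_minus field_simps)
  also have "\<dots> \<le> 1 - tol / 2" using tol1 by (simp add: field_simps)
  finally have e: "tol / 2 \<le> 1 - exp (- tol)" by simp
  have "real R * real R * of_int m * (33/10) powr (- p / 2) = 12 * (real J)^3 * (33/10) powr (- p / 2)"
    by (simp add: R_def m_def power3_eq_cube)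
  also have "\<dots> = (2700 * (real J)^4 * (33/10) powr (- p / 2)) * (12 / (2700 * real J))"
    using J0 by (simp add: power4_eq_xxxx power3_eq_cube)
  also have "\<dots> \<le> ?b powr (- p / 2) * (12 / (2700 * real J))"
    using main J0 by (intro mult_right_mono) auto
  also have "\<dots> = (12/2700) * ?b powr (- p / 2) / real J" by simp
  also have "\<dots> < (36/8000) * ?b powr (- p / 2) / real J"
    using J0 by (intro divide_strict_right_mono mult_strict_right_mono) auto
  also have "\<dots> = 4 * ((9/10 * ?b powr (- p / 2)) * (tol / 2))"
    by (simp add: tol)
  also have "\<dots> \<le> 4 * (narrow_psi (p / 2 + 1) \<delta> * (1 - exp (- tol)))"
  proof (rule mult_left_mono)
    have low: "9/10 * ?b powr (- p / 2) \<le> narrow_psi (p / 2 + 1) \<delta>"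
      by (rule narrow_psi_lower[OF \<delta>]) (use p22 in simp)
    have "0 \<le> 9/10 * ?b powr (- p / 2)" by simp
    then have "0 \<le> narrow_psi (p / 2 + 1) \<delta>" using low by (rule order_trans)
    then show "9/10 * ?b powr (- p / 2) * (tol / 2) \<le> narrow_psi (p / 2 + 1) \<delta> * (1 - exp (- tol))"
      using tol1 by (intro mult_mono low e) auto
  qed simp
  finally show "real R * real R * of_int m * (33/10) powr (- p / 2)
        < 4 * (narrow_psi (p / 2 + 1) \<delta> * (1 - exp (- tol)))" .
qed

lemma critical_config_exists:
  assumes "J \<ge> 75 ^ 10" "p > 5 * ln (real num)"
  shows "\<exists>\<epsilon> \<delta>. near_ideal \<delta> \<epsilon> \<and> config \<epsilon> \<in> critical_points p num"
proof -
  note f = far_force_small[OF assms]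
  have p: "p \<ge> 22" using f(1)[of "1/6"] by simp
  from equilibrium[OF p f(2)] obtain \<delta> \<epsilon> where "near_ideal \<delta> \<epsilon>"
    "\<And>r. r < R \<Longrightarrow> (\<Sum>r'\<in>{..<R} - {r}. force p r r' (\<epsilon> r' - \<epsilon> r)) = 0" by blast
  then show ?thesis using config_critical[of \<delta> \<epsilon> p] p by fastforce
qed

end

lemma card_le_fibres:
  assumes "finite A" "\<And>a. a \<in> A \<Longrightarrow> card {x \<in> A. f x = f a} \<le> k"
  shows "card A \<le> k * card (f ` A)"
proof -
  have "card A = (\<Sum>y\<in>f ` A. card {x \<in> A. f x = y})"
    using sum.image_gen[OF assms(1), of "\<lambda>_. 1 :: nat" f] by simp
  also have "\<dots> \<le> (\<Sum>y\<in>f ` A. k)"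
    using assms(2) by (intro sum_mono) auto
  finally show ?thesis by (simp add: mult.commute)
qed

text \<open>
For each pattern \<open>S\<close> one critical configuration is chosen. The patterns whose configurations lie in
the class of a given one are all obtained by \<open>decode\<close> from \<open>R\<close> starting rows and two directions.
\<close>

lemma many_critical_classes:
  assumes J: "odd J" "J \<ge> 75 ^ 10" and n: "n = 6 * J\<^sup>2" and p: "p > 5 * ln (real n)"
    and fin: "finite (critical_points p n // config_equiv n)"
  shows "2 ^ J \<le> 4 * J * card (critical_points p n // config_equiv n)"
proof -
  have J3: "J \<ge> 3" using J(2) by (rule order_trans[rotated]) simp
  have loc: "diagonal_rows J" by unfold_locales (rule J(1) J3)+
  interpret E: diagonal_rows J "{}" by (rule loc)
  have num: "E.num = n" by (simp add: n E.num_eq)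
  have "\<forall>S. \<exists>\<epsilon> \<delta>. diagonal_rows.near_ideal J S \<delta> \<epsilon> \<and> diagonal_rows.config J S \<epsilon> \<in> critical_points p n"
    using diagonal_rows.critical_config_exists[OF loc J(2), of p] p unfolding num by blast
  then obtain \<epsilon> \<delta> where \<epsilon>: "\<And>S. diagonal_rows.near_ideal J S (\<delta> S) (\<epsilon> S)"
    "\<And>S. diagonal_rows.config J S (\<epsilon> S) \<in> critical_points p n" by metis
  define X where "X S = diagonal_rows.config J S (\<epsilon> S)" for S
  define f where "f S = config_equiv n `` {X S}" for S
  have XC: "X S \<in> configs n" for S using \<epsilon>(2)[of S] by (simp add: X_def critical_points_def)
  have "card {S' \<in> Pow {..<J}. f S' = f S} \<le> 4 * J" for S
  proof -
    have "{S' \<in> Pow {..<J}. f S' = f S} \<subseteq> diagonal_rows.decode J S ` ({..<E.R} \<times> UNIV)"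
    proof
      fix S' assume "S' \<in> {S' \<in> Pow {..<J}. f S' = f S}"
      then have S': "S' \<subseteq> {..<J}" "f S = f S'" by auto
      then have "(X S, X S') \<in> config_equiv n"
        unfolding f_def using eq_equiv_class_iff[OF equiv_config_equiv XC XC] by blast
      then show "S' \<in> diagonal_rows.decode J S ` ({..<E.R} \<times> UNIV)"
        using diagonal_rows.config_equiv_decode[OF loc \<epsilon>(1) S'(1) \<epsilon>(1)] unfolding num X_def by blast
    qed
    then have "card {S' \<in> Pow {..<J}. f S' = f S} \<le> card ({..<E.R} \<times> (UNIV :: bool set))"
      by (rule surj_card_le[rotated]) simp
    then show ?thesis by (simp add: E.R_def card_cartesian_product)
  qed
  then have "card (Pow {..<J}) \<le> 4 * J * card (f ` Pow {..<J})"
    by (intro card_le_fibres) auto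
  also have "card (f ` Pow {..<J}) \<le> card (critical_points p n // config_equiv n)"
    using \<epsilon>(2) by (intro card_mono fin) (auto simp: f_def X_def intro: quotientI)
  finally show ?thesis by (simp add: card_Pow)
qed

theorem theorem1:
  shows "\<exists>(c1::real) (c2::real) (A::nat set). c1 > 0 \<and> c2 > 0 \<and> infinite A \<and>
    (\<forall>n\<in>A. \<forall>p::real. p > 5 * ln (real n) \<longrightarrow>
      infinite (critical_points p n // config_equiv n) \<or>
      real (card (critical_points p n // config_equiv n)) \<ge> c1 * exp (c2 * sqrt (real n)))"
proof -
  define A where "A = (\<lambda>J::nat. 6 * J\<^sup>2) ` {J. odd J \<and> J \<ge> 75 ^ 10}"
  have "infinite {J::nat. odd J \<and> J \<ge> 75 ^ 10}"
    unfolding infinite_nat_iff_unbounded_le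
  proof
    fix k :: nat
    show "\<exists>J\<ge>k. J \<in> {J. odd J \<and> J \<ge> 75 ^ 10}"
      by (intro exI[of _ "2 * (k + 75 ^ 10) + 1"]) simp
  qed
  moreover have "inj_on (\<lambda>J::nat. 6 * J\<^sup>2) {J. odd J \<and> J \<ge> 75 ^ 10}"
    by (rule inj_onI) simp
  ultimately have A: "infinite A" unfolding A_def by (simp add: finite_image_iff)
  have "real (card (critical_points p n // config_equiv n)) \<ge> 1/32 * exp (1/10 * sqrt (real n))"
    if nA: "n \<in> A" and p: "p > 5 * ln (real n)" and fin: "finite (critical_points p n // config_equiv n)" for n p
  proof -
    obtain J where J: "odd J" "J \<ge> 75 ^ 10" "n = 6 * J\<^sup>2" using nA by (auto simp: A_def)
    let ?c = "real (card (critical_points p n // config_equiv n))"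
    have J0: "real J > 0" using J(1) by (auto intro: Nat.gr0I)
    have "real (2 ^ J) \<le> real (4 * J * card (critical_points p n // config_equiv n))"
      using many_critical_classes[OF J p fin] by (simp only: of_nat_le_iff)
    then have *: "2 ^ J \<le> 4 * real J * ?c" by simp
    have "sqrt (real n) = sqrt 6 * real J" by (simp add: J(3) real_sqrt_mult)
    also have "\<dots> \<le> 5/2 * real J" by (intro mult_right_mono real_le_lsqrt) (auto simp: power2_eq_square)
    finally have s: "1/10 * sqrt (real n) \<le> real J / 4" by simp
    \<comment> \<open>the factor \<open>4 * J\<close> is absorbed by \<open>32 * exp (J / 8)\<close>, whence the constant \<open>1/32\<close>\<close>
    have "real J / 8 \<le> exp (real J / 8)"
      using exp_ge_add_one_self[of "real J / 8"] by linarith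
    then have "1/32 * exp (1/10 * sqrt (real n)) * (4 * real J) \<le> 1/32 * exp (real J / 4) * (32 * exp (real J / 8))"
      using s by (intro mult_mono[OF mult_left_mono]) auto
    also have "\<dots> = exp (3/8) ^ J"
      by (simp add: exp_of_nat_mult[symmetric] exp_add[symmetric])
    also have "\<dots> \<le> 2 ^ J"
    proof (rule power_mono)
      have "exp (3/8 :: real) \<le> 1 + 3/8 + (3/8)\<^sup>2" by (rule exp_bound) auto
      also have "\<dots> \<le> 2" by (simp add: power2_eq_square)
      finally show "exp (3/8 :: real) \<le> 2" .
    qed simp
    also have "\<dots> \<le> ?c * (4 * real J)" using * by (simp add: mult.commute)
    finally show ?thesis using J0 by (simp add: mult_le_cancel_right)
  qed
  then have "\<forall>n\<in>A. \<forall>p::real. p > 5 * ln (real n) \<longrightarrow>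
      infinite (critical_points p n // config_equiv n) \<or>
      real (card (critical_points p n // config_equiv n)) \<ge> 1/32 * exp (1/10 * sqrt (real n))"
    by blast
  then show ?thesis using A by (intro exI[of _ "1/32"] exI[of _ "1/10"] exI[of _ A]) simp
qed

end
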